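(* Let $(H,\sigma)$ be sampled from $\mathcal H(n,d,p_n,q_n)$, with self-avoiding matrices $B^{(l)}$, and let $\Delta^{(l)}$ and $\overline A$ be as in the context. Then there exist random $n\times n$ matrices $\Gamma^{(l,m)}$, $1\le m\le l$ (functions of $(H,\sigma)$), such that: (1) for every $l\ge1$, $$B^{(l)}=\Delta^{(l)}+\sum_{m=1}^l \Delta^{(l-m)}\overline A B^{(m-1)}-\sum_{m=1}^l\Gamma^{(l,m)};$$ (2) for any sequence $l_n=O(\log n)$ and any fixed $\epsilon>0$, $$\lim_{n\to\infty}\mathbb P_{\mathcal H_n}\big(\rho(\Delta^{(l_n)})\le n^{\epsilon}\alpha^{l_n/2}\big)=1,\qquad \lim_{n\to\infty}\mathbb P_{\mathcal H_n}\Big(\bigcap_{m=1}^{l_n}\big\{\rho(\Gamma^{(l_n,m)})\le n^{\epsilon-1}\alpha^{(l_n+m)/2}\big\}\Big)=1.$$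
   Context: Fix an integer $d\ge3$ and constants $a\ge b>0$; $p_n=a/\binom{n}{d-1}$, $q_n=b/\binom{n}{d-1}$. Under $\mathcal H(n,d,p_n,q_n)$, $\sigma\in\{-1,+1\}^n$ has i.i.d. uniform entries, and given $\sigma$ each $d$-subset $e\subset[n]$ is independently a hyperedge of $H$ with probability $p_n$ if all spins in $e$ agree and $q_n$ otherwise; $\mathbb P_{\mathcal H_n},\mathbb E_{\mathcal H_n}$ denote probability/expectation under this law. $\alpha=(d-1)\frac{a+(2^{d-1}-1)b}{2^{d-1}}$; throughout $\alpha>1$ and $\beta=(d-1)\frac{a-b}{2^{d-1}}>1$. $\rho(M)=\sup_{\|x\|_2=1}\|Mx\|_2$ is the spectral norm. For a $d$-subset $e$ and $i\ne j$, $A^e_{ij}=1$ if $\{i,j\}\subset e$ and $e$ is a hyperedge of $H$, and $0$ otherwise; $A^e_{ii}=0$. The adjacency matrix is $A_{ij}=\sum_e A^e_{ij}$, and $\overline A=\mathbb E_{\mathcal H_n}[A\mid\sigma]$, $\overline A^e_{ij}=\mathbb E_{\mathcal H_n}[A^e_{ij}\mid\sigma]$. A walk of length $l$ is $(i_0,e_1,i_1,\dots,e_l,i_l)$ with $i_{j-1}\ne i_j$, $\{i_{j-1},i_j\}\subset e_j$; it is self-avoiding if $i_0,\dots,i_l$ are distinct, $e_{j-1}\cap e_j=\{i_{j-1}\}$ for $2\le j\le l$, and $e_j\cap e_k=\emptyset$ for $k\ge j+2$. $\mathrm{SAW}_{ij}$ is the set of self-avoiding walks of length $l$ from $i$ to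 $j$ in the complete $d$-uniform hypergraph on $[n]$ (all $d$-subsets are hyperedges). For $l\ge1$, $B^{(l)}_{ij}=\sum_{w\in \mathrm{SAW}_{ij}}\prod_{t=1}^l A^{e_t}_{i_{t-1}i_t}$ for $i\ne j$ (the number of self-avoiding walks of length $l$ from $i$ to $j$ in $H$) and $B^{(l)}_{ii}=0$; and $\Delta^{(l)}_{ij}=\sum_{w\in\mathrm{SAW}_{ij}}\prod_{t=1}^l(A^{e_t}_{i_{t-1}i_t}-\overline A^{e_t}_{i_{t-1}i_t})$, where $w=(i_0,e_1,\dots,e_l,i_l)$. For $l=0$ the only self-avoiding walk of length $0$ from $i$ to $j$ is $(i)$ when $i=j$ (none otherwise), so $B^{(0)}=\Delta^{(0)}=I$. *)

theory Defs
  imports "HOL-Analysis.Analysis" "HOL-Library.Landau_Symbols"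
begin

text \<open>Vertices are 0..<n; spin configurations are functions into {-1,1} on 0..<n
  (fixed to 1 outside, to make the sample space finite); a hypergraph is a set of d-subsets.\<close>

definition spins :: "nat \<Rightarrow> (nat \<Rightarrow> int) set" where
  "spins n = {\<sigma>. (\<forall>i<n. \<sigma> i = 1 \<or> \<sigma> i = -1) \<and> (\<forall>i\<ge>n. \<sigma> i = 1)}"

definition dsets :: "nat \<Rightarrow> nat \<Rightarrow> nat set set" where
  "dsets n d = {e. e \<subseteq> {..<n} \<and> card e = d}"

definition pn :: "nat \<Rightarrow> nat \<Rightarrow> real \<Rightarrow> real" where
  "pn n d a = a / real (n choose (d - 1))"

definition eprob :: "nat \<Rightarrow> nat \<Rightarrow> real \<Rightarrow> real \<Rightarrow> (nat \<Rightarrow> int) \<Rightarrow> nat set \<Rightarrow> real" where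
  "eprob n d a b \<sigma> e = (if \<forall>i\<in>e. \<forall>j\<in>e. \<sigma> i = \<sigma> j then pn n d a else pn n d b)"

definition hweight :: "nat \<Rightarrow> nat \<Rightarrow> real \<Rightarrow> real \<Rightarrow> (nat \<Rightarrow> int) \<Rightarrow> nat set set \<Rightarrow> real" where
  "hweight n d a b \<sigma> H = (1 / 2 ^ n) *
     (\<Prod>e\<in>dsets n d. if e \<in> H then eprob n d a b \<sigma> e else 1 - eprob n d a b \<sigma> e)"

definition hprob :: "nat \<Rightarrow> nat \<Rightarrow> real \<Rightarrow> real \<Rightarrow> ((nat \<Rightarrow> int) \<Rightarrow> nat set set \<Rightarrow> bool) \<Rightarrow> real" where
  "hprob n d a b E = (\<Sum>\<sigma>\<in>spins n. \<Sum>H\<in>Pow (dsets n d). if E \<sigma> H then hweight n d a b \<sigma> H else 0)"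

text \<open>Square matrices indexed by 0..<n, represented as functions.\<close>
type_synonym mat = "nat \<Rightarrow> nat \<Rightarrow> real"

definition mmul :: "nat \<Rightarrow> mat \<Rightarrow> mat \<Rightarrow> mat" where
  "mmul n M N = (\<lambda>i j. \<Sum>k<n. M i k * N k j)"

definition specnorm :: "nat \<Rightarrow> mat \<Rightarrow> real" where
  "specnorm n M = Sup {sqrt (\<Sum>i<n. (\<Sum>j<n. M i j * x j)\<^sup>2) | x. (\<Sum>j<n. (x j)\<^sup>2) = 1}"

text \<open>A^e_{ij} and its conditional expectation given \<sigma>.\<close>
definition Ae :: "nat set set \<Rightarrow> nat set \<Rightarrow> nat \<Rightarrow> nat \<Rightarrow> real" where
  "Ae H e i j = (if i \<noteq> j \<and> {i, j} \<subseteq> e \<and> e \<in> H then 1 else 0)"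

definition Abare :: "nat \<Rightarrow> nat \<Rightarrow> real \<Rightarrow> real \<Rightarrow> (nat \<Rightarrow> int) \<Rightarrow> nat set \<Rightarrow> nat \<Rightarrow> nat \<Rightarrow> real" where
  "Abare n d a b \<sigma> e i j = (if i \<noteq> j \<and> {i, j} \<subseteq> e then eprob n d a b \<sigma> e else 0)"

definition Abar :: "nat \<Rightarrow> nat \<Rightarrow> real \<Rightarrow> real \<Rightarrow> (nat \<Rightarrow> int) \<Rightarrow> mat" where
  "Abar n d a b \<sigma> = (\<lambda>i j. \<Sum>e\<in>dsets n d. Abare n d a b \<sigma> e i j)"

text \<open>A walk of length l is (vs, es) with vs = [i_0..i_l], es = [e_1..e_l] (es ! t = e_{t+1}).
  Self-avoiding walks in the complete d-uniform hypergraph on 0..<n from i to j.\<close>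
definition SAW :: "nat \<Rightarrow> nat \<Rightarrow> nat \<Rightarrow> nat \<Rightarrow> nat \<Rightarrow> (nat list \<times> nat set list) set" where
  "SAW n d l i j = {w. let vs = fst w; es = snd w in
     length vs = l + 1 \<and> length es = l \<and> vs ! 0 = i \<and> vs ! l = j \<and>
     set vs \<subseteq> {..<n} \<and> set es \<subseteq> dsets n d \<and>
     (\<forall>t<l. vs ! t \<noteq> vs ! (t + 1) \<and> {vs ! t, vs ! (t + 1)} \<subseteq> es ! t) \<and>
     distinct vs \<and>
     (\<forall>t. 1 \<le> t \<and> t < l \<longrightarrow> es ! (t - 1) \<inter> es ! t = {vs ! t}) \<and>
     (\<forall>s t. s < l \<and> t < l \<and> s + 2 \<le> t \<longrightarrow> es ! s \<inter> es ! t = {})}"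

text \<open>B^(l): number of self-avoiding walks of length l in H (gives I for l = 0).\<close>
definition Bmat :: "nat \<Rightarrow> nat \<Rightarrow> nat \<Rightarrow> nat set set \<Rightarrow> mat" where
  "Bmat n d l H = (\<lambda>i j. \<Sum>w\<in>SAW n d l i j. \<Prod>t<l. Ae H (snd w ! t) (fst w ! t) (fst w ! (t + 1)))"

definition Delta :: "nat \<Rightarrow> nat \<Rightarrow> real \<Rightarrow> real \<Rightarrow> nat \<Rightarrow> (nat \<Rightarrow> int) \<Rightarrow> nat set set \<Rightarrow> mat" where
  "Delta n d a b l \<sigma> H = (\<lambda>i j. \<Sum>w\<in>SAW n d l i j. \<Prod>t<l.
      Ae H (snd w ! t) (fst w ! t) (fst w ! (t + 1)) - Abare n d a b \<sigma> (snd w ! t) (fst w ! t) (fst w ! (t + 1)))"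

end

(* Expand the trace of (M^T M)^K, for M one of the two matrices and a constant K depending on epsilon
   only, into chains of 2K walks. Averaging over the hyperedges kills every chain in which some centered
   hyperedge is used only once, so at most K l (for Gamma: K (l + m)) distinct hyperedges remain.

   Explore a chain step by step. A new hyperedge meeting the explored vertices only in its starting point
   (tree edge) costs on average a factor alpha, since the tree edges form a hyperforest and the spins
   of the fresh vertices are independent. Any other new hyperedge (excess edge) gains a factor
   polylog(n) / n. Old edges cannot follow a tree edge, and a self-avoiding walk inside a hyperforest is
   determined by its endpoints, so the choice of a run of old tree edges costs only a polylogarithmic
   factor; a small weight z on repeated excess edges controls the number of runs. In a walk
   contributing to Gamma, the middle edge or a later edge must be excessive, whence the additional 1 / n.
   The expected trace is thus at most n polylog(n) alpha^(K l), and Markov's inequality applies as soon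
   as 2 K epsilon > 1. *)

theory Submission
  imports Defs "HOL-Real_Asymp.Real_Asymp"
begin

section \<open>Self-avoiding walks as lists of steps\<close>

text \<open>The matrices Gamma come from telescoping. Changing the factors of a self-avoiding walk
  one at a time from \<open>A\<close> to \<open>A - Abar\<close> writes \<open>B - Delta\<close> as
  a sum of products with a centered initial piece, one factor \<open>Abar\<close> and an uncentered
  final piece. Without any condition between the two pieces these products sum to Delta Abar B; the
  surplus, where the concatenation is not self-avoiding, is Gamma. An uncentered edge may occur only
  once without making the mean vanish, so it counts double, which leads to the exponent (l + m) / 2.

  The obstacle is the return to explored edges. Walks have logarithmic length, so even a constant
  number of choices per repeated step would cost a fixed power of n that no choice of K removes;
  only a polylogarithmic factor per walk is affordable. Hence runs of old tree edges are counted as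
  a whole. The number of walks in a chain is constant, so an edge is used a bounded number of times
  and the charges for repeated excess edges stay polylogarithmic too. Spins and hyperedges are
  averaged once per chain; all counting afterwards concerns a deterministic weight of the
  exploration.\<close>

fun endv :: "nat \<Rightarrow> ('e \<times> nat) list \<Rightarrow> nat" where
  "endv v [] = v"
| "endv v (p # s) = endv (snd p) s"

definition cover :: "(nat set \<times> nat) list \<Rightarrow> nat set" where
  "cover s = (\<Union>p\<in>set s. fst p)"

text \<open>Requiring that \<open>e\<close> meets the union of all later edges at most in \<open>u\<close> is enough:
  the edge after \<open>e\<close> contains \<open>u\<close>, and no later one does.\<close>

fun saw :: "nat \<Rightarrow> (nat set \<times> nat) list \<Rightarrow> bool" where
  "saw v [] = True"
| "saw v (p # s) = (v \<in> fst p \<and> snd p \<in> fst p \<and> snd p \<noteq> v \<and> fst p \<inter> cover s \<subseteq> {snd p} \<and> saw (snd p) s)"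

text \<open>Each edge gets paired with the vertex from which it was entered, so the start is needed
  as an argument. The edge type of \<open>endv\<close> and \<open>revw\<close> is generic because
  both are also applied to tokens, whose edges carry flags.\<close>

fun revw :: "nat \<Rightarrow> ('e \<times> nat) list \<Rightarrow> ('e \<times> nat) list" where
  "revw v [] = []"
| "revw v (p # s) = revw (snd p) s @ [(fst p, v)]"

text \<open>Only the start is fixed: a chain continues from wherever a walk ends, and matrix entries
  select the endpoint by \<open>endv\<close>.\<close>

definition saws :: "nat \<Rightarrow> nat \<Rightarrow> nat \<Rightarrow> nat \<Rightarrow> (nat set \<times> nat) list set" where
  "saws n d l v = {s. length s = l \<and> saw v s \<and> fst ` set s \<subseteq> dsets n d}"

lemma endv_append [simp]: "endv v (s @ t) = endv (endv v s) t"
  by (induction s arbitrary: v) auto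

lemma cover_simps [simp]: "cover [] = {}" "cover (p # s) = fst p \<union> cover s"
  "cover (s @ t) = cover s \<union> cover t"
  by (auto simp: cover_def)

lemma finite_dsets [simp]: "finite (dsets n d)"
  by (rule finite_subset[of _ "Pow {..<n}"]) (auto simp: dsets_def)

lemma dsetsD: "e \<in> dsets n d \<Longrightarrow> e \<subseteq> {..<n}" "e \<in> dsets n d \<Longrightarrow> card e = d"
  "e \<in> dsets n d \<Longrightarrow> finite e"
  by (auto simp: dsets_def intro: finite_subset)

lemma endv_cover: "saw v s \<Longrightarrow> s \<noteq> [] \<Longrightarrow> endv v s \<in> cover s"
proof (induction s arbitrary: v)
  case (Cons p s)
  then show ?case by (cases s) auto
qed auto

lemma start_cover: "saw v s \<Longrightarrow> s \<noteq> [] \<Longrightarrow> v \<in> cover s"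
  by (cases s) auto

lemma start_notin_cover_tl: "saw v (p # s) \<Longrightarrow> v \<notin> cover s"
  by auto

lemma saw_append:
  "saw v (s @ t) \<longleftrightarrow> saw v s \<and> saw (endv v s) t \<and> insert v (cover s) \<inter> cover t \<subseteq> {endv v s}"
proof (induction s arbitrary: v)
  case Nil
  show ?case using start_cover[of v t] by (cases t) auto
next
  case (Cons p s)
  have "saw (snd p) s \<Longrightarrow> endv (snd p) s \<in> insert (snd p) (cover s)"
    using endv_cover[of "snd p" s] by (cases s) auto
  then show ?case
    using Cons[of "snd p"] by auto
qed

lemma endv_neq_start: "saw v s \<Longrightarrow> s \<noteq> [] \<Longrightarrow> endv v s \<noteq> v"
proof (cases s)
  case (Cons p t)
  assume "saw v s" "s \<noteq> []"
  then show ?thesis using Cons endv_cover[of "snd p" t] start_notin_cover_tl[of v p t]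
    by (cases t) auto
qed auto

lemma endv_revw [simp]: "endv (endv v s) (revw v s) = v"
  by (induction s arbitrary: v) auto

lemma revw_append: "revw v (s @ t) = revw (endv v s) t @ revw v s"
  by (induction s arbitrary: v) auto

lemma revw_revw [simp]: "revw (endv v s) (revw v s) = s"
proof (induction s arbitrary: v)
  case (Cons p s)
  then show ?case using revw_append[of "endv (snd p) s" "revw (snd p) s" "[(fst p, v)]"]
    by auto
qed auto

lemma length_revw [simp]: "length (revw v s) = length s"
  by (induction s arbitrary: v) auto

lemma map_fst_revw [simp]: "map fst (revw v s) = rev (map fst s)"
  by (induction s arbitrary: v) auto

lemma fst_set_revw [simp]: "fst ` set (revw v s) = fst ` set s"
  by (metis map_fst_revw set_map set_rev)

lemma cover_revw [simp]: "cover (revw v s) = cover s"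
  by (metis cover_def fst_set_revw)

text \<open>The recursive condition only looks ahead, so its symmetry is not immediate. In the
  reversed walk the first edge comes last, and \<open>saw_append\<close> asks of it the same
  intersection condition as before.\<close>

lemma saw_revw: "saw v s \<Longrightarrow> saw (endv v s) (revw v s)"
proof (induction s arbitrary: v)
  case (Cons p s)
  have "endv (snd p) s \<in> insert (snd p) (cover s)"
    using endv_cover[of "snd p" s] Cons.prems by (cases "s = []") auto
  moreover have "saw (endv (snd p) s) (revw (snd p) s)"
    using Cons by simp
  ultimately show ?case using Cons.prems by (auto simp: saw_append simp del: revw.simps(2) 
        simp add: revw.simps(2)[of v p s])
qed auto

lemma saw_distinct_edges: "saw v s \<Longrightarrow> distinct (map fst s)"
proof (induction s arbitrary: v)
  case (Cons p s)
  then show ?case using start_notin_cover_tl[of v p s] by (force simp: cover_def)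
qed auto

lemma finite_saws [simp]: "finite (saws n d l v)"
proof (rule finite_subset)
  show "saws n d l v \<subseteq> {s. set s \<subseteq> dsets n d \<times> {..<n} \<and> length s = l}"
  proof
    fix s assume s: "s \<in> saws n d l v"
    have "saw v s \<Longrightarrow> fst ` set s \<subseteq> dsets n d \<Longrightarrow> set s \<subseteq> dsets n d \<times> {..<n}"
    proof (induction s arbitrary: v)
      case (Cons p s)
      then show ?case by (cases p) (auto dest: dsetsD)
    qed auto
    then show "s \<in> {s. set s \<subseteq> dsets n d \<times> {..<n} \<and> length s = l}"
      using s by (auto simp: saws_def)
  qed
qed (simp add: finite_lists_length_eq)

lemma endv_less: "saw v s \<Longrightarrow> fst ` set s \<subseteq> dsets n d \<Longrightarrow> v < n \<Longrightarrow> endv v s < n"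
proof (induction s arbitrary: v)
  case (Cons p s)
  then show ?case using dsetsD(1)[of "fst p" n d] by auto
qed auto

section \<open>Uniqueness of self-avoiding walks in hyperforests\<close>

text \<open>Acyclicity is encoded by an order of construction, because this is what the exploration
  provides: a tree edge meets everything found before in at most one vertex. An empty intersection
  starts a new component.\<close>

inductive hforest :: "nat set set \<Rightarrow> bool" where
  empty: "hforest {}"
| insert: "hforest F \<Longrightarrow> e \<notin> F \<Longrightarrow> e \<inter> \<Union>F \<subseteq> {c} \<Longrightarrow> hforest (insert e F)"

lemma hforest_finite: "hforest F \<Longrightarrow> finite F"
  by (induction rule: hforest.induct) auto

text \<open>Induction on the forest: the last added edge can only be the first or the last edge of a
  walk, since it meets the rest in at most one vertex.\<close>

lemma hforest_saw_unique:
  assumes "hforest F" "saw v s" "saw v s'" "fst ` set s \<subseteq> F" "fst ` set s' \<subseteq> F"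
    and "endv v s = endv v s'"
  shows "s = s'"
  using assms
proof (induction arbitrary: v s s' rule: hforest.induct)
  case empty
  then show ?case by simp
next
  case (insert F e c)
  have cov: "cover t \<subseteq> \<Union>F" if "fst ` set t \<subseteq> F" for t
    using that by (auto simp: cover_def)
  \<comment> \<open>A walk starting in \<open>e\<close> away from \<open>c\<close> uses
    \<open>e\<close> first, since no edge of \<open>F\<close> contains its start, and can continue
    from \<open>c\<close> only. The remaining walk lies in \<open>F\<close>.\<close>
  have start: "s = s'"
    if v: "v \<in> e" "v \<noteq> c" and s: "saw v s" "saw v s'" "fst ` set s \<subseteq> insert e F"
      "fst ` set s' \<subseteq> insert e F" "endv v s = endv v s'" for v s s'
  proof (cases "s = [] \<or> s' = []")
    case True
    then show ?thesis using s endv_neq_start by (metis endv.simps(1))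
  next
    case False
    have first: "\<exists>u r. t = (e, u) # r \<and> fst ` set r \<subseteq> F \<and> saw u r \<and> u \<in> e \<and> u \<noteq> v
       \<and> (r \<noteq> [] \<longrightarrow> u = c)"
      if t: "saw v t" "fst ` set t \<subseteq> insert e F" "t \<noteq> []" for t
    proof -
      obtain p r where tr: "t = p # r" using t by (cases t) auto
      have "v \<notin> \<Union>F" using v insert.hyps by auto
      then have "fst p = e" using t tr by auto
      have "e \<notin> fst ` set r"
        using saw_distinct_edges[OF t(1)] tr \<open>fst p = e\<close> by simp
      then have rF: "fst ` set r \<subseteq> F"
        using t(2) tr by auto
      have "r \<noteq> [] \<longrightarrow> snd p = c"
        using t(1) tr start_cover[of "snd p" r] cov[OF rF] insert.hyps \<open>fst p = e\<close> by auto
      then show ?thesis using t tr rF \<open>fst p = e\<close> by (cases p) auto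
    qed
    obtain u r where ur: "s = (e, u) # r" "fst ` set r \<subseteq> F" "saw u r" "u \<in> e" "u \<noteq> v" 
      "r \<noteq> [] \<longrightarrow> u = c" using first[OF s(1,3)] False by auto
    obtain u' r' where ur': "s' = (e, u') # r'" "fst ` set r' \<subseteq> F" "saw u' r'" "u' \<in> e" "u' \<noteq> v" 
      "r' \<noteq> [] \<longrightarrow> u' = c" using first[OF s(2,4)] False by auto
    have fin: "endv w t \<in> e \<Longrightarrow> endv w t = c"
      if "saw w t" "fst ` set t \<subseteq> F" "t \<noteq> []" for w t
      using endv_cover[OF that(1,3)] cov[OF that(2)] insert.hyps by auto
    have eq: "endv u r = endv u' r'" using s ur ur' by simp
    have "u = u'"
    proof (cases "r = [] \<or> r' = []")
      case True
      then show ?thesis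
      proof
        assume "r = []"
        show ?thesis
        proof (cases "r' = []")
          case True
          then show ?thesis using eq \<open>r = []\<close> by simp
        next
          case False
          then have "u = c" using fin[OF ur'(3,2)] eq \<open>r = []\<close> ur(4) by simp
          then show ?thesis using ur' False by simp
        qed
      next
        assume "r' = []"
        show ?thesis
        proof (cases "r = []")
          case True
          then show ?thesis using eq \<open>r' = []\<close> by simp
        next
          case False
          then have "u' = c" using fin[OF ur(3,2)] eq \<open>r' = []\<close> ur'(4) by simp
          then show ?thesis using ur False by simp
        qed
      qed
    next
      case False
      then show ?thesis using ur ur' by simp
    qed
    then show ?thesis using insert.IH[of u r r'] ur ur' eq by simp
  qed
  show ?case
  proof (cases "v \<in> e \<and> v \<noteq> c")
    case True
    then show ?thesis using start insert.prems by blast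
  next
    case nv: False
    show ?thesis
    proof (cases "endv v s \<in> e \<and> endv v s \<noteq> c")
      case True
      \<comment> \<open>Reversal exchanges the endpoints and reduces this case to
        \<open>start\<close>.\<close>
      have "revw v s = revw v s'"
      proof (rule start[of "endv v s"])
        show "saw (endv v s) (revw v s)" "saw (endv v s) (revw v s')"
          using insert.prems saw_revw by metis+
        show "endv (endv v s) (revw v s) = endv (endv v s) (revw v s')"
          using insert.prems endv_revw by metis
      qed (use True insert.prems in simp_all)
      then show ?thesis using insert.prems(5) by (metis revw_revw)
    next
      case ne: False
      \<comment> \<open>With neither endpoint in \<open>e - {c}\<close>, a walk through
        \<open>e\<close> would have to enter and to leave it at \<open>c\<close>.\<close>
      have avoid: "fst ` set t \<subseteq> F"
        if t: "saw v t" "fst ` set t \<subseteq> insert e F" "endv v t = endv v s" for t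
      proof (rule ccontr)
        assume "\<not> fst ` set t \<subseteq> F"
        then obtain p where "p \<in> set t" "fst p = e" using t by auto
        then obtain t1 t2 where tt: "t = t1 @ p # t2" by (meson split_list)
        have dist: "distinct (map fst t)" using saw_distinct_edges t by auto
        then have "e \<notin> fst ` set t1" "e \<notin> fst ` set t2"
          using tt \<open>fst p = e\<close> by auto
        then have F12: "fst ` set t1 \<subseteq> F" "fst ` set t2 \<subseteq> F" 
          using t(2) unfolding tt by auto
        have sw: "saw v t1" "saw (endv v t1) (p # t2)" using t(1) tt by (auto simp: saw_append)
        have "endv v t1 = c"
          using endv_cover[OF sw(1)] cov[OF F12(1)] sw(2) nv insert.hyps \<open>fst p = e\<close>
          by (cases "t1 = []") auto
        moreover have "snd p = c"
          using start_cover[of "snd p" t2] cov[OF F12(2)] sw(2) ne insert.hyps \<open>fst p = e\<close> t(3) tt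
          by (cases "t2 = []") auto
        ultimately show False using sw(2) by auto
      qed
      show ?thesis using insert.IH[of v s s'] avoid insert.prems by metis
    qed
  qed
qed

section \<open>Exploring a sequence of walks\<close>

text \<open>The flag records which factor an edge contributes: centered (\<open>A - Abar\<close>), middle (\<open>Abar\<close>) or
  uncentered (\<open>A\<close>). A state consists of the explored vertices, the tree edges and the excess edges
  found so far; middle edges only contribute their vertices.\<close>

datatype flag = Cen | Mid | Unc

type_synonym state = "nat set \<times> nat set set \<times> nat set set"

text \<open>The current vertex is not mentioned, so the notion depends on \<open>V\<close> and
  \<open>e\<close> only. For a step from \<open>v\<close> in both sets, \<open>c\<close> is forced
  to be \<open>v\<close>.\<close>

definition small :: "nat set \<Rightarrow> nat set \<Rightarrow> bool" where
  "small V e \<longleftrightarrow> (\<exists>c. e \<inter> V \<subseteq> {c})"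

fun upd :: "state \<Rightarrow> flag \<times> nat set \<Rightarrow> state" where
  "upd (V, T, X) (f, e) =
     (V \<union> e,
      if f \<noteq> Mid \<and> small V e then insert e T else T,
      if f \<noteq> Mid \<and> \<not> small V e \<and> e \<notin> T then insert e X else X)"

definition lab :: "flag \<Rightarrow> (nat set \<times> nat) list \<Rightarrow> (flag \<times> nat set) list" where
  "lab f s = map (\<lambda>p. (f, fst p)) s"

text \<open>The walk consists of new tree edges only when it is explored from
  \<open>V\<close>.\<close>

fun allT :: "nat set \<Rightarrow> (nat set \<times> nat) list \<Rightarrow> bool" where
  "allT V [] = True"
| "allT V (p # s) = (small V (fst p) \<and> allT (V \<union> fst p) s)"

definition pairs :: "nat \<Rightarrow> nat \<Rightarrow> nat \<Rightarrow> (nat set \<times> nat) set" where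
  "pairs n d v = {p. fst p \<in> dsets n d \<and> v \<in> fst p \<and> snd p \<in> fst p \<and> snd p \<noteq> v}"

lemma lab_simps [simp]: "lab f [] = []" "lab f (p # s) = (f, fst p) # lab f s"
  "lab f (s @ t) = lab f s @ lab f t"
  by (auto simp: lab_def)

text \<open>The tool for every decomposition of walks into pieces: each element of \<open>S\<close>
  only has to be representable, and overcounting is harmless because \<open>g\<close> is
  nonnegative.\<close>

lemma sum_le_sum_Sigma:
  fixes g :: "'c \<Rightarrow> real"
  assumes "finite P" "\<And>p. p \<in> P \<Longrightarrow> finite (Q p)" "\<And>s. g s \<ge> 0"
    and "\<And>s. s \<in> S \<Longrightarrow> \<exists>p\<in>P. \<exists>q\<in>Q p. s = h p q"
  shows "sum g S \<le> (\<Sum>p\<in>P. \<Sum>q\<in>Q p. g (h p q))"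
proof -
  have fin: "finite (Sigma P Q)" using assms(1,2) by auto
  have "sum g S \<le> sum g ((\<lambda>(p, q). h p q) ` Sigma P Q)"
    using assms(3,4) fin by (intro sum_mono2) (fastforce simp: image_iff)+
  also have "\<dots> \<le> sum (g \<circ> (\<lambda>(p, q). h p q)) (Sigma P Q)"
    using fin assms(3) by (intro sum_image_le) auto
  also have "\<dots> = (\<Sum>p\<in>P. \<Sum>q\<in>Q p. g (h p q))"
    using assms(1,2) by (subst sum.Sigma) (auto intro!: sum.cong simp: case_prod_unfold)
  finally show ?thesis .
qed

lemma sum_Un_le:
  fixes g :: "'c \<Rightarrow> real"
  assumes "finite A" "finite B" "\<And>s. g s \<ge> 0"
  shows "sum g (A \<union> B) \<le> sum g A + sum g B"
  using sum.union_inter[OF assms(1,2), of g] sum_nonneg[of "A \<inter> B" g] assms(3) by simp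

section \<open>Counting hyperedges and steps through prescribed vertices\<close>

lemma card_dsets_superset:
  assumes "A \<subseteq> {..<n}"
  shows "card {e \<in> dsets n d. A \<subseteq> e} \<le> (n - card A) choose (d - card A)"
proof -
  have finA: "finite A" using assms finite_subset by blast
  have "card {e \<in> dsets n d. A \<subseteq> e} \<le> card {B. B \<subseteq> {..<n} - A \<and> card B = d - card A}"
  proof (rule card_inj_on_le[where f = "\<lambda>e. e - A"])
    show "inj_on (\<lambda>e. e - A) {e \<in> dsets n d. A \<subseteq> e}"
      by (rule inj_onI) (metis (no_types, lifting) Diff_partition mem_Collect_eq)
    show "(\<lambda>e. e - A) ` {e \<in> dsets n d. A \<subseteq> e} \<subseteq> {B. B \<subseteq> {..<n} - A \<and> card B = d - card A}"
      using finA by (auto simp: dsets_def card_Diff_subset)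
  qed auto
  also have "\<dots> = (n - card A) choose (d - card A)"
    using n_subsets[of "{..<n} - A" "d - card A"] assms finA by (simp add: card_Diff_subset)
  finally show ?thesis .
qed

lemma finite_pairs [simp]: "finite (pairs n d v)"
  by (rule finite_subset[of _ "dsets n d \<times> {..<n}"]) (auto simp: pairs_def dsets_def)

lemma card_pairs_le:
  assumes E: "E \<subseteq> {e \<in> dsets n d. v \<in> e}"
  shows "card {p \<in> pairs n d v. fst p \<in> E} \<le> (d - 1) * card E"
proof -
  have finE: "finite E" using E finite_dsets finite_subset by fastforce
  have "{p \<in> pairs n d v. fst p \<in> E} = Sigma E (\<lambda>e. e - {v})"
    using E by (auto simp: pairs_def)
  moreover have "card (Sigma E (\<lambda>e. e - {v})) = (\<Sum>e\<in>E. card (e - {v}))"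
    using finE E by (subst card_SigmaI) (auto dest: dsetsD)
  moreover have "card (e - {v}) = d - 1" if "e \<in> E" for e
    using that E dsetsD[of e n d] by (auto simp: card_Diff_singleton)
  ultimately show ?thesis by simp
qed

lemma card_pairs:
  assumes "v < n"
  shows "card (pairs n d v) \<le> (d - 1) * ((n - 1) choose (d - 1))"
proof -
  have "pairs n d v = {p \<in> pairs n d v. fst p \<in> {e \<in> dsets n d. v \<in> e}}"
    by (auto simp: pairs_def)
  then have "card (pairs n d v) \<le> (d - 1) * card {e \<in> dsets n d. v \<in> e}"
    using card_pairs_le[of "{e \<in> dsets n d. v \<in> e}" n d v] by simp
  also have "\<dots> \<le> (d - 1) * ((n - 1) choose (d - 1))"
    using card_dsets_superset[of "{v}" n d] assms by simp
  finally show ?thesis .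
qed

text \<open>Such an edge contains \<open>v\<close> and a second explored vertex \<open>w\<close>; a
  union bound over \<open>w\<close> applies. Compared with all steps from \<open>v\<close>, this is
  the gain of order \<open>card V\<close> / n for excess edges.\<close>

lemma card_pairs_not_small:
  assumes "v \<in> V" "finite V" "V \<subseteq> {..<n}"
  shows "card {p \<in> pairs n d v. \<not> small V (fst p)} \<le> card V * ((d - 1) * ((n - 2) choose (d - 2)))"
proof -
  let ?E = "\<lambda>w. {e \<in> dsets n d. {v, w} \<subseteq> e}"
  have "{p \<in> pairs n d v. \<not> small V (fst p)} \<subseteq> (\<Union>w\<in>V - {v}. {p \<in> pairs n d v. fst p \<in> ?E w})"
    by (auto simp: pairs_def small_def)
  then have "card {p \<in> pairs n d v. \<not> small V (fst p)}
      \<le> card (\<Union>w\<in>V - {v}. {p \<in> pairs n d v. fst p \<in> ?E w})"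
    using assms by (intro card_mono) auto
  also have "\<dots> \<le> (\<Sum>w\<in>V - {v}. card {p \<in> pairs n d v. fst p \<in> ?E w})"
    using assms by (intro card_UN_le) auto
  also have "\<dots> \<le> (\<Sum>w\<in>V - {v}. (d - 1) * ((n - 2) choose (d - 2)))"
  proof (rule sum_mono)
    fix w assume w: "w \<in> V - {v}"
    have "card {p \<in> pairs n d v. fst p \<in> ?E w} \<le> (d - 1) * card (?E w)"
      by (rule card_pairs_le) auto
    also have "\<dots> \<le> (d - 1) * ((n - 2) choose (d - 2))"
      using card_dsets_superset[of "{v, w}" n d] assms w by (auto simp: numeral_2_eq_2)
    finally show "card {p \<in> pairs n d v. fst p \<in> ?E w} \<le> (d - 1) * ((n - 2) choose (d - 2))" .
  qed
  also have "\<dots> \<le> card V * ((d - 1) * ((n - 2) choose (d - 2)))"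
    using assms by (simp add: card_Diff_singleton)
  finally show ?thesis .
qed

text \<open>The weights: \<open>\<tau>\<close> for a new edge meeting the explored vertices only in its starting point
  (tree edge), \<open>y\<close> for any other new edge (excess edge), \<open>z\<close> for using an excess edge again,
  \<open>1\<close> for using a tree edge again, \<open>\<mu>\<close> for every middle edge.
  In the application \<open>x\<close> is a power of \<open>ln n\<close> divided by \<open>n\<close> and \<open>z\<close> is of order \<open>1 / N\<^sup>2\<close>.\<close>

locale exploration =
  fixes n d N :: nat and \<tau> y z \<mu> x \<kappa> :: real
  assumes d2: "d \<ge> 2"
    and nonneg: "\<tau> \<ge> 0" "y \<ge> 0" "z \<ge> 0" "\<mu> \<ge> 0" "x \<ge> 0" "\<kappa> \<ge> 0"
    and tree: "\<tau> * real ((d - 1) * ((n - 1) choose (d - 1))) \<le> 1"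
    and excess: "y * real (N * ((d - 1) * ((n - 2) choose (d - 2)))) \<le> x"
    and mid_excess: "\<mu> * real (N * ((d - 1) * ((n - 2) choose (d - 2)))) \<le> x"
    and mid: "\<mu> * real ((d - 1) * ((n - 1) choose (d - 1))) \<le> \<kappa>"
    and revisit: "z * real (N * d) * real (3 * N) \<le> 1"
    and x_small: "real N * (real (3 * N) * x) \<le> 1"
begin

fun stepw :: "state \<Rightarrow> flag \<times> nat set \<Rightarrow> real" where
  "stepw (V, T, X) (f, e) =
     (if f = Mid then \<mu> else if small V e then \<tau> else if e \<in> T then 1 else if e \<in> X then z else y)"

fun wt :: "state \<Rightarrow> (flag \<times> nat set) list \<Rightarrow> real" where
  "wt st [] = 1"
| "wt st (q # qs) = stepw st q * wt (upd st q) qs"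

fun valid :: "state \<Rightarrow> bool" where
  "valid (V, T, X) \<longleftrightarrow> finite V \<and> V \<subseteq> {..<n} \<and> (\<forall>e\<in>T \<union> X. e \<subseteq> V \<and> e \<in> dsets n d)
     \<and> hforest T \<and> finite X \<and> T \<inter> X = {}"

text \<open>A budget: each of the \<open>r\<close> steps still to come adds at most \<open>d\<close>
  vertices and one excess edge, so \<open>N\<close> bounds both counts throughout.\<close>

fun room :: "state \<Rightarrow> nat \<Rightarrow> bool" where
  "room (V, T, X) r \<longleftrightarrow> card V + d * r \<le> N \<and> card X + r \<le> N"

lemma stepw_nonneg [simp]: "stepw st q \<ge> 0"
  using nonneg by (cases st; cases q) auto

lemma wt_nonneg [simp]: "wt st qs \<ge> 0"
  by (induction qs arbitrary: st) auto

lemma wt_append: "wt st (qs @ rs) = wt st qs * wt (fold (\<lambda>q s. upd s q) qs st) rs"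
  by (induction qs arbitrary: st) auto

text \<open>Recorded edges lie inside \<open>V\<close> and have at least two vertices, so a repeated
  edge never looks like a tree edge. This is why \<open>stepw\<close> may test \<open>small\<close>
  before membership.\<close>

lemma not_small_subset: "e \<in> dsets n d \<Longrightarrow> e \<subseteq> V \<Longrightarrow> \<not> small V e"
proof
  assume e: "e \<in> dsets n d" "e \<subseteq> V" and "small V e"
  obtain c where "e \<subseteq> {c}" using \<open>small V e\<close> \<open>e \<subseteq> V\<close> by (auto simp: small_def Int_absorb2)
  then have "card e \<le> 1" by (metis card.empty card.insert card_mono empty_iff finite.emptyI finite.insertI One_nat_def)
  then show False using dsetsD(2)[OF e(1)] d2 by simp
qed

text \<open>A tree edge meets \<open>V\<close>, hence the union of \<open>T\<close>, in at most one
  vertex; the order of discovery is therefore a construction order for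
  \<open>hforest\<close>.\<close>

lemma valid_upd:
  assumes "valid st" "snd q \<in> dsets n d"
  shows "valid (upd st q)"
proof (cases st; cases q)
  fix V T X f e assume st: "st = (V, T, X)" and q: "q = (f, e)"
  have i: "finite V" "V \<subseteq> {..<n}" "\<And>e. e \<in> T \<union> X \<Longrightarrow> e \<subseteq> V \<and> e \<in> dsets n d" "hforest T" "finite X"
    "T \<inter> X = {}" and e: "e \<in> dsets n d"
    using assms st q by auto
  have new: "e \<notin> T" "e \<notin> X" "hforest (insert e T)" if sm: "small V e"
  proof -
    show "e \<notin> T" "e \<notin> X" using not_small_subset[of e V] e i(3)[of e] sm by auto
    obtain c where "e \<inter> V \<subseteq> {c}" using sm by (auto simp: small_def)
    moreover have "\<Union>T \<subseteq> V" using i(3) by auto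
    ultimately show "hforest (insert e T)"
      using \<open>e \<notin> T\<close> i(4) by (intro hforest.insert[of _ _ c]) auto
  qed
  show ?thesis
    unfolding st q upd.simps valid.simps
  proof (intro conjI ballI)
    fix g
    assume "g \<in> (if f \<noteq> Mid \<and> small V e then insert e T else T) \<union>
      (if f \<noteq> Mid \<and> \<not> small V e \<and> e \<notin> T then insert e X else X)"
    then have "g = e \<or> g \<in> T \<union> X" by (auto split: if_splits)
    then show "g \<subseteq> V \<union> e" "g \<in> dsets n d" using i(3)[of g] e by blast+
  qed (use i(1,2,4,5,6) dsetsD[OF e] new in \<open>auto split: if_splits\<close>)
qed

lemma room_upd:
  assumes "valid st" "snd q \<in> dsets n d" "room st (Suc r)"
  shows "room (upd st q) r"
proof (cases st; cases q)
  fix V T X f e assume st: "st = (V, T, X)" and q: "q = (f, e)"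
  have "card (V \<union> e) \<le> card V + d"
    using card_Un_le[of V e] dsetsD(2)[of e n d] assms q by simp
  moreover have "card (insert e X) \<le> Suc (card X)"
    by (rule card_insert_le_m1) auto
  ultimately show ?thesis using assms(3) unfolding st q by auto
qed

lemma room_mono: "room st r \<Longrightarrow> r' \<le> r \<Longrightarrow> room st r'"
proof (cases st)
  fix V T X assume a: "room st r" "r' \<le> r" "st = (V, T, X)"
  moreover have "d * r' \<le> d * r" using a(2) by simp
  moreover have "card V + d * r \<le> N" "card X + r \<le> N" using a by auto
  ultimately have "card V + d * r' \<le> N" "card X + r' \<le> N" by linarith+
  then show ?thesis using a(3) by simp
qed

lemma valid_fold:
  assumes "valid st" "snd ` set qs \<subseteq> dsets n d"
  shows "valid (fold (\<lambda>q s. upd s q) qs st)"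
  using assms
proof (induction qs arbitrary: st)
  case (Cons q qs)
  then show ?case using valid_upd[of st q] by simp
qed auto

lemma valid_sz_fold:
  assumes "valid st" "snd ` set qs \<subseteq> dsets n d" "room st (length qs + r)"
  shows "valid (fold (\<lambda>q s. upd s q) qs st) \<and> room (fold (\<lambda>q s. upd s q) qs st) r"
  using valid_fold[OF assms(1,2)] assms
proof (induction qs arbitrary: st)
  case (Cons q qs)
  then show ?case using valid_upd[of st q] room_upd[of st q "length qs + r"] by simp
qed auto

lemma fst_fold_upd: "fst (fold (\<lambda>q s. upd s q) qs st) = fst st \<union> (\<Union>q\<in>set qs. snd q)"
proof (induction qs arbitrary: st)
  case (Cons q qs)
  then show ?case by (cases st; cases q) auto
qed auto

section \<open>Total weight of the self-avoiding walks leaving a vertex\<close>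

lemma sawsD: "s \<in> saws n d l v \<Longrightarrow> length s = l" "s \<in> saws n d l v \<Longrightarrow> saw v s"
  "s \<in> saws n d l v \<Longrightarrow> fst ` set s \<subseteq> dsets n d"
  by (auto simp: saws_def)

lemma saws_Suc: "s \<in> saws n d (Suc r) v \<Longrightarrow>
   \<exists>p\<in>pairs n d v. \<exists>s'\<in>saws n d r (snd p). s = p # s'"
  by (cases s) (auto simp: saws_def pairs_def)

lemma card_V_le: "room (V, T, X) r \<Longrightarrow> card V \<le> N" "room (V, T, X) r \<Longrightarrow> r \<le> N"
  "room (V, T, X) r \<Longrightarrow> card X \<le> N"
  by auto

text \<open>\<open>\<tau>\<close> is normalised so that all tree steps from one vertex weigh at most
  1 together; hence the length of the walk costs nothing.\<close>

lemma sum_tree_walks: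
  assumes "f \<noteq> Mid" "valid st" "v \<in> fst st"
  shows "(\<Sum>s\<in>{s \<in> saws n d r v. allT (fst st) s}. wt st (lab f s)) \<le> 1"
  using assms
proof (induction r arbitrary: st v)
  case 0
  have "{s \<in> saws n d 0 v. allT (fst st) s} = {[]}" by (auto simp: saws_def)
  then show ?case by simp
next
  case (Suc r)
  obtain V T X where st: "st = (V, T, X)" by (cases st)
  have v: "v < n" "v \<in> V" using Suc.prems st by auto
  let ?P = "{p \<in> pairs n d v. small V (fst p)}"
  let ?Q = "\<lambda>p. {s \<in> saws n d r (snd p). allT (V \<union> fst p) s}"
  have "(\<Sum>s\<in>{s \<in> saws n d (Suc r) v. allT (fst st) s}. wt st (lab f s))
     \<le> (\<Sum>p\<in>?P. \<Sum>s\<in>?Q p. wt st (lab f (p # s)))"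
  proof (rule sum_le_sum_Sigma)
    fix s assume "s \<in> {s \<in> saws n d (Suc r) v. allT (fst st) s}"
    then show "\<exists>p\<in>?P. \<exists>q\<in>?Q p. s = p # q" using saws_Suc[of s r v] st by auto
  qed auto
  also have "\<dots> \<le> (\<Sum>p\<in>?P. \<tau>)"
  proof (rule sum_mono)
    fix p assume p: "p \<in> ?P"
    then have d: "snd (f, fst p) \<in> dsets n d" and u: "snd p \<in> fst p" by (auto simp: pairs_def)
    have "(\<Sum>s\<in>{s \<in> saws n d r (snd p). allT (fst (upd st (f, fst p))) s}.
        wt (upd st (f, fst p)) (lab f s)) \<le> 1"
      using Suc.IH[of "upd st (f, fst p)" "snd p"] valid_upd[OF Suc.prems(2) d] u Suc.prems(1) st
      by auto
    then have "\<tau> * (\<Sum>s\<in>?Q p. wt (upd st (f, fst p)) (lab f s)) \<le> \<tau> * 1"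
      using st nonneg by (intro mult_left_mono) auto
    then show "(\<Sum>s\<in>?Q p. wt st (lab f (p # s))) \<le> \<tau>"
      using p Suc.prems(1) st by (simp add: sum_distrib_left)
  qed
  also have "\<dots> \<le> \<tau> * real (card (pairs n d v))"
    using nonneg card_mono[OF finite_pairs, of ?P n d v]
    by (simp add: mult.commute[of _ \<tau>] mult_left_mono)
  also have "\<dots> \<le> \<tau> * real ((d - 1) * ((n - 1) choose (d - 1)))"
    using card_pairs[OF v(1), of d] nonneg by (intro mult_left_mono of_nat_mono) auto
  finally show ?case using tree by simp
qed

text \<open>Named so that the bound for shorter walks can be handed to
  \<open>sum_fresh_walks\<close>, which is itself a step of the induction proving it. The bound is
  uniform in the state and in the length.\<close>

definition seg_bound :: "flag \<Rightarrow> nat \<Rightarrow> bool" where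
  "seg_bound f r \<longleftrightarrow> (\<forall>st v. valid st \<longrightarrow> room st r \<longrightarrow> v \<in> fst st \<longrightarrow>
     (\<Sum>s\<in>saws n d r v. wt st (lab f s)) \<le> real (3 * N))"

text \<open>Only the first step is restricted; along tree edges the property then propagates by
  itself.\<close>

fun fresh :: "state \<Rightarrow> (nat set \<times> nat) list \<Rightarrow> bool" where
  "fresh (V, T, X) s \<longleftrightarrow> (s \<noteq> [] \<longrightarrow> fst (hd s) \<notin> T \<union> X)"

lemma sum_weight_excess:
  assumes "v \<in> V" "finite V" "V \<subseteq> {..<n}" "card V \<le> N" "w \<ge> 0"
    and "w * real (N * ((d - 1) * ((n - 2) choose (d - 2)))) \<le> x"
  shows "(\<Sum>p\<in>{p \<in> pairs n d v. \<not> small V (fst p)}. w) \<le> x"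
proof -
  have "card {p \<in> pairs n d v. \<not> small V (fst p)} \<le> N * ((d - 1) * ((n - 2) choose (d - 2)))"
    using card_pairs_not_small[OF assms(1-3), of d] assms(4) mult_le_mono1 le_trans by blast
  then have "w * real (card {p \<in> pairs n d v. \<not> small V (fst p)}) \<le>
     w * real (N * ((d - 1) * ((n - 2) choose (d - 2))))"
    using assms(5) by (intro mult_left_mono of_nat_mono)
  then show ?thesis using assms(6) by (simp add: mult.commute)
qed

text \<open>The walk follows tree edges up to its first excess edge, which is new. There are at most
  \<open>r\<close> positions for that edge; the possible edges weigh at most \<open>x\<close>
  together, and whatever follows weighs at most 3 N.\<close>

lemma sum_fresh_walks:
  assumes "f \<noteq> Mid" "valid st" "room st r" "v \<in> fst st" "\<And>q. q < r \<Longrightarrow> seg_bound f q"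
  shows "(\<Sum>s\<in>{s \<in> saws n d r v. fresh st s \<and> \<not> allT (fst st) s}. wt st (lab f s))
    \<le> real r * (real (3 * N) * x)"
  using assms
proof (induction r arbitrary: st v)
  case 0
  have "{s \<in> saws n d 0 v. fresh st s \<and> \<not> allT (fst st) s} = {}" by (auto simp: saws_def)
  then show ?case by (simp only: sum.empty)
next
  case (Suc r)
  obtain V T X where st: "st = (V, T, X)" by (cases st)
  have v: "v < n" "v \<in> V" "finite V" "V \<subseteq> {..<n}" "card V \<le> N"
    using Suc.prems st by auto
  let ?b = "real r * (real (3 * N) * x)"
  let ?u = "\<lambda>p. upd st (f, fst p)"
  let ?S = "\<lambda>p. {s \<in> saws n d r (snd p). fresh (?u p) s \<and> \<not> allT (fst (?u p)) s}"
  let ?P = "{p \<in> pairs n d v. fst p \<notin> T \<union> X}"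
  let ?Q = "\<lambda>p. if small V (fst p) then ?S p else saws n d r (snd p)"
  have "(\<Sum>s\<in>{s \<in> saws n d (Suc r) v. fresh st s \<and> \<not> allT (fst st) s}. wt st (lab f s))
     \<le> (\<Sum>p\<in>?P. \<Sum>s\<in>?Q p. wt st (lab f (p # s)))"
  proof (rule sum_le_sum_Sigma)
    fix s assume s: "s \<in> {s \<in> saws n d (Suc r) v. fresh st s \<and> \<not> allT (fst st) s}"
    then obtain p t where pt: "p \<in> pairs n d v" "t \<in> saws n d r (snd p)" "s = p # t"
      using saws_Suc[of s r v] by auto
    have "t \<in> ?S p" if sm: "small V (fst p)"
    proof -
      \<comment> \<open>A tree edge meets \<open>V\<close> in \<open>v\<close> alone, so it is left
        at an unexplored vertex, which no recorded edge contains.\<close>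
      have "snd p \<notin> V"
      proof
        assume "snd p \<in> V"
        moreover obtain c where "fst p \<inter> V \<subseteq> {c}" using sm by (auto simp: small_def)
        ultimately show False using pt(1) v by (auto simp: pairs_def)
      qed
      have "fst (hd t) \<notin> insert (fst p) T \<union> X" if t: "t \<noteq> []"
      proof -
        obtain q t' where t: "t = q # t'" using t by (cases t) auto
        have sq: "snd p \<in> fst q" using pt t by (auto simp: saws_def)
        then have "fst q \<notin> T \<union> X" using Suc.prems st \<open>snd p \<notin> V\<close> by auto
        moreover have "fst q \<noteq> fst p"
          using s saw_distinct_edges[of v s] unfolding pt(3) t by (auto simp: saws_def)
        ultimately show ?thesis using t by auto
      qed
      then show ?thesis using s pt sm Suc.prems(1) st by auto
    qed
    then show "\<exists>p\<in>?P. \<exists>q\<in>?Q p. s = p # q" using pt s st by auto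
  qed auto
  also have "\<dots> \<le> (\<Sum>p\<in>?P. if small V (fst p) then \<tau> * ?b else y * real (3 * N))"
  proof (rule sum_mono)
    fix p assume p: "p \<in> ?P"
    then have d: "snd (f, fst p) \<in> dsets n d" and u: "snd p \<in> fst p" by (auto simp: pairs_def)
    note i = valid_upd[OF Suc.prems(2) d] room_upd[OF Suc.prems(2) d Suc.prems(3)]
    have u': "snd p \<in> fst (?u p)" using u st by auto
    show "(\<Sum>s\<in>?Q p. wt st (lab f (p # s)))
       \<le> (if small V (fst p) then \<tau> * ?b else y * real (3 * N))"
    proof (cases "small V (fst p)")
      case True
      have "(\<Sum>s\<in>?S p. wt (?u p) (lab f s)) \<le> ?b"
        using Suc.IH[OF Suc.prems(1) i u'] Suc.prems(5) by simp
      then have "\<tau> * (\<Sum>s\<in>?S p. wt (?u p) (lab f s)) \<le> \<tau> * ?b"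
        using nonneg by (intro mult_left_mono) auto
      then show ?thesis using True Suc.prems(1) st by (simp add: sum_distrib_left)
    next
      case False
      have "(\<Sum>s\<in>saws n d r (snd p). wt (?u p) (lab f s)) \<le> real (3 * N)"
        using Suc.prems(5)[of r] i u' unfolding seg_bound_def by blast
      then have "y * (\<Sum>s\<in>saws n d r (snd p). wt (?u p) (lab f s)) \<le> y * real (3 * N)"
        using nonneg by (intro mult_left_mono) auto
      then show ?thesis using False p Suc.prems(1) st by (simp add: sum_distrib_left)
    qed
  qed
  also have "\<dots> \<le> (\<Sum>p\<in>pairs n d v. \<tau> * ?b) + (\<Sum>p\<in>{p \<in> pairs n d v. \<not> small V (fst p)}. y * real (3 * N))"
  proof -
    have "(\<Sum>p\<in>?P. if small V (fst p) then \<tau> * ?b else y * real (3 * N))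
       \<le> (\<Sum>p\<in>pairs n d v. if small V (fst p) then \<tau> * ?b else y * real (3 * N))"
      using nonneg by (intro sum_mono2) auto
    also have "\<dots> \<le> (\<Sum>p\<in>pairs n d v. \<tau> * ?b + (if \<not> small V (fst p) then y * real (3 * N) else 0))"
      using nonneg by (intro sum_mono) auto
    also have "\<dots> = (\<Sum>p\<in>pairs n d v. \<tau> * ?b) + (\<Sum>p\<in>{p \<in> pairs n d v. \<not> small V (fst p)}. y * real (3 * N))"
      by (simp only: sum.distrib sum.inter_filter[OF finite_pairs])
    finally show ?thesis .
  qed
  also have "(\<Sum>p\<in>pairs n d v. \<tau> * ?b) = (\<tau> * real (card (pairs n d v))) * ?b" by simp
  also have "\<dots> \<le> 1 * ?b"
  proof (rule mult_right_mono)
    have "\<tau> * real (card (pairs n d v)) \<le> \<tau> * real ((d - 1) * ((n - 1) choose (d - 1)))"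
      using card_pairs[OF v(1), of d] nonneg by (intro mult_left_mono of_nat_mono) auto
    then show "\<tau> * real (card (pairs n d v)) \<le> 1" using tree by simp
  qed (use nonneg in auto)
  also have "(\<Sum>p\<in>{p \<in> pairs n d v. \<not> small V (fst p)}. y * real (3 * N))
    = (\<Sum>p\<in>{p \<in> pairs n d v. \<not> small V (fst p)}. y) * real (3 * N)"
    by (simp only: sum_distrib_right)
  also have "\<dots> \<le> x * real (3 * N)"
    using sum_weight_excess[OF v(2-5) nonneg(2) excess] by (intro mult_right_mono) auto
  finally show ?case by (simp add: algebra_simps)
qed

lemma upd_old:
  assumes "valid (V, T, X)" "f \<noteq> Mid" "e \<in> T"
  shows "upd (V, T, X) (f, e) = (V, T, X)" "stepw (V, T, X) (f, e) = 1"
  using assms not_small_subset[of e V] by (auto simp: Un_absorb2)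

lemma wt_old:
  assumes "valid (V, T, X)" "f \<noteq> Mid" "fst ` set s \<subseteq> T"
  shows "wt (V, T, X) (lab f (s @ t)) = wt (V, T, X) (lab f t)"
  using assms(3)
proof (induction s)
  case (Cons p s)
  then show ?case using upd_old[OF assms(1,2), of "fst p"] by simp
qed simp

text \<open>The walk is split after its longest initial run of edges from \<open>T\<close>. The run
  is determined by its endpoint in \<open>V\<close>, which leaves at most \<open>N\<close> choices,
  each of weight 1. The remainder consists of new tree edges only, or starts with a new edge and
  contains an excess edge, or starts with a recorded excess edge. Each class weighs at most 1,
  whence 3 N.\<close>

lemma seg_bound:
  assumes f: "f \<noteq> Mid"
  shows "seg_bound f r"
proof (induction r rule: less_induct)
  case (less r)
  show ?case unfolding seg_bound_def
  proof (intro allI impI)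
    fix st :: state and v
    assume i: "valid st" and room: "room st r" and vV: "v \<in> fst st"
    obtain V T X where st: "st = (V, T, X)" by (cases st)
    have V: "finite V" "V \<subseteq> {..<n}" "hforest T" "\<And>e. e \<in> T \<union> X \<Longrightarrow> e \<subseteq> V \<and> e \<in> dsets n d" "finite X"
      using i st by auto
    have N: "card V \<le> N" "r \<le> N" "card X \<le> N" using card_V_le room st by blast+
    define Rn where "Rn = {s. saw v s \<and> fst ` set s \<subseteq> T \<and> length s \<le> r}"
    have endV: "endv v s \<in> V" if "s \<in> Rn" for s
    proof (cases "s = []")
      case False
      have "endv v s \<in> cover s" using endv_cover False that by (auto simp: Rn_def)
      moreover have "cover s \<subseteq> V" using that V(4) by (auto simp: Rn_def cover_def)
      ultimately show ?thesis by auto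
    qed (use vV st in auto)
    have inj: "inj_on (endv v) Rn"
      using hforest_saw_unique[OF V(3)] by (auto simp: inj_on_def Rn_def)
    have finR: "finite Rn" using inj endV V(1) by (meson finite_imageD finite_subset image_subsetI)
    have cardR: "card Rn \<le> N"
      using card_inj_on_le[OF inj _ V(1)] endV N(1) by (meson image_subsetI le_trans)
    define Q :: "(nat set \<times> nat) list \<Rightarrow> (nat set \<times> nat) list set" where "Q s = {t \<in> saws n d (r - length s) (endv v s). t \<noteq> [] \<longrightarrow> fst (hd t) \<notin> T}" for s
    have rest: "(\<Sum>t\<in>Q s. wt st (lab f t)) \<le> 3" if s: "s \<in> Rn" for s
    proof -
      define q where "q = r - length s"
      define w where "w = endv v s"
      have q: "q \<le> r" and w: "w \<in> V" using endV s by (auto simp: q_def w_def)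
      have szq: "room st q" using room_mono[OF room q] .
      let ?A = "{t \<in> saws n d q w. allT (fst st) t}"
      let ?B = "{t \<in> saws n d q w. fresh st t \<and> \<not> allT (fst st) t}"
      let ?C = "{t \<in> saws n d q w. t \<noteq> [] \<and> fst (hd t) \<in> X}"
      have A: "(\<Sum>t\<in>?A. wt st (lab f t)) \<le> 1"
        using sum_tree_walks[OF f i] w st by simp
      have "(\<Sum>t\<in>?B. wt st (lab f t)) \<le> real q * (real (3 * N) * x)"
        using sum_fresh_walks[OF f i szq, of w] w st less q by simp
      also have "\<dots> \<le> real N * (real (3 * N) * x)"
        using q N nonneg by (intro mult_right_mono) auto
      finally have B: "(\<Sum>t\<in>?B. wt st (lab f t)) \<le> 1" using x_small by simp
      have C: "(\<Sum>t\<in>?C. wt st (lab f t)) \<le> 1"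
      proof (cases q)
        case 0
        then have "?C = {}" by (auto simp: saws_def)
        then show ?thesis by (simp only: sum.empty)
      next
        case (Suc q')
        \<comment> \<open>A reused excess edge and the vertex at which it is left: at most N d
          choices. \<open>z\<close> pays for them and for the factor 3 N of the
          continuation.\<close>
        let ?P = "Sigma X (\<lambda>e::nat set. e)"
        have finX: "finite e" if "e \<in> X" for e using V(4)[of e] that dsetsD(3) by blast
        then have finP: "finite ?P" using V(5) by (intro finite_SigmaI)
        have cardP: "card ?P \<le> N * d"
        proof -
          have "card ?P = (\<Sum>e\<in>X. card e)" using V(5) finX by (intro card_SigmaI) auto
          also have "\<dots> = (\<Sum>e\<in>X. d)"
            using V(4) by (intro sum.cong refl) (auto intro!: dsetsD(2))
          also have "\<dots> = card X * d" by simp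
          finally show ?thesis using N(3) by simp
        qed
        have "(\<Sum>t\<in>?C. wt st (lab f t)) \<le> (\<Sum>p\<in>?P. \<Sum>t\<in>saws n d q' (snd p). wt st (lab f (p # t)))"
        proof (rule sum_le_sum_Sigma[OF finP])
          fix t assume t: "t \<in> ?C"
          then obtain p t' where "p \<in> pairs n d w" "t' \<in> saws n d q' (snd p)" "t = p # t'"
            using saws_Suc[of t q' w] Suc by auto
          moreover from this have "p \<in> ?P" using t by (cases p) (auto simp: pairs_def)
          ultimately show "\<exists>p\<in>?P. \<exists>t'\<in>saws n d q' (snd p). t = p # t'" by blast
        qed auto
        also have "\<dots> \<le> (\<Sum>p\<in>?P. z * real (3 * N))"
        proof (rule sum_mono)
          fix p assume p: "p \<in> ?P"
          then have e: "fst p \<in> X" "snd p \<in> fst p" by auto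
          then have d: "snd (f, fst p) \<in> dsets n d" and ns: "\<not> small V (fst p)" "fst p \<notin> T"
            using V(4)[of "fst p"] not_small_subset i st by auto
          note j = valid_upd[OF i d] room_upd[OF i d szq[unfolded Suc]]
          have "snd p \<in> fst (upd st (f, fst p))" using e st by auto
          then have "(\<Sum>t\<in>saws n d q' (snd p). wt (upd st (f, fst p)) (lab f t)) \<le> real (3 * N)"
            using less[of q'] Suc q j unfolding seg_bound_def by (metis less_eq_Suc_le)
          then have "z * (\<Sum>t\<in>saws n d q' (snd p). wt (upd st (f, fst p)) (lab f t)) \<le> z * real (3 * N)"
            using nonneg by (intro mult_left_mono) auto
          then show "(\<Sum>t\<in>saws n d q' (snd p). wt st (lab f (p # t))) \<le> z * real (3 * N)"
            using ns e f st by (simp add: sum_distrib_left)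
        qed
        also have "\<dots> = real (card ?P) * (z * real (3 * N))" by simp
        also have "\<dots> \<le> real (N * d) * (z * real (3 * N))"
          using cardP nonneg by (intro mult_right_mono of_nat_mono) auto
        also have "\<dots> \<le> 1" using revisit by (simp add: algebra_simps)
        finally show ?thesis .
      qed
      have sub: "Q s \<subseteq> (?A \<union> ?B) \<union> ?C" using st by (auto simp: Q_def q_def w_def)
      have "(\<Sum>t\<in>Q s. wt st (lab f t)) \<le> (\<Sum>t\<in>(?A \<union> ?B) \<union> ?C. wt st (lab f t))"
        using sub by (intro sum_mono2) auto
      also have "\<dots> \<le> (\<Sum>t\<in>?A. wt st (lab f t)) + (\<Sum>t\<in>?B. wt st (lab f t)) + (\<Sum>t\<in>?C. wt st (lab f t))"
        using sum_Un_le[of ?A ?B "\<lambda>t. wt st (lab f t)"] sum_Un_le[of "?A \<union> ?B" ?C "\<lambda>t. wt st (lab f t)"]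
        by simp
      finally show ?thesis using A B C by simp
    qed
    have "(\<Sum>s\<in>saws n d r v. wt st (lab f s)) \<le> (\<Sum>s\<in>Rn. \<Sum>t\<in>Q s. wt st (lab f (s @ t)))"
    proof (rule sum_le_sum_Sigma[OF finR])
      fix s assume s: "s \<in> saws n d r v"
      define s1 s2 where "s1 = takeWhile (\<lambda>p. fst p \<in> T) s" and "s2 = dropWhile (\<lambda>p. fst p \<in> T) s"
      have ss: "s = s1 @ s2" by (simp add: s1_def s2_def)
      have "saw v s1" "saw (endv v s1) s2" using sawsD(2)[OF s] unfolding ss by (auto simp: saw_append)
      moreover have "fst ` set s1 \<subseteq> T" unfolding s1_def by (auto dest: set_takeWhileD)
      moreover have "s2 \<noteq> [] \<longrightarrow> fst (hd s2) \<notin> T" unfolding s2_def using hd_dropWhile by blast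
      moreover have "length s1 \<le> r" "length s2 = r - length s1" "fst ` set s2 \<subseteq> dsets n d"
        using sawsD(1,3)[OF s] unfolding ss by auto
      ultimately show "\<exists>s1\<in>Rn. \<exists>s2\<in>Q s1. s = s1 @ s2"
        using ss by (intro bexI[of _ s1] bexI[of _ s2]) (auto simp: Rn_def Q_def saws_def)
    qed (auto simp: Q_def)
    also have "\<dots> \<le> (\<Sum>s\<in>Rn. 3)"
    proof (rule sum_mono)
      fix s assume s: "s \<in> Rn"
      then have "wt st (lab f (s @ t)) = wt st (lab f t)" for t
        using wt_old[of V T X f s t] i st f by (simp add: Rn_def)
      then show "(\<Sum>t\<in>Q s. wt st (lab f (s @ t))) \<le> 3" using rest[OF s] by simp
    qed
    also have "\<dots> \<le> real (3 * N)" using cardR by simp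
    finally show "(\<Sum>s\<in>saws n d r v. wt st (lab f s)) \<le> real (3 * N)" .
  qed
qed

end

section \<open>Blocks and chains of blocks\<close>

type_synonym token = "(flag \<times> nat set) \<times> nat"
text \<open>For each start vertex, the walks that contribute to the corresponding row of a matrix.
  Matrix products then become concatenations.\<close>

type_synonym block = "nat \<Rightarrow> token list set"

definition tag :: "flag \<Rightarrow> (nat set \<times> nat) list \<Rightarrow> token list" where
  "tag f s = map (\<lambda>p. ((f, fst p), snd p)) s"

text \<open>Middle tokens carry the deterministic factor \<open>p e\<close>, so multiplicities are
  counted without them.\<close>

definition unmid :: "(flag \<times> nat set) list \<Rightarrow> nat set list" where
  "unmid qs = map snd (filter (\<lambda>q. fst q \<noteq> Mid) qs)"

definition nflag :: "flag \<Rightarrow> (flag \<times> nat set) list \<Rightarrow> nat" where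
  "nflag f qs = length (filter (\<lambda>q. fst q = f) qs)"

text \<open>A saw block is a walk entering \<open>\<Delta>\<close>; a crossing block is a walk entering \<open>\<Gamma>\<close>,
  namely two self-avoiding walks joined by a middle edge into a walk that is not self-avoiding.\<close>

definition saw_block :: "nat \<Rightarrow> nat \<Rightarrow> flag \<Rightarrow> nat \<Rightarrow> block" where
  "saw_block n d f l v = tag f ` saws n d l v"

definition crossing_block :: "nat \<Rightarrow> nat \<Rightarrow> flag \<Rightarrow> nat \<Rightarrow> flag \<Rightarrow> nat \<Rightarrow> block" where
  "crossing_block n d f p g q v =
     {tag f s @ ((Mid, fst m), snd m) # tag g t | s m t.
        s \<in> saws n d p v \<and> m \<in> pairs n d (endv v s) \<and> t \<in> saws n d q (snd m)
        \<and> \<not> saw v (s @ m # t)}"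

text \<open>A nested sum, as it arises from expanding a matrix product. The set
  \<open>chains\<close> collects the possible arguments, for pointwise bounds.\<close>

fun chain_sum :: "block list \<Rightarrow> nat \<Rightarrow> (token list \<Rightarrow> real) \<Rightarrow> real" where
  "chain_sum [] i f = f []"
| "chain_sum (B # L) i f = (\<Sum>b\<in>B i. chain_sum L (endv i b) (\<lambda>c. f (b @ c)))"

fun chains :: "block list \<Rightarrow> nat \<Rightarrow> token list set" where
  "chains [] i = {[]}"
| "chains (B # L) i = {b @ c | b c. b \<in> B i \<and> c \<in> chains L (endv i b)}"

text \<open>An edge occurs at most twice outside the middle position of a block: at most once in each of
  its at most two self-avoiding pieces.\<close>

definition wf_block :: "nat \<Rightarrow> nat \<Rightarrow> nat \<Rightarrow> nat \<Rightarrow> nat \<Rightarrow> block \<Rightarrow> bool" where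
  "wf_block n d len cC cU B \<longleftrightarrow> (\<forall>v<n. finite (B v) \<and> (\<forall>b\<in>B v.
      length b = len \<and> (\<forall>q\<in>set (map fst b). snd q \<in> dsets n d)
      \<and> endv v b \<in> insert v (\<Union>q\<in>set (map fst b). snd q)
      \<and> nflag Cen (map fst b) = cC \<and> nflag Unc (map fst b) = cU
      \<and> (\<forall>e. count_list (unmid (map fst b)) e \<le> 2)))"

lemma tag_simps [simp]: "tag f [] = []" "tag f (p # s) = ((f, fst p), snd p) # tag f s"
  "map fst (tag f s) = lab f s" "length (tag f s) = length s" "endv v (tag f s) = endv v s"
  "revw v (tag f s) = tag f (revw v s)"
proof -
  show "endv v (tag f s) = endv v s"
    by (induction s arbitrary: v) (auto simp: tag_def)
  show "revw v (tag f s) = tag f (revw v s)"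
    by (induction s arbitrary: v) (auto simp: tag_def)
qed (auto simp: tag_def lab_def)

lemma unmid_simps [simp]: "unmid [] = []"
  "unmid (q # qs) = (if fst q = Mid then unmid qs else snd q # unmid qs)"
  "unmid (qs @ rs) = unmid qs @ unmid rs"
  by (auto simp: unmid_def)

lemma nflag_simps [simp]: "nflag f [] = 0"
  "nflag f (q # qs) = (if fst q = f then Suc (nflag f qs) else nflag f qs)"
  "nflag f (qs @ rs) = nflag f qs + nflag f rs"
  by (auto simp: nflag_def)

lemma unmid_lab [simp]: "f \<noteq> Mid \<Longrightarrow> unmid (lab f s) = map fst s"
  by (induction s) auto

lemma nflag_lab [simp]: "nflag g (lab f s) = (if f = g then length s else 0)"
  by (induction s) auto

lemma snd_set_lab [simp]: "snd ` set (lab f s) = fst ` set s"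
  by (simp add: lab_def image_image)

lemma count_list_distinct: "distinct xs \<Longrightarrow> count_list xs e \<le> 1"
  by (induction xs) (auto simp: count_notin)

lemma endv_in_cover: "saw v s \<Longrightarrow> endv v s \<in> insert v (cover s)"
  using endv_cover by (cases "s = []") auto

lemma wf_saw_block:
  assumes "f \<noteq> Mid"
  shows "wf_block n d l (if f = Cen then l else 0) (if f = Unc then l else 0) (saw_block n d f l)"
  unfolding wf_block_def
proof (intro allI impI conjI ballI)
  fix v b assume "b \<in> saw_block n d f l v"
  then obtain s where s: "s \<in> saws n d l v" and b: "b = tag f s" by (auto simp: saw_block_def)
  have s': "length s = l" "saw v s" "fst ` set s \<subseteq> dsets n d" using s by (auto simp: saws_def)
  show "length b = l" "nflag Cen (map fst b) = (if f = Cen then l else 0)" 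
    "nflag Unc (map fst b) = (if f = Unc then l else 0)" using s' b by auto
  show "count_list (unmid (map fst b)) e \<le> 2" for e
    using count_list_distinct[OF saw_distinct_edges[OF s'(2)], of e] b assms by simp
  show "q \<in> set (map fst b) \<Longrightarrow> snd q \<in> dsets n d" for q
    using s' b by (force simp: lab_def)
  show "endv v b \<in> insert v (\<Union>q\<in>set (map fst b). snd q)"
    using endv_in_cover[OF s'(2)] b by (auto simp: cover_def lab_def)
qed (auto simp: saw_block_def)

lemma wf_crossing_block:
  assumes "f \<noteq> Mid" "g \<noteq> Mid"
  shows "wf_block n d (p + Suc q) ((if f = Cen then p else 0) + (if g = Cen then q else 0))
     ((if f = Unc then p else 0) + (if g = Unc then q else 0)) (crossing_block n d f p g q)"
  unfolding wf_block_def
proof (intro allI impI conjI ballI)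
  fix v b assume "b \<in> crossing_block n d f p g q v"
  then obtain s m t where s: "s \<in> saws n d p v" and m: "m \<in> pairs n d (endv v s)"
    and t: "t \<in> saws n d q (snd m)" and b: "b = tag f s @ ((Mid, fst m), snd m) # tag g t"
    by (auto simp: crossing_block_def)
  have s': "length s = p" "saw v s" "fst ` set s \<subseteq> dsets n d" using s by (auto simp: saws_def)
  have t': "length t = q" "saw (snd m) t" "fst ` set t \<subseteq> dsets n d" using t by (auto simp: saws_def)
  have m': "fst m \<in> dsets n d" "snd m \<in> fst m" using m by (auto simp: pairs_def)
  show "length b = p + Suc q" 
    "nflag Cen (map fst b) = (if f = Cen then p else 0) + (if g = Cen then q else 0)" 
    "nflag Unc (map fst b) = (if f = Unc then p else 0) + (if g = Unc then q else 0)"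
    using s' t' b by auto
  show "count_list (unmid (map fst b)) e \<le> 2" for e
    using count_list_distinct[OF saw_distinct_edges[OF s'(2)], of e]
      count_list_distinct[OF saw_distinct_edges[OF t'(2)], of e] b assms by simp
  show "q \<in> set (map fst b) \<Longrightarrow> snd q \<in> dsets n d" for q
    using s' t' m' b by (force simp: lab_def)
  show "endv v b \<in> insert v (\<Union>q\<in>set (map fst b). snd q)"
    using endv_in_cover[OF t'(2)] b m' by (auto simp: cover_def lab_def)
next
  fix v
  let ?S = "\<Union>s\<in>saws n d p v. \<Union>m\<in>pairs n d (endv v s). 
    (\<lambda>t. tag f s @ ((Mid, fst m), snd m) # tag g t) ` saws n d q (snd m)"
  have "crossing_block n d f p g q v \<subseteq> ?S"
    unfolding crossing_block_def by blast
  moreover have "finite ?S" by auto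
  ultimately show "finite (crossing_block n d f p g q v)" by (rule finite_subset)
qed

lemma wf_blockD:
  assumes "wf_block n d len cC cU B" "v < n" "b \<in> B v"
  shows "length b = len" "\<And>q. q \<in> set (map fst b) \<Longrightarrow> snd q \<in> dsets n d"
    "endv v b \<in> insert v (\<Union>q\<in>set (map fst b). snd q)"
    "nflag Cen (map fst b) = cC" "nflag Unc (map fst b) = cU"
    "count_list (unmid (map fst b)) e \<le> 2" "endv v b < n"
proof -
  show *: "length b = len" "\<And>q. q \<in> set (map fst b) \<Longrightarrow> snd q \<in> dsets n d"
    "endv v b \<in> insert v (\<Union>q\<in>set (map fst b). snd q)"
    "nflag Cen (map fst b) = cC" "nflag Unc (map fst b) = cU"
    "count_list (unmid (map fst b)) e \<le> 2"
    using assms unfolding wf_block_def by blast+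
  have "(\<Union>q\<in>set (map fst b). snd q) \<subseteq> {..<n}"
    by (rule UN_least) (rule dsetsD(1)[OF *(2)])
  then have "insert v (\<Union>q\<in>set (map fst b). snd q) \<subseteq> {..<n}"
    using assms(2) by (simp only: insert_subset lessThan_iff simp_thms)
  then have "endv v b \<in> {..<n}" using *(3) by (rule subsetD)
  then show "endv v b < n" by (simp only: lessThan_iff)
qed

lemma chainsD:
  assumes "\<forall>B\<in>set L. wf_block n d len cC cU B" "i < n" "c \<in> chains L i"
  shows "length c = length L * len \<and> (\<forall>q\<in>set (map fst c). snd q \<in> dsets n d)
    \<and> nflag Cen (map fst c) = length L * cC \<and> nflag Unc (map fst c) = length L * cU
    \<and> (\<forall>e. count_list (unmid (map fst c)) e \<le> 2 * length L)"
  using assms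
proof (induction L arbitrary: i c)
  case (Cons B L)
  then obtain b c' where bc: "c = b @ c'" "b \<in> B i" "c' \<in> chains L (endv i b)" by auto
  have B: "wf_block n d len cC cU B" using Cons.prems by simp
  note b = wf_blockD[OF B Cons.prems(2) bc(2)]
  have IH: "length c' = length L * len \<and> (\<forall>q\<in>set (map fst c'). snd q \<in> dsets n d)
    \<and> nflag Cen (map fst c') = length L * cC \<and> nflag Unc (map fst c') = length L * cU
    \<and> (\<forall>e. count_list (unmid (map fst c')) e \<le> 2 * length L)"
    using Cons.IH[OF _ b(7) bc(3)] Cons.prems(1) by simp
  have "count_list (unmid (map fst c)) e \<le> 2 * length (B # L)" for e
    using b(6)[of e] IH[THEN conjunct2, THEN conjunct2, THEN conjunct2, THEN conjunct2, rule_format, of e]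
      bc(1) by simp
  moreover have "\<forall>q\<in>set (map fst c). snd q \<in> dsets n d"
    using IH b(2) unfolding bc(1) map_append set_append by blast
  ultimately show ?case using IH b(1,4,5) bc(1) by simp
qed simp

lemma chain_sum_mono:
  assumes "\<And>c. c \<in> chains L i \<Longrightarrow> f c \<le> g c"
  shows "chain_sum L i f \<le> chain_sum L i g"
  using assms
proof (induction L arbitrary: i f g)
  case (Cons B L)
  show ?case unfolding chain_sum.simps by (intro sum_mono Cons) (auto intro: Cons.prems)
qed auto

lemma chain_sum_mult: "chain_sum L i (\<lambda>c. a * f c) = a * chain_sum L i f"
  by (induction L arbitrary: i f) (auto simp: sum_distrib_left)

lemma chain_sum_sum: "(\<Sum>x\<in>A. chain_sum L i (f x)) = chain_sum L i (\<lambda>c. \<Sum>x\<in>A. f x c)"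
proof (induction L arbitrary: i f)
  case (Cons B L)
  show ?case unfolding chain_sum.simps by (subst sum.swap) (simp add: Cons)
qed auto

text \<open>The first edge meets \<open>W\<close> in \<open>u\<close> alone and is left outside
  \<open>W\<close>; by induction the later edges meet the enlarged set only in that new
  vertex.\<close>

lemma allT_cover:
  assumes "saw u s" "allT W s" "u \<in> W"
  shows "cover s \<inter> W \<subseteq> {u}"
  using assms
proof (induction s arbitrary: u W)
  case (Cons p s)
  obtain c where "fst p \<inter> W \<subseteq> {c}" using Cons.prems by (auto simp: small_def)
  then have "fst p \<inter> W \<subseteq> {u}" using Cons.prems by auto
  moreover have "cover s \<inter> (W \<union> fst p) \<subseteq> {snd p}"
    using Cons by auto
  ultimately show ?case using Cons.prems by auto
qed auto

text \<open>By contraposition, every crossing block has a middle edge meeting the explored vertices twice or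
  an excess edge in its second piece; this is where \<open>\<Gamma>\<close> gains the factor \<open>1 / n\<close>.\<close>

lemma saw_join:
  assumes "saw v s" "saw (snd m) t" "insert v (cover s) \<subseteq> V" "endv v s \<in> fst m" "snd m \<in> fst m"
    "snd m \<noteq> endv v s" "small V (fst m)" "allT (V \<union> fst m) t"
  shows "saw v (s @ m # t)"
proof -
  have w: "endv v s \<in> V" using endv_in_cover[OF assms(1)] assms(3) by auto
  obtain c where "fst m \<inter> V \<subseteq> {c}" using assms(7) by (auto simp: small_def)
  then have e: "fst m \<inter> V \<subseteq> {endv v s}" using w assms(4) by auto
  have "cover t \<inter> (V \<union> fst m) \<subseteq> {snd m}"
    using allT_cover[OF assms(2,8)] assms(5) by auto
  then show ?thesis using assms e unfolding saw_append by auto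
qed

section \<open>Exploration weights of blocks and chains\<close>

context exploration
begin

text \<open>If the middle edge is not \<open>small\<close>, the middle edges weigh \<open>x\<close>
  in total and the second piece at most 3 N. Otherwise they weigh at most \<open>\<kappa>\<close>,
  but then the second piece must contain an excess edge, so \<open>sum_fresh_walks\<close> supplies
  the factor \<open>x\<close>.\<close>

lemma sum_middle:
  assumes g: "g \<noteq> Mid" and i: "valid st" and room: "room st (Suc q)" and w: "w \<in> fst st"
    and R: "\<And>m t. m \<in> pairs n d w \<Longrightarrow> t \<in> R m \<Longrightarrow> t \<in> saws n d q (snd m) \<and> (small (fst st) (fst m) \<longrightarrow> \<not> allT (fst st \<union> fst m) t)"
  shows "(\<Sum>m\<in>pairs n d w. \<Sum>t\<in>R m. wt st ((Mid, fst m) # lab g t))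
    \<le> x * real (3 * N) + \<kappa> * (real q * (real (3 * N) * x))"
proof -
  obtain V T X where st: "st = (V, T, X)" by (cases st)
  have V: "w \<in> V" "finite V" "V \<subseteq> {..<n}" "card V \<le> N" "w < n" "\<And>e. e \<in> T \<union> X \<Longrightarrow> e \<subseteq> V" 
    using i w room st by auto
  let ?b = "real q * (real (3 * N) * x)"
  have "(\<Sum>m\<in>pairs n d w. \<Sum>t\<in>R m. wt st ((Mid, fst m) # lab g t))
    \<le> (\<Sum>m\<in>pairs n d w. \<mu> * ?b + (if \<not> small V (fst m) then \<mu> * real (3 * N) else 0))"
  proof (rule sum_mono)
    fix m assume m: "m \<in> pairs n d w"
    let ?u = "upd st (Mid, fst m)"
    have d: "snd (Mid, fst m) \<in> dsets n d" and u: "snd m \<in> fst ?u"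
      using m st by (auto simp: pairs_def)
    note j = valid_upd[OF i d] room_upd[OF i d room]
    have eq: "(\<Sum>t\<in>R m. wt st ((Mid, fst m) # lab g t)) = \<mu> * (\<Sum>t\<in>R m. wt ?u (lab g t))"
      using st by (simp add: sum_distrib_left)
    show "(\<Sum>t\<in>R m. wt st ((Mid, fst m) # lab g t))
       \<le> \<mu> * ?b + (if \<not> small V (fst m) then \<mu> * real (3 * N) else 0)"
    proof (cases "small V (fst m)")
      case True
      obtain c where "fst m \<inter> V \<subseteq> {c}" using True by (auto simp: small_def)
      then have un: "snd m \<notin> V" using m V(1) by (auto simp: pairs_def)
      \<comment> \<open>The middle edge ends outside \<open>V\<close>, so no recorded edge can
        follow. The middle edge itself is not recorded, so its reuse by \<open>t\<close> would be
        charged as a new edge.\<close>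
      have "R m \<subseteq> {t \<in> saws n d q (snd m). fresh ?u t \<and> \<not> allT (fst ?u) t}"
      proof
        fix t assume t: "t \<in> R m"
        have "fresh ?u t"
        proof (cases t)
          case (Cons p t')
          then have "snd m \<in> fst p" using R[OF m t] by (auto simp: saws_def)
          then show ?thesis using un V(6) Cons st by auto
        qed (simp add: st)
        then show "t \<in> {t \<in> saws n d q (snd m). fresh ?u t \<and> \<not> allT (fst ?u) t}"
          using R[OF m t] True st by auto
      qed
      then have "(\<Sum>t\<in>R m. wt ?u (lab g t))
         \<le> (\<Sum>t\<in>{t \<in> saws n d q (snd m). fresh ?u t \<and> \<not> allT (fst ?u) t}. wt ?u (lab g t))"
        by (intro sum_mono2) auto
      also have "\<dots> \<le> ?b" using sum_fresh_walks[OF g j u] seg_bound[OF g] by blast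
      finally show ?thesis using True eq nonneg by (simp add: mult_left_mono)
    next
      case False
      have "(\<Sum>t\<in>R m. wt ?u (lab g t)) \<le> (\<Sum>t\<in>saws n d q (snd m). wt ?u (lab g t))"
        using R[OF m] by (intro sum_mono2) auto
      also have "\<dots> \<le> real (3 * N)"
        using seg_bound[OF g] j u unfolding seg_bound_def by blast
      finally have "\<mu> * (\<Sum>t\<in>R m. wt ?u (lab g t)) \<le> \<mu> * real (3 * N)"
        using nonneg by (intro mult_left_mono)
      moreover have "0 \<le> \<mu> * ?b" using nonneg by simp
      ultimately show ?thesis unfolding eq if_P[OF False] by linarith
    qed
  qed
  also have "\<dots> = \<mu> * real (card (pairs n d w)) * ?b
     + (\<Sum>m\<in>{m \<in> pairs n d w. \<not> small V (fst m)}. \<mu>) * real (3 * N)"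
    unfolding sum.distrib sum.inter_filter[OF finite_pairs, symmetric] by (simp add: sum_distrib_right)
  also have "\<dots> \<le> \<kappa> * ?b + x * real (3 * N)"
  proof (intro add_mono mult_right_mono)
    have "\<mu> * real (card (pairs n d w)) \<le> \<mu> * real ((d - 1) * ((n - 1) choose (d - 1)))"
      using card_pairs[OF V(5), of d] nonneg by (intro mult_left_mono of_nat_mono) auto
    then show "\<mu> * real (card (pairs n d w)) \<le> \<kappa>" using mid by simp
    show "(\<Sum>m\<in>{m \<in> pairs n d w. \<not> small V (fst m)}. \<mu>) \<le> x"
      using sum_weight_excess[OF V(1-4) nonneg(4) mid_excess] .
  qed (use nonneg in auto)
  finally show ?thesis by simp
qed

definition block_bound :: "nat \<Rightarrow> real \<Rightarrow> block \<Rightarrow> bool" where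
  "block_bound len \<beta> B \<longleftrightarrow> (\<forall>st v. valid st \<longrightarrow> room st len \<longrightarrow> v \<in> fst st \<longrightarrow>
     (\<Sum>b\<in>B v. wt st (map fst b)) \<le> \<beta>)"

lemma block_bound_saw:
  assumes "f \<noteq> Mid"
  shows "block_bound l (real (3 * N)) (saw_block n d f l)"
  unfolding block_bound_def
proof (intro allI impI)
  fix st v assume a: "valid st" "room st l" "v \<in> fst st"
  have "(\<Sum>b\<in>saw_block n d f l v. wt st (map fst b)) \<le> (\<Sum>s\<in>saws n d l v. wt st (map fst (tag f s)))"
    unfolding saw_block_def by (intro order.trans[OF sum_image_le]) auto
  also have "\<dots> = (\<Sum>s\<in>saws n d l v. wt st (lab f s))" by (simp only: tag_simps)
  also have "\<dots> \<le> real (3 * N)"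
    using seg_bound[OF assms, of l] a unfolding seg_bound_def by blast
  finally show "(\<Sum>b\<in>saw_block n d f l v. wt st (map fst b)) \<le> real (3 * N)" .
qed

text \<open>The first piece costs 3 N whatever it does. By \<open>saw_join\<close>, the failure of
  self-avoidance shows up in the middle edge or in the second piece, where \<open>sum_middle\<close>
  gains the factor \<open>x\<close>.\<close>

lemma block_bound_crossing:
  assumes "f \<noteq> Mid" "g \<noteq> Mid"
  shows "block_bound (p + Suc q) (real (3 * N) * (x * real (3 * N) + \<kappa> * (real q * (real (3 * N) * x))))
     (crossing_block n d f p g q)"
  unfolding block_bound_def
proof (intro allI impI)
  fix st v assume a: "valid st" "room st (p + Suc q)" "v \<in> fst st"
  let ?w = "\<lambda>s. endv v s"
  let ?R = "\<lambda>s m. {t \<in> saws n d q (snd m). \<not> saw v (s @ m # t)}"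
  let ?c = "x * real (3 * N) + \<kappa> * (real q * (real (3 * N) * x))"
  have "(\<Sum>b\<in>crossing_block n d f p g q v. wt st (map fst b))
     \<le> (\<Sum>s\<in>saws n d p v. \<Sum>r\<in>Sigma (pairs n d (?w s)) (?R s).
          wt st (map fst (tag f s @ ((Mid, fst (fst r)), snd (fst r)) # tag g (snd r))))"
  proof (rule sum_le_sum_Sigma)
    fix b assume "b \<in> crossing_block n d f p g q v"
    then obtain s m t where "s \<in> saws n d p v" "m \<in> pairs n d (endv v s)"
      "t \<in> saws n d q (snd m)" "b = tag f s @ ((Mid, fst m), snd m) # tag g t" "\<not> saw v (s @ m # t)"
      by (auto simp: crossing_block_def)
    then show "\<exists>s\<in>saws n d p v. \<exists>r\<in>Sigma (pairs n d (?w s)) (?R s).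
       b = tag f s @ ((Mid, fst (fst r)), snd (fst r)) # tag g (snd r)"
      by (intro bexI[of _ s] bexI[of _ "(m, t)"]) auto
  qed auto
  also have "\<dots> \<le> (\<Sum>s\<in>saws n d p v. wt st (lab f s) * ?c)"
  proof (rule sum_mono)
    fix s assume s: "s \<in> saws n d p v"
    let ?st = "fold (\<lambda>q s. upd s q) (lab f s) st"
    have s': "length (lab f s) = p" "saw v s" "snd ` set (lab f s) \<subseteq> dsets n d"
      using s by (auto simp: saws_def lab_def)
    have j: "valid ?st" "room ?st (Suc q)" using valid_sz_fold[OF a(1) s'(3), of "Suc q"] a(2) s'(1) by auto
    have cov: "insert v (cover s) \<subseteq> fst ?st"
      using a(3) by (auto simp: fst_fold_upd cover_def lab_def)
    then have w: "?w s \<in> fst ?st" using endv_in_cover[OF s'(2)] by auto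
    have "(\<Sum>r\<in>Sigma (pairs n d (?w s)) (?R s).
          wt st (map fst (tag f s @ ((Mid, fst (fst r)), snd (fst r)) # tag g (snd r))))
       = wt st (lab f s) * (\<Sum>m\<in>pairs n d (?w s). \<Sum>t\<in>?R s m. wt ?st ((Mid, fst m) # lab g t))"
      by (subst sum.Sigma) (auto simp: wt_append sum_distrib_left case_prod_unfold simp del: wt.simps)
    also have "\<dots> \<le> wt st (lab f s) * ?c"
    proof (intro mult_left_mono sum_middle[OF assms(2) j w])
      fix m t assume m: "m \<in> pairs n d (?w s)" and t: "t \<in> {t \<in> saws n d q (snd m). \<not> saw v (s @ m # t)}"
      show "t \<in> saws n d q (snd m) \<and> (small (fst ?st) (fst m) \<longrightarrow> \<not> allT (fst ?st \<union> fst m) t)"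
        using t m saw_join[OF s'(2) _ cov, of m t] by (auto simp: saws_def pairs_def)
    qed auto
    finally show "(\<Sum>r\<in>Sigma (pairs n d (?w s)) (?R s).
          wt st (map fst (tag f s @ ((Mid, fst (fst r)), snd (fst r)) # tag g (snd r))))
       \<le> wt st (lab f s) * ?c" .
  qed
  also have "\<dots> = (\<Sum>s\<in>saws n d p v. wt st (lab f s)) * ?c" by (simp only: sum_distrib_right)
  also have "\<dots> \<le> real (3 * N) * ?c"
  proof (rule mult_right_mono)
    show "(\<Sum>s\<in>saws n d p v. wt st (lab f s)) \<le> real (3 * N)"
      using seg_bound[OF assms(1), of p] a room_mono[OF a(2) le_add1] unfolding seg_bound_def by blast
  qed (use nonneg in simp)
  finally show "(\<Sum>b\<in>crossing_block n d f p g q v. wt st (map fst b)) \<le> real (3 * N) * ?c" .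
qed

text \<open>Block bounds hold from every valid state with enough room, in particular from the state
  left by the previous blocks, so they multiply.\<close>

lemma chain_sum_wt_le:
  assumes "\<forall>B\<in>set L. wf_block n d len cC cU B \<and> block_bound len \<beta> B" "\<beta> \<ge> 0"
    "valid st" "room st (length L * len)" "v \<in> fst st"
  shows "chain_sum L v (\<lambda>c. wt st (map fst c)) \<le> \<beta> ^ length L"
  using assms
proof (induction L arbitrary: st v)
  case (Cons B L)
  have v: "v < n" using Cons.prems by (cases st) auto
  have B: "wf_block n d len cC cU B" "block_bound len \<beta> B" using Cons.prems by auto
  have "chain_sum (B # L) v (\<lambda>c. wt st (map fst c)) \<le> (\<Sum>b\<in>B v. wt st (map fst b) * \<beta> ^ length L)"
    unfolding chain_sum.simps
  proof (rule sum_mono)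
    fix b assume b: "b \<in> B v"
    note bd = wf_blockD[OF B(1) v b]
    let ?st = "fold (\<lambda>q s. upd s q) (map fst b) st"
    have j: "valid ?st \<and> room ?st (length L * len)"
    proof (rule valid_sz_fold[OF Cons.prems(3)])
      show "snd ` set (map fst b) \<subseteq> dsets n d" using bd(2) by blast
      show "room st (length (map fst b) + length L * len)" using bd(1) Cons.prems(4) by simp
    qed
    have e: "endv v b \<in> fst ?st" using bd(3) Cons.prems(5) by (auto simp: fst_fold_upd)
    have "chain_sum L (endv v b) (\<lambda>c. wt st (map fst (b @ c)))
      = wt st (map fst b) * chain_sum L (endv v b) (\<lambda>c. wt ?st (map fst c))"
      by (simp add: wt_append chain_sum_mult)
    also have "\<dots> \<le> wt st (map fst b) * \<beta> ^ length L"
      using Cons.IH[of ?st "endv v b"] Cons.prems j e by (intro mult_left_mono) auto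
    finally show "chain_sum L (endv v b) (\<lambda>c. wt st (map fst (b @ c))) \<le> wt st (map fst b) * \<beta> ^ length L" .
  qed
  also have "\<dots> = (\<Sum>b\<in>B v. wt st (map fst b)) * \<beta> ^ length L" by (simp only: sum_distrib_right)
  also have "\<dots> \<le> \<beta> * \<beta> ^ length L"
  proof (rule mult_right_mono)
    have "room st len" by (rule room_mono[OF Cons.prems(4)]) simp
    then show "(\<Sum>b\<in>B v. wt st (map fst b)) \<le> \<beta>"
      using B(2) Cons.prems unfolding block_bound_def by blast
  qed (use Cons.prems in simp)
  finally show ?case by simp
qed simp

end

section \<open>Averaging over spins\<close>

definition flip :: "nat set \<Rightarrow> (nat \<Rightarrow> int) \<Rightarrow> nat \<Rightarrow> int" where
  "flip D \<sigma> = (\<lambda>i. if i \<in> D then - \<sigma> i else \<sigma> i)"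

definition const_on :: "(nat \<Rightarrow> int) \<Rightarrow> nat set \<Rightarrow> bool" where
  "const_on \<sigma> e \<longleftrightarrow> (\<forall>i\<in>e. \<forall>j\<in>e. \<sigma> i = \<sigma> j)"

text \<open>The mean of \<open>eprob\<close> over uniform spins: \<open>d\<close> independent spins
  agree with probability 2 / 2^d.\<close>

definition pbar :: "nat \<Rightarrow> nat \<Rightarrow> real \<Rightarrow> real \<Rightarrow> real" where
  "pbar n d a b = pn n d b + (pn n d a - pn n d b) / 2 ^ (d - 1)"

lemma spins_bij: "bij_betw (\<lambda>S i. if i \<in> S then -1 else (1::int)) (Pow {..<n}) (spins n)"
  unfolding bij_betw_def
proof
  let ?f = "\<lambda>S i. if i \<in> S then -1 else (1::int)"
  show "inj_on ?f (Pow {..<n})"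
  proof (rule inj_onI)
    fix S S' :: "nat set" assume "?f S = ?f S'"
    then have "?f S i = ?f S' i" for i by (rule fun_cong)
    then have "i \<in> S \<longleftrightarrow> i \<in> S'" for i by (metis one_neq_neg_one)
    then show "S = S'" by blast
  qed
  have "\<sigma> \<in> ?f ` Pow {..<n}" if "\<sigma> \<in> spins n" for \<sigma>
  proof (rule image_eqI)
    have "\<sigma> i = (if i \<in> {i. i < n \<and> \<sigma> i = -1} then -1 else 1)" for i
      using that by (cases "i < n") (auto simp: spins_def)
    then show "\<sigma> = ?f {i. i < n \<and> \<sigma> i = -1}" by blast
  qed auto
  moreover have "?f S \<in> spins n" if "S \<subseteq> {..<n}" for S
    using that by (auto simp: spins_def)
  ultimately show "?f ` Pow {..<n} = spins n" by blast
qed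

lemma card_spins: "card (spins n) = 2 ^ n"
  using bij_betw_same_card[OF spins_bij[of n]] by (simp add: card_Pow)

lemma finite_spins [simp]: "finite (spins n)"
  using bij_betw_finite[OF spins_bij[of n]] by simp

lemma flip_flip [simp]: "flip D (flip D \<sigma>) = \<sigma>"
  by (auto simp: flip_def)

lemma flip_spins: "D \<subseteq> {..<n} \<Longrightarrow> \<sigma> \<in> spins n \<Longrightarrow> flip D \<sigma> \<in> spins n"
  by (auto simp: flip_def spins_def)

lemma sum_flip:
  assumes "D \<subseteq> {..<n}"
  shows "(\<Sum>\<sigma>\<in>spins n. g (flip D \<sigma>)) = (\<Sum>\<sigma>\<in>spins n. g \<sigma>)"
  by (rule sum.reindex_bij_witness[of _ "flip D" "flip D"]) (auto simp: flip_spins[OF assms])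

text \<open>Flipping the spins of \<open>D \<subseteq> e - {c}\<close> does not change \<open>f\<close>, and for every \<open>\<sigma>\<close> exactly one such flip
  makes \<open>\<sigma>\<close> constant on \<open>e\<close>.\<close>

lemma sum_const_on:
  fixes f :: "(nat \<Rightarrow> int) \<Rightarrow> real"
  assumes e: "e \<in> dsets n d" "d \<ge> 1" and U: "e \<inter> U \<subseteq> {c}"
    and f: "\<And>\<sigma> \<sigma>'. (\<And>i. i \<in> U \<Longrightarrow> \<sigma> i = \<sigma>' i) \<Longrightarrow> f \<sigma> = f \<sigma>'"
  shows "(\<Sum>\<sigma>\<in>spins n. f \<sigma> * of_bool (const_on \<sigma> e)) = (\<Sum>\<sigma>\<in>spins n. f \<sigma>) / 2 ^ (d - 1)"
proof -
  have en: "e \<subseteq> {..<n}" "finite e" "card e = d" using e(1) dsetsD by auto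
  have "e \<noteq> {}" using en e(2) by auto
  \<comment> \<open>The vertex kept fixed has to lie in \<open>e\<close>: the common vertex with
    \<open>U\<close> if there is one, any vertex of \<open>e\<close> otherwise.\<close>
  then obtain c' where c': "c' \<in> e" "e \<inter> U \<subseteq> {c'}" using U by blast
  let ?P = "Pow (e - {c'})"
  have cardP: "card ?P = 2 ^ (d - 1)" using en c' by (simp add: card_Pow card_Diff_singleton)
  have one: "(\<Sum>D\<in>?P. of_bool (const_on (flip D \<sigma>) e)) = (1::real)" if \<sigma>: "\<sigma> \<in> spins n" for \<sigma>
  proof -
    define D0 where "D0 = {j \<in> e. \<sigma> j \<noteq> \<sigma> c'}"
    have pm: "\<sigma> j = 1 \<or> \<sigma> j = -1" for j using \<sigma> by (cases "j < n") (auto simp: spins_def)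
    have "const_on (flip D \<sigma>) e \<longleftrightarrow> D = D0" if D: "D \<in> ?P" for D
    proof
      assume con: "const_on (flip D \<sigma>) e"
      have cD: "c' \<notin> D" using D by auto
      have "j \<in> D \<longleftrightarrow> j \<in> D0" if "j \<in> e" for j
      proof -
        have "flip D \<sigma> j = flip D \<sigma> c'" using con that c'(1) unfolding const_on_def by blast
        then have "flip D \<sigma> j = \<sigma> c'" using cD by (simp add: flip_def)
        then show ?thesis using pm[of j] pm[of c'] that
          by (cases "j \<in> D"; elim disjE; simp add: flip_def D0_def)
      qed
      then show "D = D0" using D by (auto simp: D0_def)
    next
      assume "D = D0"
      then have "flip D \<sigma> j = \<sigma> c'" if "j \<in> e" for j
        using that pm[of j] pm[of c'] by (cases "j \<in> D0"; elim disjE; simp add: flip_def D0_def)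
      then show "const_on (flip D \<sigma>) e" by (auto simp: const_on_def)
    qed
    then have "(\<Sum>D\<in>?P. of_bool (const_on (flip D \<sigma>) e)) = (\<Sum>D\<in>?P. if D = D0 then 1 else (0::real))"
      by (intro sum.cong) auto
    also have "\<dots> = 1" using en by (subst sum.delta) (auto simp: D0_def)
    finally show ?thesis .
  qed
  have "2 ^ (d - 1) * (\<Sum>\<sigma>\<in>spins n. f \<sigma> * of_bool (const_on \<sigma> e))
     = (\<Sum>D\<in>?P. \<Sum>\<sigma>\<in>spins n. f \<sigma> * of_bool (const_on \<sigma> e))"
    using cardP by simp
  also have "\<dots> = (\<Sum>D\<in>?P. \<Sum>\<sigma>\<in>spins n. f \<sigma> * of_bool (const_on (flip D \<sigma>) e))"
  proof (rule sum.cong[OF refl])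
    fix D assume D: "D \<in> ?P"
    have "f (flip D \<sigma>) = f \<sigma>" for \<sigma>
      using D c' by (intro f) (auto simp: flip_def)
    moreover have "D \<subseteq> {..<n}" using D en by auto
    ultimately show "(\<Sum>\<sigma>\<in>spins n. f \<sigma> * of_bool (const_on \<sigma> e))
       = (\<Sum>\<sigma>\<in>spins n. f \<sigma> * of_bool (const_on (flip D \<sigma>) e))"
      using sum_flip[of D n "\<lambda>\<sigma>. f \<sigma> * of_bool (const_on \<sigma> e)"] by presburger
  qed
  also have "\<dots> = (\<Sum>\<sigma>\<in>spins n. f \<sigma> * (\<Sum>D\<in>?P. of_bool (const_on (flip D \<sigma>) e)))"
    by (subst sum.swap) (simp only: sum_distrib_left)
  also have "\<dots> = (\<Sum>\<sigma>\<in>spins n. f \<sigma>)" using one by (intro sum.cong) auto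
  finally show ?thesis by (simp add: field_simps)
qed

lemma eprob_const_on:
  "eprob n d a b \<sigma> e = pn n d b + (pn n d a - pn n d b) * of_bool (const_on \<sigma> e)"
  unfolding eprob_def const_on_def[symmetric] by simp

lemma sum_eprob:
  fixes f :: "(nat \<Rightarrow> int) \<Rightarrow> real"
  assumes "e \<in> dsets n d" "d \<ge> 1" "e \<inter> U \<subseteq> {c}"
    and "\<And>\<sigma> \<sigma>'. (\<And>i. i \<in> U \<Longrightarrow> \<sigma> i = \<sigma>' i) \<Longrightarrow> f \<sigma> = f \<sigma>'"
  shows "(\<Sum>\<sigma>\<in>spins n. f \<sigma> * eprob n d a b \<sigma> e) = pbar n d a b * (\<Sum>\<sigma>\<in>spins n. f \<sigma>)"
proof -
  have "(\<Sum>\<sigma>\<in>spins n. f \<sigma> * eprob n d a b \<sigma> e) = pn n d b * (\<Sum>\<sigma>\<in>spins n. f \<sigma>)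
     + (pn n d a - pn n d b) * (\<Sum>\<sigma>\<in>spins n. f \<sigma> * of_bool (const_on \<sigma> e))"
    unfolding eprob_const_on sum_distrib_left sum.distrib[symmetric]
    by (intro sum.cong refl) (simp add: algebra_simps)
  also have "(\<Sum>\<sigma>\<in>spins n. f \<sigma> * of_bool (const_on \<sigma> e)) = (\<Sum>\<sigma>\<in>spins n. f \<sigma>) / 2 ^ (d - 1)"
    by (rule sum_const_on) (use assms in blast)+
  also have "pn n d b * (\<Sum>\<sigma>\<in>spins n. f \<sigma>) + (pn n d a - pn n d b) * ((\<Sum>\<sigma>\<in>spins n. f \<sigma>) / 2 ^ (d - 1))
     = pbar n d a b * (\<Sum>\<sigma>\<in>spins n. f \<sigma>)"
    unfolding pbar_def by (simp add: algebra_simps)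
  finally show ?thesis .
qed

text \<open>The edge added last shares at most one vertex with the others, and fixing one spin
  leaves the chance of agreement at 1 / 2^(d-1). Its factor therefore averages to
  \<open>pbar\<close> whatever the remaining product is.\<close>

lemma sum_prod_eprob_hforest:
  assumes "hforest T" "T \<subseteq> dsets n d" "d \<ge> 1"
  shows "(\<Sum>\<sigma>\<in>spins n. \<Prod>e\<in>T. eprob n d a b \<sigma> e) = 2 ^ n * pbar n d a b ^ card T"
  using assms
proof (induction rule: hforest.induct)
  case empty
  show ?case by (simp add: card_spins)
next
  case (insert F e c)
  have dep: "(\<Prod>g\<in>F. eprob n d a b \<sigma> g) = (\<Prod>g\<in>F. eprob n d a b \<sigma>' g)"
    if "\<And>i. i \<in> \<Union>F \<Longrightarrow> \<sigma> i = \<sigma>' i" for \<sigma> \<sigma>'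
  proof (rule prod.cong[OF refl])
    fix g assume "g \<in> F"
    then have "\<sigma> i = \<sigma>' i" if "i \<in> g" for i using that \<open>\<And>i. i \<in> \<Union>F \<Longrightarrow> \<sigma> i = \<sigma>' i\<close> by blast
    then show "eprob n d a b \<sigma> g = eprob n d a b \<sigma>' g" by (simp add: eprob_def)
  qed
  have "(\<Sum>\<sigma>\<in>spins n. \<Prod>g\<in>insert e F. eprob n d a b \<sigma> g)
     = (\<Sum>\<sigma>\<in>spins n. (\<Prod>g\<in>F. eprob n d a b \<sigma> g) * eprob n d a b \<sigma> e)"
    using insert.hyps(2) hforest_finite[OF insert.hyps(1)] by (simp add: mult.commute)
  also have "\<dots> = pbar n d a b * (\<Sum>\<sigma>\<in>spins n. \<Prod>g\<in>F. eprob n d a b \<sigma> g)"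
  proof (rule sum_eprob[OF _ insert.prems(2) insert.hyps(3)])
    show "e \<in> dsets n d" using insert.prems(1) by simp
  qed (rule dep)
  also have "\<dots> = 2 ^ n * pbar n d a b ^ card (insert e F)"
    using insert.IH insert.prems insert.hyps(2) hforest_finite[OF insert.hyps(1)] by simp
  finally show ?case .
qed

section \<open>Averaging over hyperedges\<close>

fun tokw :: "(nat set \<Rightarrow> real) \<Rightarrow> nat set set \<Rightarrow> flag \<times> nat set \<Rightarrow> real" where
  "tokw p H (Cen, e) = of_bool (e \<in> H) - p e"
| "tokw p H (Mid, e) = p e"
| "tokw p H (Unc, e) = of_bool (e \<in> H)"

definition tw :: "(nat set \<Rightarrow> real) \<Rightarrow> nat set set \<Rightarrow> (flag \<times> nat set) list \<Rightarrow> real" where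
  "tw p H qs = prod_list (map (tokw p H) qs)"

text \<open>All factors of the token list that involve \<open>e\<close>, as a function of its
  indicator \<open>h\<close>; grouping by edges lets independence be applied.\<close>

definition edgew :: "(nat set \<Rightarrow> real) \<Rightarrow> (flag \<times> nat set) list \<Rightarrow> nat set \<Rightarrow> bool \<Rightarrow> real" where
  "edgew p qs e h = (of_bool h - p e) ^ count_list qs (Cen, e) * p e ^ count_list qs (Mid, e)
     * of_bool h ^ count_list qs (Unc, e)"

lemma tw_simps [simp]: "tw p H [] = 1" "tw p H (q # qs) = tokw p H q * tw p H qs"
  "tw p H (qs @ rs) = tw p H qs * tw p H rs"
  by (auto simp: tw_def)

lemma tw_edgew:
  assumes "finite D" "snd ` set qs \<subseteq> D"
  shows "tw p H qs = (\<Prod>e\<in>D. edgew p qs e (e \<in> H))"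
  using assms(2)
proof (induction qs)
  case Nil
  show ?case by (simp add: edgew_def)
next
  case (Cons q qs)
  obtain f e0 where q: "q = (f, e0)" by (cases q)
  have "edgew p (q # qs) e (e \<in> H) = (if e = e0 then tokw p H q else 1) * edgew p qs e (e \<in> H)" for e
    unfolding q by (cases f) (auto simp: edgew_def)
  then have "(\<Prod>e\<in>D. edgew p (q # qs) e (e \<in> H))
     = (\<Prod>e\<in>D. if e = e0 then tokw p H q else 1) * (\<Prod>e\<in>D. edgew p qs e (e \<in> H))"
    by (simp add: prod.distrib)
  also have "(\<Prod>e\<in>D. if e = e0 then tokw p H q else 1) = tokw p H q"
    using Cons.prems assms(1) q by (subst prod.delta) auto
  finally show ?case using Cons by simp
qed

text \<open>Independence of the hyperedges: multiplying out the two-term factors over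
  \<open>D\<close> yields one summand for each hypergraph \<open>H\<close>.\<close>

lemma sum_Pow_prod:
  fixes p :: "'e \<Rightarrow> real" and g :: "'e \<Rightarrow> bool \<Rightarrow> real"
  assumes "finite D"
  shows "(\<Sum>H\<in>Pow D. (\<Prod>e\<in>D. if e \<in> H then p e else 1 - p e) * (\<Prod>e\<in>D. g e (e \<in> H)))
    = (\<Prod>e\<in>D. p e * g e True + (1 - p e) * g e False)"
proof -
  have "(\<Prod>e\<in>D. p e * g e True + (1 - p e) * g e False)
    = (\<Sum>H\<in>Pow D. (\<Prod>e\<in>H. p e * g e True) * (\<Prod>e\<in>D - H. (1 - p e) * g e False))"
    by (rule prod_add[OF assms])
  also have "\<dots> = (\<Sum>H\<in>Pow D. (\<Prod>e\<in>D. if e \<in> H then p e else 1 - p e) * (\<Prod>e\<in>D. g e (e \<in> H)))"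
  proof (rule sum.cong[OF refl])
    fix H assume H: "H \<in> Pow D"
    have "(\<Prod>e\<in>D. if e \<in> H then p e else 1 - p e) * (\<Prod>e\<in>D. g e (e \<in> H))
      = (\<Prod>e\<in>D. if e \<in> H then p e * g e True else (1 - p e) * g e False)"
      unfolding prod.distrib[symmetric] by (intro prod.cong) auto
    also have "\<dots> = (\<Prod>e\<in>D \<inter> {e. e \<in> H}. p e * g e True) * (\<Prod>e\<in>D \<inter> - {e. e \<in> H}. (1 - p e) * g e False)"
      using assms by (rule prod.If_cases)
    also have "D \<inter> {e. e \<in> H} = H" using H by auto
    also have "D \<inter> - {e. e \<in> H} = D - H" by auto
    finally show "(\<Prod>e\<in>H. p e * g e True) * (\<Prod>e\<in>D - H. (1 - p e) * g e False)
      = (\<Prod>e\<in>D. if e \<in> H then p e else 1 - p e) * (\<Prod>e\<in>D. g e (e \<in> H))" by simp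
  qed
  finally show ?thesis by simp
qed

text \<open>The powers of \<open>1\<close> and \<open>0\<close> are those of the indicator of the edge; note \<open>0 ^ 0 = 1\<close>.\<close>

lemma edge_moment:
  fixes p :: real
  assumes p: "0 \<le> p" "p \<le> 1"
  shows "\<bar>p * ((1 - p) ^ c * p ^ m * 1 ^ u) + (1 - p) * ((0 - p) ^ c * p ^ m * 0 ^ u)\<bar>
     \<le> (if c = 1 \<and> u = 0 then 0 else p ^ m * (if c = 0 \<and> u = 0 then 1 else p))"
proof -
  have c1: "(1 - p) ^ c \<le> 1" using p by (simp add: power_le_one)
  have eq: "p * ((1 - p) ^ c * p ^ m * 1 ^ u) + (1 - p) * ((0 - p) ^ c * p ^ m * 0 ^ u)
    = p ^ m * (p * (1 - p) ^ c + (1 - p) * ((- p) ^ c * 0 ^ u))" by (simp add: algebra_simps)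
  have "\<bar>p * (1 - p) ^ c + (1 - p) * ((- p) ^ c * 0 ^ u)\<bar>
     \<le> (if c = 1 \<and> u = 0 then 0 else if c = 0 \<and> u = 0 then 1 else p)"
  proof (cases "u = 0")
    case False
    have "p * (1 - p) ^ c \<le> p * 1" using c1 p by (intro mult_left_mono) auto
    moreover have "p * (1 - p) ^ c + (1 - p) * ((- p) ^ c * 0 ^ u) = p * (1 - p) ^ c"
      using False by simp
    ultimately show ?thesis using False p by (simp only: if_False simp_thms) (simp add: abs_mult)
  next
    case True
    consider "c = 0" | "c = 1" | k where "c = Suc (Suc k)" by (metis One_nat_def not0_implies_Suc)
    then show ?thesis
    proof cases
      case 3
      have "\<bar>p * (1 - p) ^ c + (1 - p) * (- p) ^ c\<bar> \<le> \<bar>p * (1 - p) ^ c\<bar> + \<bar>(1 - p) * (- p) ^ c\<bar>"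
        by (rule abs_triangle_ineq)
      also have "\<dots> = p * (1 - p) ^ c + (1 - p) * p ^ c" using p by (simp add: abs_mult power_abs)
      also have "\<dots> \<le> p * (1 - p) + (1 - p) * (p * p)"
      proof (intro add_mono mult_left_mono)
        have "(1 - p) * (1 - p) ^ Suc k \<le> (1 - p) * 1"
          using p by (intro mult_left_mono power_le_one) auto
        then show "(1 - p) ^ c \<le> 1 - p" using 3 by simp
        have "p * p * p ^ k \<le> p * p * 1" using p by (intro mult_left_mono power_le_one) auto
        then show "p ^ c \<le> p * p" using 3 by (simp add: mult.assoc)
      qed (use p in auto)
      also have "\<dots> = p - p * (p * p)" by (simp add: algebra_simps)
      also have "\<dots> \<le> p" using p by simp
      finally show ?thesis using 3 True by simp
    qed (use True p in \<open>auto simp: algebra_simps\<close>)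
  qed
  then have "p ^ m * \<bar>p * (1 - p) ^ c + (1 - p) * ((- p) ^ c * 0 ^ u)\<bar>
     \<le> p ^ m * (if c = 1 \<and> u = 0 then 0 else if c = 0 \<and> u = 0 then 1 else p)"
    using p by (intro mult_left_mono) auto
  then show ?thesis unfolding eq using p by (simp add: abs_mult split: if_splits)
qed

lemma sum_count_list_flag:
  assumes "finite D" "snd ` set qs \<subseteq> D"
  shows "(\<Sum>e\<in>D. count_list qs (f, e)) = nflag f qs"
  using assms(2)
proof (induction qs)
  case (Cons q qs)
  have "(\<Sum>e\<in>D. count_list (q # qs) (f, e)) = (\<Sum>e\<in>D. (if e = snd q then (if fst q = f then 1 else 0) else 0) + count_list qs (f, e))"
    by (intro sum.cong) (auto simp: prod_eq_iff)
  also have "\<dots> = (if fst q = f then 1 else 0) + nflag f qs"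
    using Cons assms(1) by (simp add: sum.distrib sum.delta)
  finally show ?case by simp
qed simp

lemma unmid_mem: "e \<in> set (unmid qs) \<longleftrightarrow> count_list qs (Cen, e) \<noteq> 0 \<or> count_list qs (Unc, e) \<noteq> 0"
proof -
  have "f \<noteq> Mid \<longleftrightarrow> f = Cen \<or> f = Unc" for f by (cases f) auto
  then have "e \<in> set (unmid qs) \<longleftrightarrow> (Cen, e) \<in> set qs \<or> (Unc, e) \<in> set qs"
    by (auto simp: unmid_def image_iff)
  then show ?thesis by (simp add: count_list_0_iff)
qed

definition EH :: "nat set set \<Rightarrow> (nat set \<Rightarrow> real) \<Rightarrow> (nat set set \<Rightarrow> real) \<Rightarrow> real" where
  "EH D p f = (\<Sum>H\<in>Pow D. (\<Prod>e\<in>D. if e \<in> H then p e else 1 - p e) * f H)"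

text \<open>A nonzero mean requires every edge of \<open>unmid qs\<close> to occur uncentered or at
  least twice centered. Such an edge accounts for at least 2 in
  \<open>nflag Cen qs + 2 * nflag Unc qs\<close>, so a smaller total forces 0. Otherwise each
  distinct edge contributes at most \<open>p e\<close>, and every middle token at most
  \<open>P\<close>.\<close>

lemma EH_tw_bound:
  assumes D: "finite D" "snd ` set qs \<subseteq> D" and p: "\<And>e. 0 \<le> p e" "\<And>e. p e \<le> P" "P \<le> 1"
  shows "\<bar>EH D p (\<lambda>H. tw p H qs)\<bar>
    \<le> (if nflag Cen qs + 2 * nflag Unc qs < 2 * card (set (unmid qs)) then 0
       else P ^ nflag Mid qs * (\<Prod>e\<in>set (unmid qs). p e))"
proof -
  let ?S = "set (unmid qs)"
  let ?c = "\<lambda>e. count_list qs (Cen, e)" and ?m = "\<lambda>e. count_list qs (Mid, e)"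
    and ?u = "\<lambda>e. count_list qs (Unc, e)"
  have P1: "p e \<le> 1" for e using p(2)[of e] p(3) by linarith
  have SD: "?S \<subseteq> D" using D(2) by (auto simp: unmid_def)
  have eq: "EH D p (\<lambda>H. tw p H qs) = (\<Prod>e\<in>D. p e * edgew p qs e True + (1 - p e) * edgew p qs e False)"
    unfolding EH_def tw_edgew[OF D] by (rule sum_Pow_prod[OF D(1)])
  have le: "\<bar>p e * edgew p qs e True + (1 - p e) * edgew p qs e False\<bar>
      \<le> (if ?c e = 1 \<and> ?u e = 0 then 0 else p e ^ ?m e * (if e \<in> ?S then p e else 1))" for e
    using edge_moment[OF p(1) P1, of e "?c e" "?m e" "?u e"] unmid_mem[of e qs]
    by (auto simp: edgew_def split: if_splits)
  have abs: "\<bar>EH D p (\<lambda>H. tw p H qs)\<bar> \<le>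
     (\<Prod>e\<in>D. if ?c e = 1 \<and> ?u e = 0 then 0 else p e ^ ?m e * (if e \<in> ?S then p e else 1))"
    unfolding eq abs_prod by (intro prod_mono) (use le in auto)
  show ?thesis
  proof (cases "\<exists>e\<in>D. ?c e = 1 \<and> ?u e = 0")
    case True
    then have "(\<Prod>e\<in>D. if ?c e = 1 \<and> ?u e = 0 then 0 else p e ^ ?m e * (if e \<in> ?S then p e else 1)) = 0"
      using D(1) by (intro prod_zero) auto
    moreover have "0 \<le> P ^ nflag Mid qs * (\<Prod>e\<in>?S. p e)"
      using p(1) order.trans[OF p(1,2)] by (intro mult_nonneg_nonneg prod_nonneg zero_le_power) auto
    ultimately show ?thesis using abs by simp
  next
    case False
    have "2 * card ?S = (\<Sum>e\<in>?S. 2)" by simp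
    also have "\<dots> \<le> (\<Sum>e\<in>?S. ?c e + 2 * ?u e)"
    proof (rule sum_mono)
      fix e assume "e \<in> ?S"
      moreover from this have "\<not> (?c e = 1 \<and> ?u e = 0)" using False SD by auto
      ultimately show "2 \<le> ?c e + 2 * ?u e" using unmid_mem[of e qs] by linarith
    qed
    also have "\<dots> \<le> (\<Sum>e\<in>D. ?c e + 2 * ?u e)" using SD D(1) by (intro sum_mono2) auto
    also have "\<dots> = nflag Cen qs + 2 * nflag Unc qs"
      using sum_count_list_flag[OF D] by (simp add: sum.distrib flip: sum_distrib_left)
    finally have card: "2 * card ?S \<le> nflag Cen qs + 2 * nflag Unc qs" .
    have "(\<Prod>e\<in>D. if ?c e = 1 \<and> ?u e = 0 then 0 else p e ^ ?m e * (if e \<in> ?S then p e else 1))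
       = (\<Prod>e\<in>D. p e ^ ?m e) * (\<Prod>e\<in>D. if e \<in> ?S then p e else 1)"
      unfolding prod.distrib[symmetric] using False by (intro prod.cong) auto
    also have "(\<Prod>e\<in>D. if e \<in> ?S then p e else 1) = (\<Prod>e\<in>?S. p e)"
      using SD D(1) by (simp add: prod.If_cases Int_absorb1)
    also have "(\<Prod>e\<in>D. p e ^ ?m e) * (\<Prod>e\<in>?S. p e) \<le> P ^ nflag Mid qs * (\<Prod>e\<in>?S. p e)"
    proof (rule mult_right_mono)
      have "(\<Prod>e\<in>D. p e ^ ?m e) \<le> (\<Prod>e\<in>D. P ^ ?m e)"
        using p by (intro prod_mono) (auto intro: power_mono)
      also have "\<dots> = P ^ nflag Mid qs" using sum_count_list_flag[OF D, of Mid] by (simp flip: power_sum)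
      finally show "(\<Prod>e\<in>D. p e ^ ?m e) \<le> P ^ nflag Mid qs" .
    qed (use p in \<open>auto intro: prod_nonneg\<close>)
    finally show ?thesis using abs card by auto
  qed
qed

definition EE :: "nat \<Rightarrow> nat \<Rightarrow> real \<Rightarrow> real \<Rightarrow> ((nat \<Rightarrow> int) \<Rightarrow> nat set set \<Rightarrow> real) \<Rightarrow> real" where
  "EE n d a b f = (\<Sum>\<sigma>\<in>spins n. \<Sum>H\<in>Pow (dsets n d). hweight n d a b \<sigma> H * f \<sigma> H)"

lemma EE_EH: "EE n d a b f = (\<Sum>\<sigma>\<in>spins n. EH (dsets n d) (eprob n d a b \<sigma>) (f \<sigma>)) / 2 ^ n"
  unfolding EE_def EH_def hweight_def by (simp add: sum_divide_distrib mult.assoc)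

section \<open>The moment bound\<close>

text \<open>A chain has at most \<open>R\<close> uses of each edge, so the factor \<open>z ^ R\<close> in \<open>p_excess\<close> pays in advance for the
  factors \<open>z\<close> charged at the later uses of an excess edge.\<close>

locale moment = exploration +
  fixes a b \<alpha> :: real and R :: nat
  assumes ab: "b > 0" "a \<ge> b" and pa: "pn n d a \<le> 1" and \<alpha>: "\<alpha> \<ge> 1" and z01: "0 < z" "z \<le> 1"
    and pbar: "pbar n d a b \<le> \<alpha> * \<tau>" and p_excess: "pn n d a \<le> \<alpha> * (y * z ^ R)"
    and p_mid: "pn n d a \<le> \<mu>"
begin

lemma pn_mono: "0 \<le> pn n d b" "pn n d b \<le> pn n d a"
  using ab by (auto simp: pn_def divide_right_mono)

lemma eprob_bounds: "0 \<le> eprob n d a b \<sigma> e" "eprob n d a b \<sigma> e \<le> pn n d a"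
  using pn_mono by (auto simp: eprob_def)

lemma pbar_nonneg: "0 \<le> pbar n d a b"
  using pn_mono by (simp add: pbar_def)

text \<open>The weight is a monomial: \<open>nt\<close> tree edges and \<open>nx\<close> excess
  edges are discovered, and excess edges are used again \<open>no\<close> times, while repeated tree
  edges contribute 1. The bound on \<open>nx + no\<close> is what limits \<open>no\<close> by edge
  multiplicities.\<close>

lemma wt_expand:
  assumes "valid st" "snd ` set qs \<subseteq> dsets n d" "fold (\<lambda>q s. upd s q) qs st = (V', T', X')" "st = (V, T, X)"
  shows "\<exists>nt nx no. wt st qs = \<mu> ^ nflag Mid qs * \<tau> ^ nt * y ^ nx * z ^ no
    \<and> card T' = card T + nt \<and> card X' = card X + nx
    \<and> nx + no \<le> (\<Sum>e\<in>X'. count_list (unmid qs) e) \<and> T' \<union> X' = T \<union> X \<union> set (unmid qs) \<and> X \<subseteq> X'"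
  using assms
proof (induction qs arbitrary: st V T X)
  case Nil
  then show ?case by (intro exI[of _ 0]) auto
next
  case (Cons q qs)
  obtain f e where q: "q = (f, e)" by (cases q)
  obtain V1 T1 X1 where u: "upd st q = (V1, T1, X1)" by (cases "upd st q")
  have e: "e \<in> dsets n d" using Cons.prems q by auto
  have inv1: "valid (V1, T1, X1)" using valid_upd[OF Cons.prems(1), of q] u q e by simp
  have inv0: "finite X" "finite T" "\<And>g. g \<in> T \<union> X \<Longrightarrow> g \<subseteq> V"
    using Cons.prems hforest_finite by auto
  have fin': "finite X'" 
    using valid_fold[OF Cons.prems(1,2)] Cons.prems(3) by auto
  obtain nt nx no where IH: "wt (V1, T1, X1) qs = \<mu> ^ nflag Mid qs * \<tau> ^ nt * y ^ nx * z ^ no"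
    "card T' = card T1 + nt" "card X' = card X1 + nx"
    "nx + no \<le> (\<Sum>e\<in>X'. count_list (unmid qs) e)" "T' \<union> X' = T1 \<union> X1 \<union> set (unmid qs)" "X1 \<subseteq> X'"
    using Cons.IH[OF inv1 _ _ refl] Cons.prems u by auto
  have W: "wt st (q # qs) = stepw st q * wt (V1, T1, X1) qs" using u by simp
  have cnt: "(\<Sum>e'\<in>X'. count_list (e # unmid qs) e') = (\<Sum>e'\<in>X'. count_list (unmid qs) e') + (if e \<in> X' then 1 else 0)"
  proof -
    have "(\<Sum>e'\<in>X'. count_list (e # unmid qs) e')
       = (\<Sum>e'\<in>X'. count_list (unmid qs) e' + (if e' = e then 1 else 0))"
      by (intro sum.cong) auto
    also have "\<dots> = (\<Sum>e'\<in>X'. count_list (unmid qs) e') + (if e \<in> X' then 1 else 0)"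
      using fin' by (simp only: sum.distrib sum.delta)
    finally show ?thesis .
  qed
  consider (mid) "f = Mid" | (tree) "f \<noteq> Mid" "small V e" | (oldT) "f \<noteq> Mid" "\<not> small V e" "e \<in> T"
    | (oldX) "f \<noteq> Mid" "\<not> small V e" "e \<notin> T" "e \<in> X" | (new) "f \<noteq> Mid" "\<not> small V e" "e \<notin> T" "e \<notin> X"
    by blast
  then show ?case
  proof cases
    case mid
    then have TX: "T1 = T" "X1 = X" using u q Cons.prems(4) by auto
    have "stepw st q = \<mu>" "nflag Mid (q # qs) = Suc (nflag Mid qs)" "unmid (q # qs) = unmid qs"
      using q mid Cons.prems(4) by auto
    then show ?thesis using IH unfolding W TX
      by (intro exI[of _ nt] exI[of _ nx] exI[of _ no]) (simp add: mult.assoc)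
  next
    case tree
    then have TX: "T1 = insert e T" "X1 = X" using u q Cons.prems(4) by auto
    have "e \<notin> T" using not_small_subset[OF e, of V] tree inv0(3) by auto
    then have c: "card T1 = Suc (card T)" using TX inv0 by simp
    have *: "stepw st q = \<tau>" "nflag Mid (q # qs) = nflag Mid qs" "unmid (q # qs) = e # unmid qs"
      using q tree Cons.prems(4) by auto
    show ?thesis unfolding W * cnt
      by (rule exI[of _ "Suc nt"], rule exI[of _ nx], rule exI[of _ no], intro conjI)
        (use IH TX c in \<open>simp_all add: mult_ac\<close>)
  next
    case oldT
    then have TX: "T1 = T" "X1 = X" using u q Cons.prems(4) by auto
    have *: "stepw st q = 1" "nflag Mid (q # qs) = nflag Mid qs" "unmid (q # qs) = e # unmid qs"
      using q oldT Cons.prems(4) by auto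
    have "T' \<union> X' = T \<union> X \<union> set (e # unmid qs)" unfolding IH(5) TX using oldT by auto
    then show ?thesis unfolding W * cnt
      by (intro exI[of _ nt] exI[of _ nx] exI[of _ no] conjI)
        (use IH TX in \<open>simp_all add: mult_ac\<close>)
  next
    case oldX
    then have TX: "T1 = T" "X1 = X" using u q Cons.prems(4) by auto
    then have "e \<in> X'" using IH(6) oldX by auto
    have *: "stepw st q = z" "nflag Mid (q # qs) = nflag Mid qs" "unmid (q # qs) = e # unmid qs"
      using q oldX Cons.prems(4) by auto
    have "T' \<union> X' = T \<union> X \<union> set (e # unmid qs)" unfolding IH(5) TX using oldX by auto
    then show ?thesis unfolding W * cnt
      by (intro exI[of _ nt] exI[of _ nx] exI[of _ "Suc no"] conjI)
        (use IH TX \<open>e \<in> X'\<close> in \<open>simp_all add: mult_ac\<close>)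
  next
    case new
    then have TX: "T1 = T" "X1 = insert e X" using u q Cons.prems(4) by auto
    then have c: "e \<in> X'" "card X1 = Suc (card X)" "X \<subseteq> X'" using IH(6) new inv0(1) by auto
    have *: "stepw st q = y" "nflag Mid (q # qs) = nflag Mid qs" "unmid (q # qs) = e # unmid qs"
      using q new Cons.prems(4) by auto
    show ?thesis unfolding W * cnt
      by (intro exI[of _ nt] exI[of _ "Suc nx"] exI[of _ no] conjI)
        (use IH TX c in \<open>simp_all add: mult_ac\<close>)
  qed
qed

text \<open>This links the model to the exploration. The tree edges form a hyperforest and average
  to a power of \<open>pbar\<close>; every excess edge is bounded by \<open>pn n d a\<close>, and
  the factor z^R reserved for it covers its later uses. Each distinct edge yields one
  \<open>\<alpha>\<close>, and there are at most \<open>h\<close> of them unless the mean is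
  0.\<close>

lemma EE_tw_bound:
  assumes qs: "snd ` set qs \<subseteq> dsets n d" and v: "v < n"
    and h: "nflag Cen qs + 2 * nflag Unc qs \<le> 2 * h"
    and R: "\<And>e. count_list (unmid qs) e \<le> R"
  shows "\<bar>EE n d a b (\<lambda>\<sigma> H. tw (eprob n d a b \<sigma>) H qs)\<bar> \<le> \<alpha> ^ h * wt ({v}, {}, {}) qs"
proof (cases "2 * h < 2 * card (set (unmid qs))")
  case True
  have "EH (dsets n d) (eprob n d a b \<sigma>) (\<lambda>H. tw (eprob n d a b \<sigma>) H qs) = 0" for \<sigma>
    using EH_tw_bound[where p = "eprob n d a b \<sigma>", OF finite_dsets qs eprob_bounds pa] True h by simp
  then show ?thesis using \<alpha> by (simp add: EE_EH)
next
  case False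
  let ?st = "({v}, {}, {}) :: state"
  let ?P = "pn n d a"
  obtain V' T' X' where f: "fold (\<lambda>q s. upd s q) qs ?st = (V', T', X')" by (metis prod_cases3)
  have i0: "valid ?st" using v hforest.empty by simp
  obtain nt nx no where wt: "wt ?st qs = \<mu> ^ nflag Mid qs * \<tau> ^ nt * y ^ nx * z ^ no"
    "card T' = nt" "card X' = nx" "nx + no \<le> (\<Sum>e\<in>X'. count_list (unmid qs) e)"
    "T' \<union> X' = set (unmid qs)"
    using wt_expand[OF i0 qs f refl] by auto
  have i': "valid (V', T', X')" using valid_fold[OF i0 qs] f by simp
  then have TX: "finite X'" "finite T'" "T' \<inter> X' = {}" "hforest T'" "T' \<subseteq> dsets n d"
    using hforest_finite by auto
  have card: "card (set (unmid qs)) = nt + nx"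
    unfolding wt(5)[symmetric] card_Un_disjoint[OF TX(2,1,3)] wt(2,3) ..
  have no: "no \<le> R * nx"
  proof -
    have "(\<Sum>e\<in>X'. count_list (unmid qs) e) \<le> (\<Sum>e\<in>X'. R)" using R by (intro sum_mono) auto
    then show ?thesis using wt(3,4) by (simp add: mult.commute)
  qed
  have "\<bar>EH (dsets n d) (eprob n d a b \<sigma>) (\<lambda>H. tw (eprob n d a b \<sigma>) H qs)\<bar>
     \<le> ?P ^ nflag Mid qs * (?P ^ nx * (\<Prod>e\<in>T'. eprob n d a b \<sigma> e))" for \<sigma>
  proof -
    have P0: "0 \<le> ?P" using pn_mono by linarith
    have pr: "0 \<le> (\<Prod>e\<in>T'. eprob n d a b \<sigma> e)" using eprob_bounds by (intro prod_nonneg) auto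
    have "0 \<le> ?P ^ nflag Mid qs * (\<Prod>e\<in>set (unmid qs). eprob n d a b \<sigma> e)"
      using P0 eprob_bounds by (intro mult_nonneg_nonneg prod_nonneg) auto
    then have "\<bar>EH (dsets n d) (eprob n d a b \<sigma>) (\<lambda>H. tw (eprob n d a b \<sigma>) H qs)\<bar>
       \<le> ?P ^ nflag Mid qs * (\<Prod>e\<in>set (unmid qs). eprob n d a b \<sigma> e)"
      using EH_tw_bound[where p = "eprob n d a b \<sigma>", OF finite_dsets qs eprob_bounds pa]
      by (simp split: if_splits)
    also have "(\<Prod>e\<in>set (unmid qs). eprob n d a b \<sigma> e)
       = (\<Prod>e\<in>T'. eprob n d a b \<sigma> e) * (\<Prod>e\<in>X'. eprob n d a b \<sigma> e)"
      unfolding wt(5)[symmetric] using TX by (intro prod.union_disjoint) auto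
    also have "?P ^ nflag Mid qs * ((\<Prod>e\<in>T'. eprob n d a b \<sigma> e) * (\<Prod>e\<in>X'. eprob n d a b \<sigma> e))
       \<le> ?P ^ nflag Mid qs * ((\<Prod>e\<in>T'. eprob n d a b \<sigma> e) * (\<Prod>e\<in>X'. ?P))"
      using P0 pr eprob_bounds by (intro mult_left_mono prod_mono) auto
    finally show ?thesis using wt(3) by (simp add: mult.commute mult.left_commute)
  qed
  then have "\<bar>\<Sum>\<sigma>\<in>spins n. EH (dsets n d) (eprob n d a b \<sigma>) (\<lambda>H. tw (eprob n d a b \<sigma>) H qs)\<bar>
     \<le> (\<Sum>\<sigma>\<in>spins n. ?P ^ nflag Mid qs * (?P ^ nx * (\<Prod>e\<in>T'. eprob n d a b \<sigma> e)))"
    by (rule order.trans[OF sum_abs sum_mono])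
  then have "\<bar>EE n d a b (\<lambda>\<sigma> H. tw (eprob n d a b \<sigma>) H qs)\<bar>
     \<le> (\<Sum>\<sigma>\<in>spins n. ?P ^ nflag Mid qs * (?P ^ nx * (\<Prod>e\<in>T'. eprob n d a b \<sigma> e))) / 2 ^ n"
    unfolding EE_EH abs_divide by (simp add: divide_right_mono)
  also have "\<dots> = ?P ^ nflag Mid qs * (?P ^ nx * (2 ^ n * pbar n d a b ^ nt)) / 2 ^ n"
    using sum_prod_eprob_hforest[OF TX(4,5), of a b] d2 wt(2) by (simp flip: sum_distrib_left)
  also have "\<dots> = ?P ^ nflag Mid qs * ?P ^ nx * pbar n d a b ^ nt" by simp
  also have "\<dots> \<le> \<mu> ^ nflag Mid qs * (\<alpha> * (y * z ^ R)) ^ nx * (\<alpha> * \<tau>) ^ nt"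
    using pn_mono p_mid p_excess pbar pbar_nonneg nonneg \<alpha>
    by (intro mult_mono power_mono mult_nonneg_nonneg zero_le_power) auto
  also have "\<dots> = \<alpha> ^ (nt + nx) * (\<mu> ^ nflag Mid qs * \<tau> ^ nt * y ^ nx * z ^ (R * nx))"
    by (simp add: power_mult_distrib power_mult power_add mult_ac)
  also have "\<dots> \<le> \<alpha> ^ h * (\<mu> ^ nflag Mid qs * \<tau> ^ nt * y ^ nx * z ^ no)"
  proof (intro mult_mono)
    show "\<alpha> ^ (nt + nx) \<le> \<alpha> ^ h" using False card \<alpha> by (intro power_increasing) auto
    show "z ^ (R * nx) \<le> z ^ no" using no z01 by (intro power_decreasing) auto
  qed (use nonneg \<alpha> z01 in auto)
  finally show ?thesis using wt(1) by simp
qed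

end

section \<open>The matrices as sums over blocks\<close>

lemma endv_nth: "endv v s = (v # map snd s) ! length s"
  by (induction s arbitrary: v) auto

lemma cover_nth: "t < length s \<Longrightarrow> fst (s ! t) \<subseteq> cover s"
  unfolding cover_def using nth_mem by blast

text \<open>The edge conditions of \<open>SAW\<close> in terms of positions, a bridge to the
  recursive \<open>saw\<close>. Distinctness of vertices is supplied by
  \<open>saw_distinct_vertices\<close>.\<close>

definition saw_nth :: "nat \<Rightarrow> (nat set \<times> nat) list \<Rightarrow> bool" where
  "saw_nth v s \<longleftrightarrow> (let vs = v # map snd s; es = map fst s; l = length s in
     (\<forall>t<l. vs ! t \<noteq> vs ! (t + 1) \<and> {vs ! t, vs ! (t + 1)} \<subseteq> es ! t) \<and>
     (\<forall>t. 1 \<le> t \<and> t < l \<longrightarrow> es ! (t - 1) \<inter> es ! t = {vs ! t}) \<and>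
     (\<forall>s t. s < l \<and> t < l \<and> s + 2 \<le> t \<longrightarrow> es ! s \<inter> es ! t = {}))"

lemma saw_imp_saw_nth: "saw v s \<Longrightarrow> saw_nth v s"
proof (induction s arbitrary: v)
  case Nil
  then show ?case by (simp add: saw_nth_def)
next
  case (Cons p r)
  have IH: "saw_nth (snd p) r" using Cons by simp
  have one: "fst p \<inter> fst (r ! 0) = {snd p}" if "r \<noteq> []"
    using that Cons.prems by (cases r) auto
  have two: "fst p \<inter> fst (r ! k) = {}" if k: "1 \<le> k" "k < length r" for k
  proof -
    obtain q r' where r: "r = q # r'" using k by (cases r) auto
    have "snd p \<notin> cover r'" using Cons.prems r start_notin_cover_tl[of "snd p" q r'] by simp
    moreover have "fst (r ! k) \<subseteq> cover r'"
      using k r cover_nth[of "k - 1" r'] by (cases k) auto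
    moreover have "fst p \<inter> cover r' \<subseteq> {snd p}" using Cons.prems r by auto
    ultimately show ?thesis by blast
  qed
  show ?case unfolding saw_nth_def Let_def
  proof (intro conjI allI impI)
    fix t assume t: "t < length (p # r)"
    show "(v # map snd (p # r)) ! t \<noteq> (v # map snd (p # r)) ! (t + 1)"
      using IH Cons.prems t by (cases t) (auto simp: saw_nth_def Let_def)
    show "{(v # map snd (p # r)) ! t, (v # map snd (p # r)) ! (t + 1)} \<subseteq> map fst (p # r) ! t"
      using IH Cons.prems t by (cases t) (auto simp: saw_nth_def Let_def)
  next
    fix t assume t: "1 \<le> t \<and> t < length (p # r)"
    then obtain k where k: "t = Suc k" by (cases t) auto
    show "map fst (p # r) ! (t - 1) \<inter> map fst (p # r) ! t = {(v # map snd (p # r)) ! t}"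
    proof (cases k)
      case 0
      then show ?thesis using one t k by auto
    next
      case (Suc k')
      then show ?thesis
        using IH[unfolded saw_nth_def Let_def, THEN conjunct2, THEN conjunct1, rule_format, of "Suc k'"] t k
        by simp
    qed
  next
    fix i t assume it: "i < length (p # r) \<and> t < length (p # r) \<and> i + 2 \<le> t"
    then obtain k where k: "t = Suc k" by (cases t) auto
    show "map fst (p # r) ! i \<inter> map fst (p # r) ! t = {}"
    proof (cases i)
      case 0
      then show ?thesis using two[of k] it k by auto
    next
      case (Suc i')
      then show ?thesis
        using IH[unfolded saw_nth_def Let_def, THEN conjunct2, THEN conjunct2, rule_format, of i' k] it k
        by simp
    qed
  qed
qed

lemma saw_nth_imp_saw: "saw_nth v s \<Longrightarrow> saw v s"
proof (induction s arbitrary: v)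
  case (Cons p r)
  note h = Cons.prems[unfolded saw_nth_def Let_def]
  have a: "v \<in> fst p \<and> snd p \<in> fst p \<and> snd p \<noteq> v"
    using h[THEN conjunct1, rule_format, of 0] by auto
  have b: "fst p \<inter> cover r \<subseteq> {snd p}"
  proof
    fix x assume x: "x \<in> fst p \<inter> cover r"
    then obtain t where t: "t < length r" "x \<in> fst (r ! t)"
      by (auto simp: cover_def in_set_conv_nth)
    show "x \<in> {snd p}"
    proof (cases t)
      case 0
      then show ?thesis
        using h[THEN conjunct2, THEN conjunct1, rule_format, of 1] t x by auto
    next
      case (Suc t')
      then show ?thesis
        using h[THEN conjunct2, THEN conjunct2, rule_format, of 0 "Suc t"] t x by auto
    qed
  qed
  have "saw_nth (snd p) r" unfolding saw_nth_def Let_def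
  proof (intro conjI allI impI)
    fix t assume t: "t < length r"
    show "(snd p # map snd r) ! t \<noteq> (snd p # map snd r) ! (t + 1)"
      "{(snd p # map snd r) ! t, (snd p # map snd r) ! (t + 1)} \<subseteq> map fst r ! t"
      using h[THEN conjunct1, rule_format, of "Suc t"] t by auto
  next
    fix t assume t: "1 \<le> t \<and> t < length r"
    then obtain k where "t = Suc k" by (cases t) auto
    then show "map fst r ! (t - 1) \<inter> map fst r ! t = {(snd p # map snd r) ! t}"
      using h[THEN conjunct2, THEN conjunct1, rule_format, of "Suc t"] t by simp
  next
    fix i t assume it: "i < length r \<and> t < length r \<and> i + 2 \<le> t"
    then show "map fst r ! i \<inter> map fst r ! t = {}"
      using h[THEN conjunct2, THEN conjunct2, rule_format, of "Suc i" "Suc t"] by simp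
  qed
  then show ?case using Cons.IH[of "snd p"] a b by simp
qed simp

lemma saw_iff_saw_nth: "saw v s \<longleftrightarrow> saw_nth v s"
  using saw_imp_saw_nth saw_nth_imp_saw by blast

lemma saw_distinct_vertices: "saw v s \<Longrightarrow> distinct (v # map snd s)"
proof (induction s arbitrary: v)
  case (Cons p r)
  have sub: "saw w s \<Longrightarrow> snd ` set s \<subseteq> cover s" for w s
    by (induction s arbitrary: w) auto
  have "v \<notin> snd ` set r"
    using start_notin_cover_tl[OF Cons.prems] sub[of "snd p" r] Cons.prems by auto
  then show ?case using Cons by auto
qed simp

text \<open>Passes from vertex and edge lists to step lists: the head \<open>i\<close> of the vertex
  list becomes the separate start.\<close>

lemma sum_SAW:
  assumes "i < n"
  shows "(\<Sum>w\<in>SAW n d l i j. F (fst w) (snd w))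
    = (\<Sum>s\<in>{s \<in> saws n d l i. endv i s = j}. F (i # map snd s) (map fst s))"
proof (rule sum.reindex_bij_witness[of _ "\<lambda>s. (i # map snd s, map fst s)" "\<lambda>w. zip (snd w) (tl (fst w))"])
  fix w assume w: "w \<in> SAW n d l i j"
  obtain vs es where ve: "w = (vs, es)" by (cases w)
  note W = w[unfolded ve SAW_def Let_def, simplified]
  obtain us where us: "vs = i # us" using W by (cases vs) auto
  have len: "length us = l" "length es = l" using W us by auto
  let ?s = "zip es us"
  have m: "map snd ?s = us" "map fst ?s = es" using len by auto
  show eq: "(i # map snd (zip (snd w) (tl (fst w))), map fst (zip (snd w) (tl (fst w)))) = w"
    using ve us m by simp
  have "saw_nth i ?s" unfolding saw_nth_def Let_def m using W us len by auto
  moreover have "fst ` set ?s \<subseteq> dsets n d"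
    using W m by (metis set_map)
  moreover have "endv i ?s = j" unfolding endv_nth m using W us len by simp
  ultimately show "zip (snd w) (tl (fst w)) \<in> {s \<in> saws n d l i. endv i s = j}"
    using ve us len by (simp add: saws_def saw_iff_saw_nth)
  show "F (i # map snd (zip (snd w) (tl (fst w)))) (map fst (zip (snd w) (tl (fst w)))) = F (fst w) (snd w)"
    using eq by (metis fst_conv snd_conv)
next
  fix s assume s: "s \<in> {s \<in> saws n d l i. endv i s = j}"
  then have s': "length s = l" "saw i s" "fst ` set s \<subseteq> dsets n d" "endv i s = j"
    by (auto simp: saws_def)
  have sub: "snd ` set r \<subseteq> {..<n}" if "saw v r" "fst ` set r \<subseteq> dsets n d" for v r
    using that
  proof (induction r arbitrary: v)
    case (Cons p r)
    then show ?case using dsetsD(1)[of "fst p" n d] by auto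
  qed simp
  note nth = s'(2)[unfolded saw_iff_saw_nth saw_nth_def Let_def s'(1)]
  show "(i # map snd s, map fst s) \<in> SAW n d l i j"
    unfolding SAW_def Let_def mem_Collect_eq fst_conv snd_conv
  proof (intro conjI)
    show "(i # map snd s) ! l = j" using s' endv_nth[of i s] by simp
    show "set (i # map snd s) \<subseteq> {..<n}" using sub[OF s'(2,3)] assms by simp
    show "distinct (i # map snd s)" using saw_distinct_vertices[OF s'(2)] .
  qed (use s' nth in \<open>simp_all\<close>)
  show "zip (snd (i # map snd s, map fst s)) (tl (fst (i # map snd s, map fst s))) = s"
    by (simp add: zip_map_fst_snd)
qed

definition block_mat :: "(nat set \<Rightarrow> real) \<Rightarrow> nat set set \<Rightarrow> block \<Rightarrow> mat" where
  "block_mat p H B i j = (\<Sum>b\<in>B i. if endv i b = j then tw p H (map fst b) else 0)"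

lemma tag_inj: "inj (tag f)"
  unfolding tag_def by (rule inj_mapI) (auto simp: inj_def prod_eq_iff)

lemma block_mat_saw_block:
  "block_mat p H (saw_block n d f l) i j = (\<Sum>s\<in>saws n d l i. if endv i s = j then tw p H (lab f s) else 0)"
  unfolding block_mat_def saw_block_def
  by (subst sum.reindex) (auto intro: inj_on_subset[OF tag_inj] cong: if_cong)

lemma prod_nth_tw:
  assumes "length s = l" "\<And>t. t < l \<Longrightarrow> F t = tokw p H (f, fst (s ! t))"
  shows "(\<Prod>t<l. F t) = tw p H (lab f s)"
proof -
  have "tw p H (lab f s) = (\<Prod>t<length (lab f s). map (tokw p H) (lab f s) ! t)"
    unfolding tw_def prod.list_conv_set_nth by (simp add: atLeast0LessThan)
  also have "\<dots> = (\<Prod>t<l. F t)"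
    using assms by (intro prod.cong) (auto simp: lab_def)
  finally show ?thesis by simp
qed

lemma Bmat_eq:
  assumes "i < n"
  shows "Bmat n d l H i j = block_mat p H (saw_block n d Unc l) i j"
proof -
  have "Bmat n d l H i j = (\<Sum>s\<in>{s \<in> saws n d l i. endv i s = j}. tw p H (lab Unc s))"
    unfolding Bmat_def
    using sum_SAW[OF assms, where F = "\<lambda>vs es. \<Prod>t<l. Ae H (es ! t) (vs ! t) (vs ! (t + 1))"]
  proof (rule trans)
    show "(\<Sum>s\<in>{s \<in> saws n d l i. endv i s = j}. \<Prod>t<l. Ae H (map fst s ! t) ((i # map snd s) ! t) ((i # map snd s) ! (t + 1)))
      = (\<Sum>s\<in>{s \<in> saws n d l i. endv i s = j}. tw p H (lab Unc s))"
    proof (intro sum.cong refl prod_nth_tw)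
      fix s t assume s: "s \<in> {s \<in> saws n d l i. endv i s = j}" and t: "t < l"
      have "length s = l" "saw_nth i s" using s by (auto simp: saws_def saw_iff_saw_nth)
      then show "Ae H (map fst s ! t) ((i # map snd s) ! t) ((i # map snd s) ! (t + 1)) = tokw p H (Unc, fst (s ! t))"
        using t unfolding saw_nth_def Let_def Ae_def by auto
    qed (auto simp: saws_def)
  qed
  then show ?thesis unfolding block_mat_saw_block by (simp add: sum.inter_filter)
qed

lemma Delta_eq:
  assumes "i < n"
  shows "Delta n d a b l \<sigma> H i j = block_mat (eprob n d a b \<sigma>) H (saw_block n d Cen l) i j"
proof -
  let ?p = "eprob n d a b \<sigma>"
  have "Delta n d a b l \<sigma> H i j = (\<Sum>s\<in>{s \<in> saws n d l i. endv i s = j}. tw ?p H (lab Cen s))"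
    unfolding Delta_def
    using sum_SAW[OF assms, where F = "\<lambda>vs es. \<Prod>t<l. Ae H (es ! t) (vs ! t) (vs ! (t + 1))
      - Abare n d a b \<sigma> (es ! t) (vs ! t) (vs ! (t + 1))"]
  proof (rule trans)
    show "(\<Sum>s\<in>{s \<in> saws n d l i. endv i s = j}. \<Prod>t<l. Ae H (map fst s ! t) ((i # map snd s) ! t) ((i # map snd s) ! (t + 1))
        - Abare n d a b \<sigma> (map fst s ! t) ((i # map snd s) ! t) ((i # map snd s) ! (t + 1)))
      = (\<Sum>s\<in>{s \<in> saws n d l i. endv i s = j}. tw ?p H (lab Cen s))"
    proof (intro sum.cong refl prod_nth_tw)
      fix s t assume s: "s \<in> {s \<in> saws n d l i. endv i s = j}" and t: "t < l"
      have "length s = l" "saw_nth i s" using s by (auto simp: saws_def saw_iff_saw_nth)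
      then show "Ae H (map fst s ! t) ((i # map snd s) ! t) ((i # map snd s) ! (t + 1))
         - Abare n d a b \<sigma> (map fst s ! t) ((i # map snd s) ! t) ((i # map snd s) ! (t + 1)) = tokw ?p H (Cen, fst (s ! t))"
        using t unfolding saw_nth_def Let_def Ae_def Abare_def by auto
    qed (auto simp: saws_def)
  qed
  then show ?thesis unfolding block_mat_saw_block by (simp add: sum.inter_filter)
qed

lemma Abar_eq:
  assumes "i < n" "k < n"
  shows "Abar n d a b \<sigma> i k = (\<Sum>m\<in>pairs n d i. if snd m = k then eprob n d a b \<sigma> (fst m) else 0)"
proof -
  have "(\<Sum>m\<in>pairs n d i. if snd m = k then eprob n d a b \<sigma> (fst m) else 0)
    = (\<Sum>m\<in>{m \<in> pairs n d i. snd m = k}. eprob n d a b \<sigma> (fst m))"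
    by (simp add: sum.inter_filter)
  also have "\<dots> = (\<Sum>e\<in>{e \<in> dsets n d. i \<noteq> k \<and> {i, k} \<subseteq> e}. eprob n d a b \<sigma> e)"
    by (rule sum.reindex_bij_witness[of _ "\<lambda>e. (e, k)" fst]) (auto simp: pairs_def)
  also have "\<dots> = Abar n d a b \<sigma> i k"
    unfolding Abar_def Abare_def by (simp add: sum.inter_filter)
  finally show ?thesis by simp
qed

section \<open>Expanding the adjacency weights\<close>

text \<open>Uncentered factors are replaced by centered ones from left to right; changing position
  \<open>k\<close> costs \<open>p\<close>, with centered factors before and uncentered ones after.
  For the first position, with \<open>U\<close> and \<open>C\<close> the products over the tail, x U
  - (x - p) C = p U + (x - p) (U - C).\<close>

lemma tw_telescope:
  "tw p H (lab Unc s) - tw p H (lab Cen s)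
    = (\<Sum>k<length s. tw p H (lab Cen (take k s)) * p (fst (s ! k)) * tw p H (lab Unc (drop (Suc k) s)))"
proof (induction s)
  case (Cons q s)
  let ?x = "of_bool (fst q \<in> H) :: real"
  have "(\<Sum>k<length (q # s). tw p H (lab Cen (take k (q # s))) * p (fst ((q # s) ! k))
       * tw p H (lab Unc (drop (Suc k) (q # s))))
    = p (fst q) * tw p H (lab Unc s) + (?x - p (fst q)) * (tw p H (lab Unc s) - tw p H (lab Cen s))"
    unfolding Cons by (simp add: sum.lessThan_Suc_shift sum_distrib_left mult.assoc del: sum.lessThan_Suc)
  also have "\<dots> = tw p H (lab Unc (q # s)) - tw p H (lab Cen (q # s))"
    by (simp add: algebra_simps)
  finally show ?case by simp
qed simp

text \<open>The index set of the product Delta Abar B: \<open>s\<close> and \<open>t\<close> are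
  self-avoiding separately, with no condition between them.\<close>

definition joins :: "nat \<Rightarrow> nat \<Rightarrow> nat \<Rightarrow> nat \<Rightarrow> nat \<Rightarrow> ((nat set \<times> nat) list \<times> (nat set \<times> nat) \<times> (nat set \<times> nat) list) set" where
  "joins n d p q i = {(s, m, t). s \<in> saws n d p i \<and> m \<in> pairs n d (endv i s) \<and> t \<in> saws n d q (snd m)}"

lemma joins_Sigma: "joins n d p q i = Sigma (saws n d p i) (\<lambda>s. Sigma (pairs n d (endv i s)) (\<lambda>m. saws n d q (snd m)))"
  by (auto simp: joins_def)

lemma finite_joins [simp]: "finite (joins n d p q i)"
  unfolding joins_Sigma by auto

lemma sum_joins:
  "(\<Sum>r\<in>joins n d p q i. F r) = (\<Sum>s\<in>saws n d p i. \<Sum>m\<in>pairs n d (endv i s). \<Sum>t\<in>saws n d q (snd m). F (s, m, t))"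
  unfolding joins_Sigma by (simp add: sum.Sigma case_prod_unfold)

lemma sum_block_mat_mult:
  assumes "i < n" "wf_block n d len cC cU B"
  shows "(\<Sum>k<n. block_mat p H B i k * g k) = (\<Sum>b\<in>B i. tw p H (map fst b) * g (endv i b))"
proof -
  have "(\<Sum>k<n. block_mat p H B i k * g k)
     = (\<Sum>b\<in>B i. \<Sum>k<n. if k = endv i b then tw p H (map fst b) * g k else 0)"
    unfolding block_mat_def sum_distrib_right by (subst sum.swap) (intro sum.cong refl, auto)
  also have "\<dots> = (\<Sum>b\<in>B i. tw p H (map fst b) * g (endv i b))"
    using wf_blockD(7)[OF assms(2,1)] by (intro sum.cong refl) (simp add: sum.delta)
  finally show ?thesis .
qed

lemma mmul_joins:
  assumes "i < n" "j < n"
  shows "mmul n (mmul n (Delta n d a b p \<sigma> H) (Abar n d a b \<sigma>)) (Bmat n d q H) i j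
    = (\<Sum>(s, m, t)\<in>joins n d p q i. if endv (snd m) t = j then
        tw (eprob n d a b \<sigma>) H (lab Cen s) * eprob n d a b \<sigma> (fst m) * tw (eprob n d a b \<sigma>) H (lab Unc t) else 0)"
proof -
  let ?P = "eprob n d a b \<sigma>"
  let ?U = "\<lambda>k. block_mat ?P H (saw_block n d Unc q) k j"
  have en: "endv i s < n" if "s \<in> saws n d p i" for s
    using endv_less[of i s n d] that assms by (auto simp: saws_def)
  have "mmul n (mmul n (Delta n d a b p \<sigma> H) (Abar n d a b \<sigma>)) (Bmat n d q H) i j
    = (\<Sum>k<n. (\<Sum>k'<n. Delta n d a b p \<sigma> H i k' * Abar n d a b \<sigma> k' k) * ?U k)"
    unfolding mmul_def using Bmat_eq by (intro sum.cong) auto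
  also have "\<dots> = (\<Sum>k'<n. Delta n d a b p \<sigma> H i k' * (\<Sum>k<n. Abar n d a b \<sigma> k' k * ?U k))"
    unfolding sum_distrib_left sum_distrib_right by (subst sum.swap) (simp only: mult.assoc)
  also have "\<dots> = (\<Sum>k'<n. block_mat ?P H (saw_block n d Cen p) i k' * (\<Sum>k<n. Abar n d a b \<sigma> k' k * ?U k))"
    using Delta_eq[OF assms(1)] by simp
  also have "\<dots> = (\<Sum>c\<in>saw_block n d Cen p i. tw ?P H (map fst c) * (\<Sum>k<n. Abar n d a b \<sigma> (endv i c) k * ?U k))"
    by (rule sum_block_mat_mult[OF assms(1) wf_saw_block]) simp
  also have "\<dots> = (\<Sum>s\<in>saws n d p i. tw ?P H (lab Cen s) * (\<Sum>k<n. Abar n d a b \<sigma> (endv i s) k * ?U k))"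
    unfolding saw_block_def by (subst sum.reindex) (auto intro: inj_on_subset[OF tag_inj])
  also have "\<dots> = (\<Sum>s\<in>saws n d p i. tw ?P H (lab Cen s) * (\<Sum>m\<in>pairs n d (endv i s). ?P (fst m) * ?U (snd m)))"
  proof (rule sum.cong[OF refl])
    fix s assume s: "s \<in> saws n d p i"
    have "(\<Sum>k<n. Abar n d a b \<sigma> (endv i s) k * ?U k)
      = (\<Sum>k<n. (\<Sum>m\<in>pairs n d (endv i s). if snd m = k then ?P (fst m) else 0) * ?U k)"
      using Abar_eq[OF en[OF s]] by simp
    also have "\<dots> = (\<Sum>m\<in>pairs n d (endv i s). \<Sum>k<n. if k = snd m then ?P (fst m) * ?U k else 0)"
      unfolding sum_distrib_right by (subst sum.swap) (intro sum.cong refl, auto)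
    also have "\<dots> = (\<Sum>m\<in>pairs n d (endv i s). ?P (fst m) * ?U (snd m))"
    proof (rule sum.cong[OF refl])
      fix m assume "m \<in> pairs n d (endv i s)"
      then have "snd m < n" using dsetsD(1)[of "fst m" n d] by (auto simp: pairs_def)
      then show "(\<Sum>k<n. if k = snd m then ?P (fst m) * ?U k else 0) = ?P (fst m) * ?U (snd m)"
        by (simp add: sum.delta)
    qed
    finally show "tw ?P H (lab Cen s) * (\<Sum>k<n. Abar n d a b \<sigma> (endv i s) k * ?U k)
      = tw ?P H (lab Cen s) * (\<Sum>m\<in>pairs n d (endv i s). ?P (fst m) * ?U (snd m))" by simp
  qed
  also have "\<dots> = (\<Sum>s\<in>saws n d p i. \<Sum>m\<in>pairs n d (endv i s). \<Sum>t\<in>saws n d q (snd m).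
     if endv (snd m) t = j then tw ?P H (lab Cen s) * ?P (fst m) * tw ?P H (lab Unc t) else 0)"
    unfolding block_mat_saw_block sum_distrib_left by (intro sum.cong refl) auto
  finally show ?thesis unfolding sum_joins by simp
qed

lemma sum_joins_crossing:
  "(\<Sum>(s, m, t)\<in>{(s, m, t) \<in> joins n d p q i. \<not> saw i (s @ m # t)}. if endv (snd m) t = j then
        tw P H (lab Cen s) * P (fst m) * tw P H (lab Unc t) else 0)
    = block_mat P H (crossing_block n d Cen p Unc q) i j"
proof -
  let ?h = "\<lambda>(s, m, t). tag Cen s @ ((Mid, fst m), snd m) # tag Unc t"
  let ?J = "{(s, m, t) \<in> joins n d p q i. \<not> saw i (s @ m # t)}"
  have im: "crossing_block n d Cen p Unc q i = ?h ` ?J"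
    unfolding crossing_block_def joins_def by (auto simp: image_iff) (metis fst_conv snd_conv)+
  have inj: "inj_on ?h ?J"
  proof (rule inj_onI)
    fix x y assume x: "x \<in> ?J" and y: "y \<in> ?J" and eq: "?h x = ?h y"
    obtain s m t s' m' t' where xy: "x = (s, m, t)" "y = (s', m', t')" by (metis prod_cases3)
    \<comment> \<open>Both first pieces have length \<open>p\<close>, so the token list can be split
      in one way only.\<close>
    have "length (tag Cen s) = length (tag Cen s')"
      using x y xy by (auto simp: joins_def saws_def)
    then have "tag Cen s = tag Cen s'" "fst m = fst m'" "snd m = snd m'" "tag Unc t = tag Unc t'"
      using eq xy by auto
    then show "x = y" using xy tag_inj by (auto simp: inj_eq prod_eq_iff)
  qed
  show ?thesis unfolding block_mat_def im
    by (subst sum.reindex[OF inj]) (intro sum.cong refl, auto simp: mult.assoc)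
qed

lemma sum_joins_saw:
  "(\<Sum>(s, m, t)\<in>{(s, m, t) \<in> joins n d p q i. saw i (s @ m # t)}. if endv (snd m) t = j then
        tw P H (lab Cen s) * P (fst m) * tw P H (lab Unc t) else 0)
    = (\<Sum>w\<in>saws n d (p + Suc q) i. if endv i w = j then
        tw P H (lab Cen (take p w)) * P (fst (w ! p)) * tw P H (lab Unc (drop (Suc p) w)) else 0)"
proof (rule sum.reindex_bij_witness[of _ "\<lambda>w. (take p w, w ! p, drop (Suc p) w)" "\<lambda>(s, m, t). s @ m # t"])
  fix w assume w: "w \<in> saws n d (p + Suc q) i"
  then have w': "length w = p + Suc q" "saw i w" "fst ` set w \<subseteq> dsets n d" by (auto simp: saws_def)
  have eq: "w = take p w @ w ! p # drop (Suc p) w" using w'(1) by (simp add: id_take_nth_drop)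
  then show "(\<lambda>(s, m, t). s @ m # t) (take p w, w ! p, drop (Suc p) w) = w" by simp
  have sw: "saw i (take p w @ w ! p # drop (Suc p) w)" using w'(2) eq by simp
  have ds: "fst ` set (take p w @ w ! p # drop (Suc p) w) \<subseteq> dsets n d" using w'(3) eq by simp
  have "(take p w, w ! p, drop (Suc p) w) \<in> joins n d p q i"
    using sw ds w'(1) unfolding saw_append joins_def by (auto simp: saws_def pairs_def)
  then show "(take p w, w ! p, drop (Suc p) w) \<in> {(s, m, t) \<in> joins n d p q i. saw i (s @ m # t)}"
    using sw by simp
next
  fix r assume r: "r \<in> {(s, m, t) \<in> joins n d p q i. saw i (s @ m # t)}"
  obtain s m t where smt: "r = (s, m, t)" by (cases r)
  have r': "length s = p" "length t = q" "saw i (s @ m # t)" "fst ` set s \<subseteq> dsets n d"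
    "fst ` set t \<subseteq> dsets n d" "fst m \<in> dsets n d"
    using r smt by (auto simp: joins_def saws_def pairs_def)
  show "(\<lambda>w. (take p w, w ! p, drop (Suc p) w)) (case r of (s, m, t) \<Rightarrow> s @ m # t) = r"
    using smt r'(1) by (simp add: nth_append)
  show "(case r of (s, m, t) \<Rightarrow> s @ m # t) \<in> saws n d (p + Suc q) i"
    using r' smt by (simp add: saws_def image_Un)
  show "(if endv i (case r of (s, m, t) \<Rightarrow> s @ m # t) = j then
        tw P H (lab Cen (take p (case r of (s, m, t) \<Rightarrow> s @ m # t))) * P (fst ((case r of (s, m, t) \<Rightarrow> s @ m # t) ! p))
        * tw P H (lab Unc (drop (Suc p) (case r of (s, m, t) \<Rightarrow> s @ m # t))) else 0)
    = (case r of (s, m, t) \<Rightarrow> if endv (snd m) t = j then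
        tw P H (lab Cen s) * P (fst m) * tw P H (lab Unc t) else 0)"
    using smt r'(1) by (simp add: nth_append)
qed

text \<open>A concatenation is either self-avoiding, giving a term of \<open>tw_telescope\<close>,
  or crossing, giving an entry of Gamma.\<close>

lemma mmul_split:
  assumes "i < n" "j < n"
  shows "mmul n (mmul n (Delta n d a b p \<sigma> H) (Abar n d a b \<sigma>)) (Bmat n d q H) i j
    = block_mat (eprob n d a b \<sigma>) H (crossing_block n d Cen p Unc q) i j
      + (\<Sum>w\<in>saws n d (p + Suc q) i. if endv i w = j then
        tw (eprob n d a b \<sigma>) H (lab Cen (take p w)) * eprob n d a b \<sigma> (fst (w ! p))
        * tw (eprob n d a b \<sigma>) H (lab Unc (drop (Suc p) w)) else 0)"
proof -
  let ?J = "joins n d p q i"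
  let ?A = "{(s, m, t) \<in> ?J. \<not> saw i (s @ m # t)}" and ?B = "{(s, m, t) \<in> ?J. saw i (s @ m # t)}"
  have "?J = ?A \<union> ?B" "?A \<inter> ?B = {}" by auto
  moreover have "finite ?A" "finite ?B" by (rule finite_subset[OF _ finite_joins[of n d p q i]]; auto)+
  ultimately have split: "sum F ?J = sum F ?A + sum F ?B" for F :: "_ \<Rightarrow> real"
    using sum.union_disjoint[of ?A ?B F] by simp
  show ?thesis unfolding mmul_joins[OF assms] split sum_joins_crossing sum_joins_saw ..
qed

text \<open>The middle edge takes one step, so l - m centered and m - 1 uncentered steps make up
  total length l for 1 <= m <= l.\<close>

definition Gamma_mat :: "nat \<Rightarrow> nat \<Rightarrow> real \<Rightarrow> real \<Rightarrow> nat \<Rightarrow> nat \<Rightarrow> (nat \<Rightarrow> int) \<Rightarrow> nat set set \<Rightarrow> mat" where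
  "Gamma_mat n d a b l m \<sigma> H = block_mat (eprob n d a b \<sigma>) H (crossing_block n d Cen (l - m) Unc (m - 1))"

text \<open>After removal of Gamma, the m-th product keeps only self-avoiding walks of length l with
  the middle edge at index l - m; summed over m, these are the terms of
  \<open>tw_telescope\<close>.\<close>

lemma Bmat_expansion:
  assumes "i < n" "j < n"
  shows "Bmat n d l H i j = Delta n d a b l \<sigma> H i j
     + (\<Sum>m=1..l. mmul n (mmul n (Delta n d a b (l - m) \<sigma> H) (Abar n d a b \<sigma>)) (Bmat n d (m - 1) H) i j)
     - (\<Sum>m=1..l. Gamma_mat n d a b l m \<sigma> H i j)"
proof -
  let ?P = "eprob n d a b \<sigma>"
  let ?T = "\<lambda>w k. tw ?P H (lab Cen (take k w)) * ?P (fst (w ! k)) * tw ?P H (lab Unc (drop (Suc k) w))"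
  have "(\<Sum>m=1..l. mmul n (mmul n (Delta n d a b (l - m) \<sigma> H) (Abar n d a b \<sigma>)) (Bmat n d (m - 1) H) i j)
     - (\<Sum>m=1..l. Gamma_mat n d a b l m \<sigma> H i j)
    = (\<Sum>m=1..l. \<Sum>w\<in>saws n d l i. if endv i w = j then ?T w (l - m) else 0)"
    unfolding sum_subtractf[symmetric]
  proof (rule sum.cong[OF refl])
    fix m assume m: "m \<in> {1..l}"
    then have "l - m + Suc (m - 1) = l" by auto
    then show "mmul n (mmul n (Delta n d a b (l - m) \<sigma> H) (Abar n d a b \<sigma>)) (Bmat n d (m - 1) H) i j
       - Gamma_mat n d a b l m \<sigma> H i j = (\<Sum>w\<in>saws n d l i. if endv i w = j then ?T w (l - m) else 0)"
      unfolding mmul_split[OF assms] Gamma_mat_def by simp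
  qed
  also have "\<dots> = (\<Sum>k<l. \<Sum>w\<in>saws n d l i. if endv i w = j then ?T w k else 0)"
    by (rule sum.reindex_bij_witness[of _ "\<lambda>k. l - k" "\<lambda>m. l - m"]) auto
  also have "\<dots> = (\<Sum>w\<in>saws n d l i. if endv i w = j then (\<Sum>k<l. ?T w k) else 0)"
    by (subst sum.swap) (intro sum.cong refl, simp)
  also have "\<dots> = (\<Sum>w\<in>saws n d l i. (if endv i w = j then tw ?P H (lab Unc w) else 0)
      - (if endv i w = j then tw ?P H (lab Cen w) else 0))"
  proof (intro sum.cong refl)
    fix w assume "w \<in> saws n d l i"
    then have "length w = l" by (simp add: saws_def)
    then show "(if endv i w = j then (\<Sum>k<l. ?T w k) else 0) = (if endv i w = j then tw ?P H (lab Unc w) else 0)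
      - (if endv i w = j then tw ?P H (lab Cen w) else 0)"
      using tw_telescope[of ?P H w] by simp
  qed
  also have "\<dots> = Bmat n d l H i j - Delta n d a b l \<sigma> H i j"
    unfolding Bmat_eq[OF assms(1), where p = ?P] Delta_eq[OF assms(1)] block_mat_saw_block
    by (simp add: sum_subtractf)
  finally show ?thesis by simp
qed

section \<open>Reversal and products of block matrices\<close>

lemma tw_rev: "tw p H (rev qs) = tw p H qs"
  by (induction qs) auto

lemma saws_revw: "s \<in> saws n d l v \<Longrightarrow> revw v s \<in> saws n d l (endv v s)"
  by (simp add: saws_def saw_revw)

text \<open>Reversing walks transposes the matrix, since \<open>tw\<close> ignores the order of
  tokens. For Gamma the two pieces change places, so the transpose belongs to a different block;
  therefore \<open>gram_blocks\<close> alternates between two blocks.\<close>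

lemma block_mat_transpose:
  assumes "\<And>v c. c \<in> B v \<Longrightarrow> revw v c \<in> B' (endv v c)" "\<And>v c. c \<in> B' v \<Longrightarrow> revw v c \<in> B (endv v c)"
    and fin: "finite (B i)" "finite (B' j)"
  shows "block_mat p H B' j i = block_mat p H B i j"
proof -
  have "(\<Sum>c\<in>{c \<in> B i. endv i c = j}. tw p H (map fst c)) = (\<Sum>c\<in>{c \<in> B' j. endv j c = i}. tw p H (map fst c))"
    by (rule sum.reindex_bij_witness[of _ "revw j" "revw i"]) (use assms in \<open>auto simp: tw_rev\<close>)
  then show ?thesis unfolding block_mat_def using fin by (simp add: sum.inter_filter)
qed

lemma saw_block_revw: "c \<in> saw_block n d f l v \<Longrightarrow> revw v c \<in> saw_block n d f l (endv v c)"
  by (auto simp: saw_block_def saws_revw)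

lemma crossing_block_revw:
  assumes "c \<in> crossing_block n d f p g q v"
  shows "revw v c \<in> crossing_block n d g q f p (endv v c)"
proof -
  obtain s m t where s: "s \<in> saws n d p v" and m: "m \<in> pairs n d (endv v s)"
    and t: "t \<in> saws n d q (snd m)" and c: "c = tag f s @ ((Mid, fst m), snd m) # tag g t"
    and ns: "\<not> saw v (s @ m # t)"
    using assms by (auto simp: crossing_block_def)
  let ?w = "endv v s"
  let ?s = "revw (snd m) t" and ?m = "(fst m, ?w)" and ?t = "revw v s"
  have rv: "revw v (s @ m # t) = ?s @ ?m # ?t" by (simp add: revw_append)
  have "\<not> saw (endv (snd m) t) (?s @ ?m # ?t)"
  proof
    assume "saw (endv (snd m) t) (?s @ ?m # ?t)"
    then have "saw (endv v (s @ m # t)) (revw v (s @ m # t))" unfolding rv by simp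
    then have "saw (endv (endv v (s @ m # t)) (revw v (s @ m # t)))
       (revw (endv v (s @ m # t)) (revw v (s @ m # t)))" by (rule saw_revw)
    then show False using ns by (simp only: endv_revw revw_revw)
  qed
  moreover have "?m \<in> pairs n d (endv (endv (snd m) t) ?s)" using m by (auto simp: pairs_def)
  moreover have "?s \<in> saws n d q (endv (snd m) t)" "?t \<in> saws n d p (snd ?m)"
    using saws_revw[OF t] saws_revw[OF s] by auto
  moreover have "revw v c = tag g ?s @ ((Mid, fst ?m), snd ?m) # tag f ?t"
    unfolding c by (simp add: revw_append)
  ultimately have "revw v c \<in> crossing_block n d g q f p (endv (snd m) t)"
    unfolding crossing_block_def by blast
  moreover have "endv v c = endv (snd m) t" unfolding c by simp
  ultimately show ?thesis by simp
qed

text \<open>The product of the block matrices in \<open>L\<close>, by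
  \<open>chain_mat_single\<close> and \<open>chain_mat_append\<close>, kept as one sum over chains
  so that expectations can be taken term by term.\<close>

definition chain_mat :: "(nat set \<Rightarrow> real) \<Rightarrow> nat set set \<Rightarrow> block list \<Rightarrow> mat" where
  "chain_mat p H L i j = chain_sum L i (\<lambda>c. if endv i c = j then tw p H (map fst c) else 0)"

lemma chain_mat_Nil: "chain_mat p H [] i j = (if i = j then 1 else 0)"
  by (simp add: chain_mat_def)

lemma chain_mat_Cons: "chain_mat p H (B # L) i j = (\<Sum>c\<in>B i. tw p H (map fst c) * chain_mat p H L (endv i c) j)"
  unfolding chain_mat_def chain_sum.simps chain_sum_mult[symmetric]
  by (intro sum.cong refl arg_cong[where f = "chain_sum L _"] ext) simp

lemma chain_mat_single: "chain_mat p H [B] i j = block_mat p H B i j"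
  unfolding chain_mat_Cons chain_mat_Nil block_mat_def by (intro sum.cong) auto

lemma chain_mat_append:
  assumes "\<forall>B\<in>set L. wf_block n d len cC cU B" "i < n"
  shows "chain_mat p H (L @ L') i j = (\<Sum>k<n. chain_mat p H L i k * chain_mat p H L' k j)"
  using assms
proof (induction L arbitrary: i)
  case Nil
  have "(\<Sum>k<n. chain_mat p H [] i k * chain_mat p H L' k j) = (\<Sum>k<n. if k = i then chain_mat p H L' k j else 0)"
    unfolding chain_mat_Nil by (intro sum.cong) auto
  then show ?case using Nil by (simp add: sum.delta)
next
  case (Cons B L)
  have B: "wf_block n d len cC cU B" using Cons.prems by simp
  have "chain_mat p H ((B # L) @ L') i j = (\<Sum>c\<in>B i. tw p H (map fst c) * (\<Sum>k<n. chain_mat p H L (endv i c) k * chain_mat p H L' k j))"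
    unfolding append_Cons chain_mat_Cons using Cons wf_blockD(7)[OF B Cons.prems(2)] by (intro sum.cong) auto
  also have "\<dots> = (\<Sum>k<n. chain_mat p H (B # L) i k * chain_mat p H L' k j)"
    unfolding chain_mat_Cons sum_distrib_left sum_distrib_right by (subst sum.swap) (simp only: mult.assoc)
  finally show ?case .
qed

section \<open>The spectral norm and the trace\<close>

lemma sum_swap3:
  "(\<Sum>i\<in>A. \<Sum>j\<in>B. \<Sum>k\<in>C. f i j k) = (\<Sum>k\<in>C. \<Sum>i\<in>A. \<Sum>j\<in>B. f i j k)"
proof -
  have "(\<Sum>j\<in>B. \<Sum>k\<in>C. f i j k) = (\<Sum>k\<in>C. \<Sum>j\<in>B. f i j k)" for i
    by (rule sum.swap)
  then show ?thesis by (simp only: sum.swap[of _ C A])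
qed

text \<open>This is (M^T M)^(2^r). The order of the moment is free, so powers of two are enough, and
  repeated squaring suits Cauchy-Schwarz.\<close>

fun gram :: "nat \<Rightarrow> mat \<Rightarrow> nat \<Rightarrow> mat" where
  "gram n M 0 = (\<lambda>i j. \<Sum>w<n. M w i * M w j)"
| "gram n M (Suc r) = mmul n (gram n M r) (gram n M r)"

lemma gram_sym: "gram n M r i j = gram n M r j i"
proof (induction r arbitrary: i j)
  case 0
  show ?case by (simp add: mult.commute)
next
  case (Suc r)
  have "gram n M r i k * gram n M r k j = gram n M r j k * gram n M r k i" for k
    using Suc[of i k] Suc[of k j] by simp
  then show ?case by (simp add: mmul_def)
qed

lemma gram_Suc: "gram n M (Suc r) i j = (\<Sum>k<n. gram n M r k i * gram n M r k j)"
  unfolding gram.simps mmul_def by (intro sum.cong refl) (metis gram_sym)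

text \<open>For a unit vector \<open>x\<close> and symmetric \<open>Q\<close>, Cauchy-Schwarz bounds
  the square of the form x.Qx by the squared norm of Qx, which is x.QQx. Iterating this from the
  squared norm of Mx replaces a diagonalisation.\<close>

lemma gram_quadratic:
  assumes x: "(\<Sum>j<n. (x j)\<^sup>2) = (1::real)"
  shows "(\<Sum>i<n. (\<Sum>j<n. M i j * x j)\<^sup>2) ^ (2 ^ r) \<le> (\<Sum>i<n. x i * (\<Sum>j<n. gram n M r i j * x j))
     \<and> 0 \<le> (\<Sum>i<n. x i * (\<Sum>j<n. gram n M r i j * x j))"
proof (induction r)
  case 0
  have "(\<Sum>i<n. x i * (\<Sum>j<n. gram n M 0 i j * x j)) = (\<Sum>i<n. \<Sum>j<n. \<Sum>w<n. M w i * x i * (M w j * x j))"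
    by (simp add: sum_distrib_left sum_distrib_right mult_ac)
  also have "\<dots> = (\<Sum>w<n. \<Sum>i<n. \<Sum>j<n. M w i * x i * (M w j * x j))"
    by (rule sum_swap3)
  also have "\<dots> = (\<Sum>w<n. (\<Sum>j<n. M w j * x j)\<^sup>2)"
    by (simp add: power2_eq_square sum_product)
  finally have eq: "(\<Sum>i<n. x i * (\<Sum>j<n. gram n M 0 i j * x j)) = (\<Sum>w<n. (\<Sum>j<n. M w j * x j)\<^sup>2)" .
  show ?case unfolding eq by (simp add: sum_nonneg)
next
  case (Suc r)
  let ?Q = "gram n M r"
  let ?q = "\<Sum>i<n. x i * (\<Sum>j<n. ?Q i j * x j)"
  have eq: "(\<Sum>i<n. x i * (\<Sum>j<n. gram n M (Suc r) i j * x j)) = (\<Sum>k<n. (\<Sum>j<n. ?Q k j * x j)\<^sup>2)"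
  proof -
    have "(\<Sum>i<n. x i * (\<Sum>j<n. gram n M (Suc r) i j * x j))
      = (\<Sum>i<n. \<Sum>j<n. \<Sum>k<n. (?Q k i * x i) * (?Q k j * x j))"
      unfolding gram_Suc sum_distrib_left sum_distrib_right
      by (intro sum.cong refl) (simp only: mult_ac)
    also have "\<dots> = (\<Sum>k<n. \<Sum>i<n. \<Sum>j<n. (?Q k i * x i) * (?Q k j * x j))"
      by (rule sum_swap3)
    also have "\<dots> = (\<Sum>k<n. (\<Sum>j<n. ?Q k j * x j)\<^sup>2)"
      by (simp add: power2_eq_square sum_product)
    finally show ?thesis .
  qed
  have "?q\<^sup>2 \<le> (\<Sum>i<n. (x i)\<^sup>2) * (\<Sum>i<n. (\<Sum>j<n. ?Q i j * x j)\<^sup>2)"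
    by (rule Cauchy_Schwarz_ineq_sum)
  then have "?q\<^sup>2 \<le> (\<Sum>i<n. x i * (\<Sum>j<n. gram n M (Suc r) i j * x j))" unfolding eq x by simp
  moreover have "((\<Sum>i<n. (\<Sum>j<n. M i j * x j)\<^sup>2) ^ (2 ^ r))\<^sup>2 \<le> ?q\<^sup>2"
    by (rule power_mono[OF conjunct1[OF Suc]]) (intro zero_le_power sum_nonneg zero_le_power2)
  ultimately show ?case unfolding eq by (simp add: power_mult[symmetric] mult.commute sum_nonneg)
qed

text \<open>As \<open>t\<close> is below the supremum, some unit vector is stretched by more than
  \<open>t\<close>. After \<open>gram_quadratic\<close>, Cauchy-Schwarz row by row leads to the sum
  of the squared entries of \<open>gram n M r\<close>, which is the trace of its square.\<close>

lemma specnorm_power_le_trace: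
  assumes "0 < n" "0 < t" "\<not> specnorm n M \<le> t"
  shows "t ^ (2 * 2 ^ Suc r) \<le> (\<Sum>i<n. gram n M (Suc r) i i)"
proof -
  let ?f = "\<lambda>x. \<Sum>i<n. (\<Sum>j<n. M i j * x j)\<^sup>2"
  let ?S = "{sqrt (?f x) | x. (\<Sum>j<n. (x j)\<^sup>2) = 1}"
  \<comment> \<open>The first coordinate vector makes the set under the supremum nonempty, as
    \<open>cSup_least\<close> requires.\<close>
  have "(\<Sum>j<n. (if j = 0 then 1 else 0 :: real)\<^sup>2) = (\<Sum>j<n. if j = 0 then 1 else 0)"
    by (intro sum.cong) auto
  also have "\<dots> = 1" using assms(1) by (simp add: sum.delta)
  finally have "sqrt (?f (\<lambda>j. if j = 0 then 1 else 0)) \<in> ?S"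
    by (intro CollectI exI[of _ "\<lambda>j. if j = 0 then 1 else 0"] conjI refl)
  then have "?S \<noteq> {}" by (metis empty_iff)
  have "\<exists>x. (\<Sum>j<n. (x j)\<^sup>2) = 1 \<and> t < sqrt (?f x)"
  proof (rule ccontr)
    assume "\<not> ?thesis"
    then have "Sup ?S \<le> t" using \<open>?S \<noteq> {}\<close> by (intro cSup_least) (auto simp: not_less)
    then show False using assms(3) by (simp add: specnorm_def)
  qed
  then obtain x where x: "(\<Sum>j<n. (x j)\<^sup>2) = 1" "t < sqrt (?f x)" by blast
  let ?Q = "gram n M r"
  have "t\<^sup>2 \<le> (sqrt (?f x))\<^sup>2" using x(2) assms(2) by (intro power_mono) auto
  then have "t\<^sup>2 \<le> ?f x" by (simp add: sum_nonneg)
  then have "(t\<^sup>2) ^ (2 ^ r) \<le> ?f x ^ (2 ^ r)" by (intro power_mono) auto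
  also have "\<dots> \<le> (\<Sum>i<n. x i * (\<Sum>j<n. ?Q i j * x j))" using gram_quadratic[OF x(1)] by blast
  finally have "((t\<^sup>2) ^ (2 ^ r))\<^sup>2 \<le> (\<Sum>i<n. x i * (\<Sum>j<n. ?Q i j * x j))\<^sup>2"
    by (intro power_mono) auto
  also have "\<dots> \<le> (\<Sum>i<n. (x i)\<^sup>2) * (\<Sum>i<n. (\<Sum>j<n. ?Q i j * x j)\<^sup>2)"
    by (rule Cauchy_Schwarz_ineq_sum)
  also have "\<dots> \<le> (\<Sum>i<n. (\<Sum>j<n. (?Q i j)\<^sup>2))"
    unfolding x(1) mult_1
  proof (rule sum_mono)
    fix i
    have "(\<Sum>j<n. ?Q i j * x j)\<^sup>2 \<le> (\<Sum>j<n. (?Q i j)\<^sup>2) * (\<Sum>j<n. (x j)\<^sup>2)"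
      by (rule Cauchy_Schwarz_ineq_sum)
    then show "(\<Sum>j<n. ?Q i j * x j)\<^sup>2 \<le> (\<Sum>j<n. (?Q i j)\<^sup>2)" using x(1) by simp
  qed
  also have "\<dots> = (\<Sum>i<n. gram n M (Suc r) i i)"
    unfolding gram_Suc power2_eq_square by (rule sum.swap)
  finally show ?thesis by (simp add: power_mult[symmetric] mult_ac)
qed

fun gram_blocks :: "block \<Rightarrow> block \<Rightarrow> nat \<Rightarrow> block list" where
  "gram_blocks B' B 0 = [B', B]"
| "gram_blocks B' B (Suc r) = gram_blocks B' B r @ gram_blocks B' B r"

lemma length_gram_blocks: "length (gram_blocks B' B r) = 2 * 2 ^ r"
  by (induction r) auto

lemma set_gram_blocks: "set (gram_blocks B' B r) = {B', B}"
  by (induction r) auto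

lemma gram_chain_mat:
  assumes "wf_block n d len cC cU B" "wf_block n d len cC cU B'"
    and "\<And>i j. i < n \<Longrightarrow> j < n \<Longrightarrow> block_mat p H B' j i = block_mat p H B i j" and "i < n" "j < n"
  shows "gram n (block_mat p H B) r i j = chain_mat p H (gram_blocks B' B r) i j"
  using assms(4,5)
proof (induction r arbitrary: i j)
  case 0
  have "chain_mat p H ([B'] @ [B]) i j = (\<Sum>k<n. chain_mat p H [B'] i k * chain_mat p H [B] k j)"
    by (rule chain_mat_append) (use assms 0 in auto)
  then show ?case using 0 assms(3) by (simp add: chain_mat_single)
next
  case (Suc r)
  have "chain_mat p H (gram_blocks B' B r @ gram_blocks B' B r) i j
     = (\<Sum>k<n. chain_mat p H (gram_blocks B' B r) i k * chain_mat p H (gram_blocks B' B r) k j)"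
    by (rule chain_mat_append) (use assms Suc in \<open>auto simp: set_gram_blocks\<close>)
  then show ?case using Suc by (simp add: mmul_def)
qed

section \<open>Probabilities\<close>

lemma EE_sum: "EE n d a b (\<lambda>\<sigma> H. \<Sum>x\<in>A. f x \<sigma> H) = (\<Sum>x\<in>A. EE n d a b (f x))"
  unfolding EE_def sum_distrib_left by (rule sum_swap3)

lemma EE_chain_sum: "EE n d a b (\<lambda>\<sigma> H. chain_sum L i (f \<sigma> H)) = chain_sum L i (\<lambda>c. EE n d a b (\<lambda>\<sigma> H. f \<sigma> H c))"
  unfolding EE_def by (simp only: chain_sum_sum[symmetric] chain_sum_mult)

lemma hprob_EE: "hprob n d a b E = EE n d a b (\<lambda>\<sigma> H. of_bool (E \<sigma> H))"
  unfolding hprob_def EE_def by (intro sum.cong refl) auto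

lemma EE_one: "EE n d a b (\<lambda>\<sigma> H. 1) = 1"
proof -
  have "EH (dsets n d) p (\<lambda>H. 1) = 1" for p
    using sum_Pow_prod[OF finite_dsets[of n d], of p "\<lambda>_ _. 1"]
    by (simp add: EH_def)
  then show ?thesis by (simp add: EE_EH card_spins)
qed

section \<open>From expected traces to probabilities\<close>

context moment
begin

lemma hweight_nonneg: "0 \<le> hweight n d a b \<sigma> H"
proof -
  have "0 \<le> eprob n d a b \<sigma> e \<and> eprob n d a b \<sigma> e \<le> 1" for e
    using eprob_bounds[of \<sigma> e] pa by linarith
  then show ?thesis unfolding hweight_def by (intro mult_nonneg_nonneg prod_nonneg) auto
qed

lemma EE_mono: "(\<And>\<sigma> H. f \<sigma> H \<le> g \<sigma> H) \<Longrightarrow> EE n d a b f \<le> EE n d a b g"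
  unfolding EE_def by (intro sum_mono mult_left_mono hweight_nonneg)

lemma hprob_le_one: "hprob n d a b E \<le> 1"
  unfolding hprob_EE using EE_mono[of "\<lambda>\<sigma> H. of_bool (E \<sigma> H)" "\<lambda>_ _. 1"] EE_one[of n d a b] by simp

lemma hprob_compl: "hprob n d a b E = 1 - hprob n d a b (\<lambda>\<sigma> H. \<not> E \<sigma> H)"
proof -
  have "EE n d a b (\<lambda>\<sigma> H. of_bool (E \<sigma> H)) + EE n d a b (\<lambda>\<sigma> H. of_bool (\<not> E \<sigma> H)) = EE n d a b (\<lambda>_ _. 1)"
    unfolding EE_def sum.distrib[symmetric] by (intro sum.cong refl) auto
  then show ?thesis by (simp add: hprob_EE EE_one)
qed

lemma hprob_Ex_le:
  assumes "finite A"
  shows "hprob n d a b (\<lambda>\<sigma> H. \<exists>m\<in>A. E m \<sigma> H) \<le> (\<Sum>m\<in>A. hprob n d a b (E m))"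
  unfolding hprob_EE EE_sum[symmetric]
proof (rule EE_mono)
  fix \<sigma> H
  show "of_bool (\<exists>m\<in>A. E m \<sigma> H) \<le> (\<Sum>m\<in>A. of_bool (E m \<sigma> H) :: real)"
  proof (cases "\<exists>m\<in>A. E m \<sigma> H")
    case True
    then obtain m where m: "m \<in> A" "E m \<sigma> H" by blast
    then have "of_bool (E m \<sigma> H) \<le> (\<Sum>m\<in>A. of_bool (E m \<sigma> H) :: real)"
      using assms by (intro member_le_sum) auto
    then show ?thesis using True m by simp
  qed (simp add: sum_nonneg)
qed

lemma hprob_markov:
  assumes "0 < t" "\<And>\<sigma> H. E \<sigma> H \<Longrightarrow> t \<le> F \<sigma> H" "\<And>\<sigma> H. 0 \<le> F \<sigma> H"
  shows "hprob n d a b E \<le> EE n d a b F / t"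
proof -
  have "t * hprob n d a b E = EE n d a b (\<lambda>\<sigma> H. t * of_bool (E \<sigma> H))"
    unfolding hprob_EE EE_def sum_distrib_left by (simp add: mult_ac)
  also have "\<dots> \<le> EE n d a b F"
    by (rule EE_mono) (use assms in \<open>auto simp: of_bool_def\<close>)
  finally show ?thesis using assms(1) by (simp add: field_simps)
qed

text \<open>Expectation comes before counting: \<open>EE_tw_bound\<close> replaces every chain by
  the common factor \<open>\<alpha> ^ h\<close> times its weight, and the weights are summed from
  the state in which only \<open>i\<close> is explored.\<close>

lemma EE_chain_mat_le:
  assumes L: "\<forall>B\<in>set L. wf_block n d len cC cU B \<and> block_bound len \<beta> B" "\<beta> \<ge> 0"
    and room: "1 + d * (length L * len) \<le> N" "length L * len \<le> N"
    and R: "2 * length L \<le> R" and h: "length L * (cC + 2 * cU) \<le> 2 * h" and i: "i < n"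
  shows "EE n d a b (\<lambda>\<sigma> H. chain_mat (eprob n d a b \<sigma>) H L i j) \<le> \<alpha> ^ h * \<beta> ^ length L"
proof -
  have "EE n d a b (\<lambda>\<sigma> H. chain_mat (eprob n d a b \<sigma>) H L i j)
    = chain_sum L i (\<lambda>c. EE n d a b (\<lambda>\<sigma> H. if endv i c = j then tw (eprob n d a b \<sigma>) H (map fst c) else 0))"
    unfolding chain_mat_def EE_chain_sum ..
  also have "\<dots> \<le> chain_sum L i (\<lambda>c. \<alpha> ^ h * wt ({i}, {}, {}) (map fst c))"
  proof (rule chain_sum_mono)
    fix c assume "c \<in> chains L i"
    then have c: "\<forall>q\<in>set (map fst c). snd q \<in> dsets n d"
      "nflag Cen (map fst c) = length L * cC" "nflag Unc (map fst c) = length L * cU"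
      "\<forall>e. count_list (unmid (map fst c)) e \<le> 2 * length L"
      using chainsD[of L n d len cC cU i c] L i by blast+
    have nn: "0 \<le> \<alpha> ^ h * wt ({i}, {}, {}) (map fst c)" using \<alpha> by simp
    show "EE n d a b (\<lambda>\<sigma> H. if endv i c = j then tw (eprob n d a b \<sigma>) H (map fst c) else 0)
      \<le> \<alpha> ^ h * wt ({i}, {}, {}) (map fst c)"
    proof (cases "endv i c = j")
      case True
      have "\<bar>EE n d a b (\<lambda>\<sigma> H. tw (eprob n d a b \<sigma>) H (map fst c))\<bar> \<le> \<alpha> ^ h * wt ({i}, {}, {}) (map fst c)"
      proof (rule EE_tw_bound[OF _ i])
        show "snd ` set (map fst c) \<subseteq> dsets n d" using c(1) by blast
        show "nflag Cen (map fst c) + 2 * nflag Unc (map fst c) \<le> 2 * h"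
          using h unfolding c(2,3) by (simp add: algebra_simps)
        show "count_list (unmid (map fst c)) e \<le> R" for e using c(4) R le_trans by blast
      qed
      then show ?thesis using True by simp
    next
      case False
      then show ?thesis using nn by (simp add: EE_def)
    qed
  qed
  also have "\<dots> = \<alpha> ^ h * chain_sum L i (\<lambda>c. wt ({i}, {}, {}) (map fst c))" by (rule chain_sum_mult)
  also have "\<dots> \<le> \<alpha> ^ h * \<beta> ^ length L"
    using \<alpha> chain_sum_wt_le[OF L, of "({i}, {}, {})" i] room i hforest.empty by (intro mult_left_mono) auto
  finally show ?thesis .
qed

text \<open>Markov's inequality for the trace, a sum over closed chains of 2 * 2 ^ Suc r blocks.
  Half of the weighted edge count cC + 2 cU over all blocks is the exponent of
  \<open>\<alpha>\<close>; two uses of an edge per block explain the condition on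
  \<open>R\<close>.\<close>

lemma hprob_specnorm:
  assumes B: "wf_block n d len cC cU B" "block_bound len \<beta> B"
    and B': "wf_block n d len cC cU B'" "block_bound len \<beta> B'" and \<beta>: "\<beta> \<ge> 0"
    and tr: "\<And>p H i j. i < n \<Longrightarrow> j < n \<Longrightarrow> block_mat p H B' j i = block_mat p H B i j"
    and room: "1 + d * (2 * 2 ^ Suc r * len) \<le> N" and R: "2 * (2 * 2 ^ Suc r) \<le> R"
    and n: "0 < n" and t: "0 < t"
  shows "hprob n d a b (\<lambda>\<sigma> H. \<not> specnorm n (block_mat (eprob n d a b \<sigma>) H B) \<le> t)
    \<le> real n * \<alpha> ^ (2 ^ Suc r * (cC + 2 * cU)) * \<beta> ^ (2 * 2 ^ Suc r) / t ^ (2 * 2 ^ Suc r)"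
proof -
  let ?L = "gram_blocks B' B (Suc r)"
  let ?F = "\<lambda>\<sigma> H. \<Sum>i<n. gram n (block_mat (eprob n d a b \<sigma>) H B) (Suc r) i i"
  have sz2: "2 * 2 ^ Suc r * len \<le> N"
  proof -
    have "2 * 2 ^ Suc r * len \<le> d * (2 * 2 ^ Suc r * len)" using d2 by (cases d) auto
    then show ?thesis using room by linarith
  qed
  have "hprob n d a b (\<lambda>\<sigma> H. \<not> specnorm n (block_mat (eprob n d a b \<sigma>) H B) \<le> t)
    \<le> EE n d a b ?F / t ^ (2 * 2 ^ Suc r)"
  proof (rule hprob_markov)
    show "0 \<le> ?F \<sigma> H" for \<sigma> H
      unfolding gram_Suc by (intro sum_nonneg zero_le_square)
  qed (use t n specnorm_power_le_trace in auto)
  also have "EE n d a b ?F = (\<Sum>i<n. EE n d a b (\<lambda>\<sigma> H. chain_mat (eprob n d a b \<sigma>) H ?L i i))"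
  proof -
    have "?F \<sigma> H = (\<Sum>i<n. chain_mat (eprob n d a b \<sigma>) H ?L i i)" for \<sigma> H
      by (intro sum.cong refl gram_chain_mat[OF B(1) B'(1) tr]) auto
    then show ?thesis unfolding EE_sum[symmetric] by simp
  qed
  also have "\<dots> \<le> (\<Sum>i<n. \<alpha> ^ (2 ^ Suc r * (cC + 2 * cU)) * \<beta> ^ (2 * 2 ^ Suc r))"
  proof (rule sum_mono)
    fix i assume "i \<in> {..<n}"
    then show "EE n d a b (\<lambda>\<sigma> H. chain_mat (eprob n d a b \<sigma>) H ?L i i)
       \<le> \<alpha> ^ (2 ^ Suc r * (cC + 2 * cU)) * \<beta> ^ (2 * 2 ^ Suc r)"
      using EE_chain_mat_le[of ?L len cC cU \<beta> "2 ^ Suc r * (cC + 2 * cU)" i i] B B' \<beta> room sz2 R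
      unfolding length_gram_blocks set_gram_blocks by (simp only:) auto
  qed
  finally show ?thesis using t by (simp add: divide_right_mono mult.assoc)
qed

end

section \<open>Choice of the constants\<close>

lemma tendsto_poly_ln:
  fixes N :: "nat \<Rightarrow> nat"
  assumes "(\<lambda>n. real (N n)) \<in> O(\<lambda>n. ln (real n))"
  shows "(\<lambda>n. c * real (N n) ^ p / real n) \<longlonglongrightarrow> 0"
proof -
  obtain D where D: "\<forall>\<^sub>F n in sequentially. norm (real (N n)) \<le> D * norm (ln (real n))"
    using landau_o.bigE[OF assms] by blast
  have "\<forall>\<^sub>F n in sequentially. norm (c * real (N n) ^ p / real n) \<le> \<bar>c\<bar> * D ^ p * (ln (real n) ^ p / real n)"
    using D eventually_ge_at_top[of 1]
  proof eventually_elim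
    case (elim n)
    then have "real (N n) ^ p \<le> (D * ln (real n)) ^ p" by (intro power_mono) auto
    then have "\<bar>c\<bar> * real (N n) ^ p / real n \<le> \<bar>c\<bar> * (D * ln (real n)) ^ p / real n"
      by (intro divide_right_mono mult_left_mono) auto
    then show ?case by (simp add: abs_mult power_mult_distrib mult.assoc)
  qed
  moreover have "(\<lambda>n::nat. ln (real n) ^ p / real n) \<longlonglongrightarrow> 0"
    by real_asymp
  then have "(\<lambda>n. \<bar>c\<bar> * D ^ p * (ln (real n) ^ p / real n)) \<longlonglongrightarrow> 0"
    by (rule tendsto_mult_right_zero)
  ultimately show ?thesis by (rule Lim_null_comparison)
qed

text \<open>The weight \<open>x\<close> of the excess edges, where \<open>3 d N\<^sup>2 = 1 / z\<close>.\<close>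

definition xval :: "nat \<Rightarrow> real \<Rightarrow> nat \<Rightarrow> nat \<Rightarrow> nat \<Rightarrow> real" where
  "xval d a n N R = (2 ^ (d - 1) + a) * (real (d - 1))\<^sup>2 * real N * real (3 * d * N * N) ^ R / real n"

text \<open>\<open>\<tau>\<close> normalises the tree steps and makes
  \<open>\<alpha> * \<tau>\<close> equal to \<open>pbar\<close>; \<open>z\<close> makes the revisit
  condition an equality. An excess edge is not averaged over spins, and \<open>pn n d a\<close> is
  at most 2^(d-1) times \<open>pbar\<close>: this factor and the prepaid z^R determine
  \<open>y\<close>. Middle edges get the weight \<open>pn n d a\<close> itself.\<close>

lemma moment_instance:
  fixes d n N R :: nat and a b \<alpha> :: real
  defines "C \<equiv> real (n choose (d - 1))" and "z \<equiv> 1 / real (3 * d * N * N)"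
  defines "\<tau> \<equiv> 1 / (real (d - 1) * C)"
  defines "y \<equiv> 2 ^ (d - 1) * \<tau> / z ^ R"
  assumes d: "d \<ge> 3" and ab: "b > 0" "a \<ge> b" and \<alpha>: "\<alpha> \<ge> 1"
    "\<alpha> = real (d - 1) * (a + (2 ^ (d - 1) - 1) * b) / 2 ^ (d - 1)"
    and n: "n \<ge> d" "a * real (d - 1) \<le> real n" and N: "N \<ge> 1"
    and x: "real N * (real (3 * N) * xval d a n N R) \<le> 1"
  shows "moment n d N \<tau> y z (a / C) (xval d a n N R) (a * real (d - 1)) a b \<alpha> R"
proof -
  let ?k = "real (d - 1)"
  have a: "a > 0" using ab by linarith
  have k: "?k \<ge> 1" using d by simp
  have n0: "real n > 0" using n d by simp
  have z: "0 < z" "z \<le> 1"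
  proof -
    have "1 \<le> 3 * d * N * N" using d N by simp
    then have "1 \<le> real (3 * d * N * N)" by linarith
    then show "0 < z" "z \<le> 1" unfolding z_def
      by (auto simp only: zero_less_divide_iff divide_le_eq_1_pos intro: less_le_trans[OF zero_less_one])
  qed
  have zR: "0 < z ^ R" "z ^ R \<le> 1" using z by (auto simp: power_le_one)
  have C0: "C > 0" using n d unfolding C_def by simp
  have aC: "a \<le> C"
  proof -
    have nk: "1 \<le> real n / ?k" using n k by simp
    have "a \<le> real n / ?k" using n(2) k by (simp add: field_simps)
    also have "\<dots> \<le> (real n / ?k) ^ (d - 1)"
      using nk d by (intro self_le_power) auto
    also have "\<dots> \<le> C" unfolding C_def by (rule binomial_ge_n_over_k_pow_k) (use n in simp)
    finally show ?thesis .
  qed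
  have C1: "real ((n - 1) choose (d - 1)) \<le> C"
    unfolding C_def by (intro of_nat_mono binomial_right_mono) simp
  \<comment> \<open>By absorption, n times binomial (n - 1, d - 2) is d - 1 times binomial (n, d -
    1). Prescribing a second vertex thus gains a factor of order 1 / n.\<close>
  have C2: "real ((n - 2) choose (d - 2)) \<le> ?k * C / real n"
  proof -
    have "(n - 2) choose (d - 2) \<le> (n - 1) choose (d - 2)" by (intro binomial_right_mono) simp
    then have "n * ((n - 2) choose (d - 2)) \<le> n * ((n - 1) choose (d - 2))" by simp
    also have "\<dots> = (d - 1) * (n choose (d - 1))"
      using times_binomial_minus1_eq[of "d - 1" n] d by (simp add: numeral_2_eq_2)
    finally have "real (n * ((n - 2) choose (d - 2))) \<le> real ((d - 1) * (n choose (d - 1)))"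
      by (rule of_nat_mono)
    then show ?thesis unfolding C_def using n0 by (simp add: field_simps)
  qed
  have x_eq: "xval d a n N R = (2 ^ (d - 1) + a) * ?k\<^sup>2 * real N / z ^ R / real n"
    unfolding xval_def z_def by (simp add: power_one_over)
  have \<tau>: "\<tau> \<ge> 0" "?k * C * \<tau> = 1" using C0 k unfolding \<tau>_def by auto
  have y0: "y \<ge> 0" unfolding y_def using \<tau> zR by simp
  have x0: "xval d a n N R \<ge> 0" unfolding x_eq using a zR by simp
  show ?thesis
  proof unfold_locales
    show "2 \<le> d" using d by simp
    show "0 \<le> \<tau>" "0 \<le> y" "0 \<le> z" "0 \<le> xval d a n N R" "0 < z" "z \<le> 1" "b > 0" "b \<le> a" "\<alpha> \<ge> 1"
      using \<tau> y0 z x0 ab \<alpha> by auto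
    show "0 \<le> a / C" "0 \<le> a * ?k" using a C0 by auto
    have "\<tau> * (?k * real ((n - 1) choose (d - 1))) \<le> \<tau> * (?k * C)"
      using C1 \<tau> k by (intro mult_left_mono) auto
    also have "\<dots> = 1" using \<tau>(2) by (simp only: mult_ac)
    finally show "\<tau> * real ((d - 1) * ((n - 1) choose (d - 1))) \<le> 1" by (simp only: of_nat_mult)
    have "a / C * (?k * real ((n - 1) choose (d - 1))) \<le> a / C * (?k * C)"
      using C1 a C0 k by (intro mult_left_mono) auto
    then show "a / C * real ((d - 1) * ((n - 1) choose (d - 1))) \<le> a * ?k" using C0 by simp
    have NC: "real (N * ((d - 1) * ((n - 2) choose (d - 2)))) \<le> real N * (?k * (?k * C / real n))"
      unfolding of_nat_mult using C2 k by (intro mult_left_mono) auto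
    have "y * real (N * ((d - 1) * ((n - 2) choose (d - 2)))) \<le> y * (real N * (?k * (?k * C / real n)))"
      using NC y0 by (rule mult_left_mono)
    also have "\<dots> = ?k * C * \<tau> * (2 ^ (d - 1) * ?k * real N / z ^ R / real n)"
      unfolding y_def by (simp only: times_divide_eq_right times_divide_eq_left divide_divide_eq_left mult_ac)
    also have "\<dots> = 2 ^ (d - 1) * ?k * real N / z ^ R / real n" unfolding \<tau>(2) by simp
    \<comment> \<open>The sum 2^(d-1) + a in \<open>xval\<close> serves both kinds of excess:
      2^(d-1) is the constant here, \<open>a\<close> the one for middle edges.\<close>
    also have "\<dots> \<le> xval d a n N R"
      unfolding x_eq
    proof (intro divide_right_mono mult_right_mono)
      have "?k * 1 \<le> ?k * ?k" using k by (intro mult_left_mono) linarith+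
      then have "2 ^ (d - 1) * ?k \<le> (2 ^ (d - 1) + a) * (?k * ?k)"
        using k a by (intro mult_mono) (simp_all only: mult_1_right, auto)
      then show "2 ^ (d - 1) * ?k \<le> (2 ^ (d - 1) + a) * ?k\<^sup>2" by (simp add: power2_eq_square)
    qed (use zR n0 in auto)
    finally show "y * real (N * ((d - 1) * ((n - 2) choose (d - 2)))) \<le> xval d a n N R" .
    have "a / C * real (N * ((d - 1) * ((n - 2) choose (d - 2)))) \<le> a / C * (real N * (?k * (?k * C / real n)))"
      using NC a C0 by (intro mult_left_mono) auto
    also have "\<dots> = a * ?k\<^sup>2 * real N / real n"
      using C0 by (simp add: field_simps power2_eq_square)
    also have "\<dots> \<le> (2 ^ (d - 1) + a) * ?k\<^sup>2 * real N / real n"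
      using n0 by (intro divide_right_mono mult_right_mono) auto
    also have "\<dots> \<le> (2 ^ (d - 1) + a) * ?k\<^sup>2 * real N / z ^ R / real n"
    proof (rule divide_right_mono)
      have "(2 ^ (d - 1) + a) * ?k\<^sup>2 * real N * z ^ R \<le> (2 ^ (d - 1) + a) * ?k\<^sup>2 * real N * 1"
        using zR a by (intro mult_left_mono) auto
      then show "(2 ^ (d - 1) + a) * ?k\<^sup>2 * real N \<le> (2 ^ (d - 1) + a) * ?k\<^sup>2 * real N / z ^ R"
        using zR by (simp add: pos_le_divide_eq)
    qed simp
    finally show "a / C * real (N * ((d - 1) * ((n - 2) choose (d - 2)))) \<le> xval d a n N R"
      unfolding x_eq .
    show "z * real (N * d) * real (3 * N) \<le> 1" unfolding z_def using N d by (simp add: field_simps)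
    show "real N * (real (3 * N) * xval d a n N R) \<le> 1" by (rule x)
    show "pn n d a \<le> 1" "pn n d a \<le> a / C" unfolding pn_def using aC C0 by (auto simp: C_def)
    have \<alpha>\<tau>: "\<alpha> * \<tau> = (a + (2 ^ (d - 1) - 1) * b) / 2 ^ (d - 1) / C"
      unfolding \<alpha>(2) \<tau>_def using k by simp
    show "pbar n d a b \<le> \<alpha> * \<tau>"
      unfolding \<alpha>\<tau> pbar_def pn_def C_def[symmetric] using C0 by (simp add: field_simps)
    have "\<alpha> * (y * z ^ R) = 2 ^ (d - 1) * (\<alpha> * \<tau>)" unfolding y_def using zR z by simp
    also have "\<dots> = (a + (2 ^ (d - 1) - 1) * b) / C" unfolding \<alpha>\<tau> by simp
    also have "\<dots> \<ge> a / C" using ab C0 by (intro divide_right_mono) auto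
    finally show "pn n d a \<le> \<alpha> * (y * z ^ R)" unfolding pn_def C_def .
  qed
qed

text \<open>\<open>e\<close> is l for Delta and l + m for Gamma; \<open>s\<close> is 0 or 1, the
  extra power of 1 / n in the threshold. Since K \<epsilon> >= 1, the threshold to the power 2 K
  contains n^2 besides the effect of \<open>s\<close>. The trace uses up one n, and the spare 1 / n
  absorbs the polylogarithmic factors.\<close>

lemma threshold_bound:
  fixes n K h e s :: nat and \<epsilon> \<alpha> \<beta> :: real
  assumes n: "n \<ge> 1" and \<alpha>: "\<alpha> \<ge> 1" and K: "real K * \<epsilon> \<ge> 1" and h: "h \<le> K * e" and \<beta>: "\<beta> \<ge> 0"
  shows "real n * \<alpha> ^ h * \<beta> ^ (2 * K) / (real n powr (\<epsilon> - real s) * \<alpha> powr (real e / 2)) ^ (2 * K)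
     \<le> (real n ^ s * \<beta>) ^ (2 * K) / real n"
proof -
  have n0: "real n > 0" using n by simp
  have t: "(real n powr (\<epsilon> - real s) * \<alpha> powr (real e / 2)) ^ (2 * K)
    = real n powr (2 * (real K * \<epsilon>)) / real n ^ (s * (2 * K)) * \<alpha> ^ (K * e)"
  proof -
    have "(real n powr (\<epsilon> - real s)) ^ (2 * K) = real n powr (2 * (real K * \<epsilon>) - real (s * (2 * K)))"
      using n0 by (simp add: powr_power algebra_simps)
    also have "\<dots> = real n powr (2 * (real K * \<epsilon>)) / real n ^ (s * (2 * K))"
      using n0 by (simp add: powr_diff powr_realpow del: of_nat_mult)
    finally have 1: "(real n powr (\<epsilon> - real s)) ^ (2 * K) = real n powr (2 * (real K * \<epsilon>)) / real n ^ (s * (2 * K))" .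
    have "(\<alpha> powr (real e / 2)) ^ (2 * K) = \<alpha> powr (real (K * e))"
      using \<alpha> by (simp add: powr_power algebra_simps)
    also have "\<dots> = \<alpha> ^ (K * e)" using \<alpha> by (intro powr_realpow) simp
    finally show ?thesis using 1 by (simp add: power_mult_distrib)
  qed
  have "real n ^ 2 = real n powr 2" using n0 by simp
  also have "\<dots> \<le> real n powr (2 * (real K * \<epsilon>))" using K n by (intro powr_mono) auto
  finally have p: "real n ^ 2 \<le> real n powr (2 * (real K * \<epsilon>))" .
  have "real n * \<alpha> ^ h * \<beta> ^ (2 * K) / (real n powr (\<epsilon> - real s) * \<alpha> powr (real e / 2)) ^ (2 * K)
    = real n * \<alpha> ^ h * \<beta> ^ (2 * K) * real n ^ (s * (2 * K)) / (real n powr (2 * (real K * \<epsilon>)) * \<alpha> ^ (K * e))"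
    unfolding t by simp
  also have "\<dots> \<le> real n * \<alpha> ^ (K * e) * \<beta> ^ (2 * K) * real n ^ (s * (2 * K)) / (real n ^ 2 * \<alpha> ^ (K * e))"
  proof (rule frac_le)
    show "real n * \<alpha> ^ h * \<beta> ^ (2 * K) * real n ^ (s * (2 * K))
      \<le> real n * \<alpha> ^ (K * e) * \<beta> ^ (2 * K) * real n ^ (s * (2 * K))"
      using h \<alpha> \<beta> by (intro mult_right_mono mult_left_mono power_increasing) auto
    show "real n ^ 2 * \<alpha> ^ (K * e) \<le> real n powr (2 * (real K * \<epsilon>)) * \<alpha> ^ (K * e)"
      using p \<alpha> by (intro mult_right_mono) auto
  qed (use n0 \<alpha> \<beta> in auto)
  also have "\<dots> = (real n ^ s * \<beta>) ^ (2 * K) / real n"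
    unfolding power_mult_distrib power_mult[of "real n" s] using n0 \<alpha> by (simp add: power2_eq_square)
  finally show ?thesis .
qed

lemma specnorm_cong:
  assumes "\<And>i j. i < n \<Longrightarrow> j < n \<Longrightarrow> M i j = M' i j"
  shows "specnorm n M = specnorm n M'"
proof -
  have "(\<Sum>i<n. (\<Sum>j<n. M i j * x j)\<^sup>2) = (\<Sum>i<n. (\<Sum>j<n. M' i j * x j)\<^sup>2)" for x
    using assms by (intro sum.cong arg_cong[where f = "\<lambda>r. r\<^sup>2"]) auto
  then show ?thesis by (simp add: specnorm_def)
qed

section \<open>Bounds for a fixed number of vertices\<close>

text \<open>The moment of order \<open>4 * 2 ^ r\<close> is used for both matrices; \<open>N\<close> bounds the number of explored vertices.\<close>

locale bounds =
  fixes d :: nat and a b \<alpha> \<epsilon> :: real and n l r N :: nat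
  assumes d: "d \<ge> 3" and ab: "b > 0" "a \<ge> b" and \<alpha>: "\<alpha> \<ge> 1"
    "\<alpha> = real (d - 1) * (a + (2 ^ (d - 1) - 1) * b) / 2 ^ (d - 1)"
    and n: "n \<ge> d" "a * real (d - 1) \<le> real n"
    and N: "N = 1 + d * (2 * 2 ^ Suc r * l)"
    and x: "real N * (real (3 * N) * xval d a n N (4 * 2 ^ Suc r)) \<le> 1"
    and \<epsilon>: "real (2 ^ Suc r) * \<epsilon> \<ge> 1"
begin

abbreviation "C \<equiv> real (n choose (d - 1))"
abbreviation "z \<equiv> 1 / real (3 * d * N * N)"
abbreviation "\<tau> \<equiv> 1 / (real (d - 1) * C)"
text \<open>At most two uses of an edge in each of the 2 * 2 ^ Suc r blocks.\<close>

abbreviation "R \<equiv> 4 * 2 ^ Suc r"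
abbreviation "xv \<equiv> xval d a n N R"

sublocale moment n d N \<tau> "2 ^ (d - 1) * \<tau> / z ^ R" z "a / C" xv "a * real (d - 1)" a b \<alpha> R
  by (rule moment_instance) (use d ab \<alpha> n x in \<open>simp_all add: N\<close>)

lemma n_pos: "0 < n" "n \<ge> 1"
  using n d by auto

lemma l_le_N: "l \<le> N"
proof -
  have "1 * l \<le> (d * (2 * 2 ^ Suc r)) * l" using d by (intro mult_right_mono) auto
  also have "\<dots> \<le> N" unfolding N by (simp only: mult.assoc le_add2)
  finally show ?thesis by simp
qed

lemma hprob_Delta:
  "hprob n d a b (\<lambda>\<sigma> H. \<not> specnorm n (Delta n d a b l \<sigma> H) \<le> real n powr \<epsilon> * \<alpha> powr (real l / 2))
    \<le> real (3 * N) ^ (2 * 2 ^ Suc r) / real n"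
proof -
  let ?t = "real n powr \<epsilon> * \<alpha> powr (real l / 2)"
  let ?B = "saw_block n d Cen l"
  have wf: "wf_block n d l l 0 ?B" using wf_saw_block[of Cen n d l] by simp
  have bb: "block_bound l (real (3 * N)) ?B" by (rule block_bound_saw) simp
  have tr: "block_mat p H ?B j i = block_mat p H ?B i j" for p H i j
  proof (rule block_mat_transpose)
    show "c \<in> ?B v \<Longrightarrow> revw v c \<in> ?B (endv v c)" for v c by (rule saw_block_revw)
    then show "c \<in> ?B v \<Longrightarrow> revw v c \<in> ?B (endv v c)" for v c .
  qed (simp_all add: saw_block_def)
  have eq: "specnorm n (Delta n d a b l \<sigma> H) = specnorm n (block_mat (eprob n d a b \<sigma>) H ?B)" for \<sigma> H
    by (rule specnorm_cong) (simp add: Delta_eq)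
  have "hprob n d a b (\<lambda>\<sigma> H. \<not> specnorm n (block_mat (eprob n d a b \<sigma>) H ?B) \<le> ?t)
    \<le> real n * \<alpha> ^ (2 ^ Suc r * (l + 2 * 0)) * real (3 * N) ^ (2 * 2 ^ Suc r) / ?t ^ (2 * 2 ^ Suc r)"
    by (rule hprob_specnorm[OF wf bb wf bb _ tr]) (use N n_pos \<alpha>(1) in auto)
  also have "\<dots> \<le> (real n ^ 0 * real (3 * N)) ^ (2 * 2 ^ Suc r) / real n"
    using threshold_bound[OF n_pos(2) \<alpha>(1) \<epsilon>, of "2 ^ Suc r * (l + 2 * 0)" l "real (3 * N)" 0]
    by simp
  finally show ?thesis unfolding eq by simp
qed

lemma hprob_Gamma:
  assumes m: "m \<in> {1..l}"
  defines "\<beta> \<equiv> real (3 * N) * (xv * real (3 * N) + a * real (d - 1) * (real N * (real (3 * N) * xv)))"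
  shows "hprob n d a b (\<lambda>\<sigma> H. \<not> specnorm n (Gamma_mat n d a b l m \<sigma> H)
      \<le> real n powr (\<epsilon> - 1) * \<alpha> powr ((real l + real m) / 2))
    \<le> (real n * \<beta>) ^ (2 * 2 ^ Suc r) / real n"
proof -
  let ?t = "real n powr (\<epsilon> - 1) * \<alpha> powr ((real l + real m) / 2)"
  let ?B = "crossing_block n d Cen (l - m) Unc (m - 1)" and ?B' = "crossing_block n d Unc (m - 1) Cen (l - m)"
  have len: "l - m + Suc (m - 1) = l" "m - 1 + Suc (l - m) = l" using m by auto
  \<comment> \<open>The block and its transpose have second pieces of different lengths
    \<open>q\<close>; enlarging \<open>q\<close> to \<open>N\<close> gives one bound for
    both.\<close>
  have mono: "real (3 * N) * (xv * real (3 * N) + a * real (d - 1) * (real q * (real (3 * N) * xv))) \<le> \<beta>"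
    if "q \<le> N" for q
    unfolding \<beta>_def using that nonneg(5,6) by (intro mult_left_mono add_left_mono mult_right_mono) auto
  have weaken: "block_bound l \<beta>' B \<Longrightarrow> \<beta>' \<le> \<beta> \<Longrightarrow> block_bound l \<beta> B" for \<beta>' B
    unfolding block_bound_def by (meson order_trans)
  have "m - 1 \<le> N" "l - m \<le> N" using l_le_N m by auto
  then have bb: "block_bound l \<beta> ?B" "block_bound l \<beta> ?B'"
    using weaken[OF block_bound_crossing[of Cen Unc "l - m" "m - 1", unfolded len] mono]
      weaken[OF block_bound_crossing[of Unc Cen "m - 1" "l - m", unfolded len] mono] by auto
  have wf: "wf_block n d l (l - m) (m - 1) ?B" "wf_block n d l (l - m) (m - 1) ?B'"
    using wf_crossing_block[of Cen Unc n d "l - m" "m - 1"] wf_crossing_block[of Unc Cen n d "m - 1" "l - m"]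
    unfolding len by auto
  have \<beta>0: "\<beta> \<ge> 0" using mono[of 0] nonneg(5) by (auto intro: order_trans[rotated])
  have tr: "block_mat p H ?B' j i = block_mat p H ?B i j" if "i < n" "j < n" for p H i j
    using that wf by (intro block_mat_transpose) (auto intro: crossing_block_revw simp: wf_block_def)
  have "hprob n d a b (\<lambda>\<sigma> H. \<not> specnorm n (block_mat (eprob n d a b \<sigma>) H ?B) \<le> ?t)
    \<le> real n * \<alpha> ^ (2 ^ Suc r * (l - m + 2 * (m - 1))) * \<beta> ^ (2 * 2 ^ Suc r) / ?t ^ (2 * 2 ^ Suc r)"
    by (rule hprob_specnorm[OF wf(1) bb(1) wf(2) bb(2) \<beta>0 tr]) (use N n_pos \<alpha>(1) in auto)
  also have "\<dots> \<le> (real n ^ 1 * \<beta>) ^ (2 * 2 ^ Suc r) / real n"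
  proof -
    \<comment> \<open>The origin of the exponent l + m: the weighted count (l - m) + 2 (m - 1) is l
      + m - 2.\<close>
    have "2 ^ Suc r * (l - m + 2 * (m - 1)) \<le> 2 ^ Suc r * (l + m)"
      using m by (intro mult_left_mono) auto
    from threshold_bound[OF n_pos(2) \<alpha>(1) \<epsilon> this \<beta>0, of 1] show ?thesis by simp
  qed
  finally show ?thesis by (simp add: Gamma_mat_def)
qed

end

section \<open>The limits\<close>

context
  fixes d :: nat and a b \<alpha> \<epsilon> :: real and L :: "nat \<Rightarrow> nat" and r :: nat
  assumes d: "d \<ge> 3" and ab: "b > 0" "a \<ge> b" and \<alpha>: "\<alpha> \<ge> 1"
    "\<alpha> = real (d - 1) * (a + (2 ^ (d - 1) - 1) * b) / 2 ^ (d - 1)"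
    and L: "(\<lambda>n. real (L n)) \<in> O(\<lambda>n. ln (real n))" and \<epsilon>: "real (2 ^ Suc r) * \<epsilon> \<ge> 1"
begin

text \<open>The start, plus \<open>d\<close> vertices for each of the L n steps of the 2 * 2 ^ Suc r
  blocks.\<close>

definition NL :: "nat \<Rightarrow> nat" where
  "NL n = 1 + d * (2 * 2 ^ Suc r * L n)"

lemma NL_bigo: "(\<lambda>n. real (NL n)) \<in> O(\<lambda>n. ln (real n))"
proof -
  have "(\<lambda>n::nat. 1 :: real) \<in> O(\<lambda>n. ln (real n))" by real_asymp
  moreover have "(\<lambda>n. real (d * (2 * 2 ^ Suc r)) * real (L n)) \<in> O(\<lambda>n. ln (real n))"
    using L by (subst cmult_in_bigo_iff) simp
  ultimately have "(\<lambda>n. 1 + real (d * (2 * 2 ^ Suc r)) * real (L n)) \<in> O(\<lambda>n. ln (real n))"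
    by (rule sum_in_bigo)
  then show ?thesis by (simp add: NL_def mult_ac)
qed

text \<open>Isolates the 1 / n in \<open>xval\<close>. As \<open>r\<close> does not depend on n, the
  rest is a fixed power of \<open>NL n\<close>, hence polylogarithmic.\<close>

lemma xval_NL:
  "\<exists>c\<ge>0. \<forall>n\<ge>1. real n * xval d a n (NL n) (4 * 2 ^ Suc r) = c * real (NL n) ^ (1 + 2 * (4 * 2 ^ Suc r))"
proof (intro exI conjI allI impI)
  show "0 \<le> (2 ^ (d - 1) + a) * (real (d - 1))\<^sup>2 * real (3 * d) ^ (4 * 2 ^ Suc r)"
    using ab by (intro mult_nonneg_nonneg) auto
  fix n :: nat assume "n \<ge> 1"
  have "real (3 * d * NL n * NL n) ^ (4 * 2 ^ Suc r)
    = real (3 * d) ^ (4 * 2 ^ Suc r) * real (NL n) ^ (2 * (4 * 2 ^ Suc r))"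
    unfolding power_mult[of "real (NL n)" 2] power_mult_distrib[symmetric] by (simp add: power2_eq_square mult_ac)
  then show "real n * xval d a n (NL n) (4 * 2 ^ Suc r) = (2 ^ (d - 1) + a) * (real (d - 1))\<^sup>2 * real (3 * d) ^ (4 * 2 ^ Suc r) * real (NL n) ^ (1 + 2 * (4 * 2 ^ Suc r))"
    using \<open>n \<ge> 1\<close> unfolding xval_def power_add by simp
qed

lemma eventually_bounds:
  "\<forall>\<^sub>F n in sequentially. bounds d a b \<alpha> \<epsilon> n (L n) r (NL n)"
proof -
  obtain c where c: "c \<ge> 0" "\<And>n. n \<ge> 1 \<Longrightarrow>
    real n * xval d a n (NL n) (4 * 2 ^ Suc r) = c * real (NL n) ^ (1 + 2 * (4 * 2 ^ Suc r))"
    using xval_NL by metis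
  \<comment> \<open>Two powers more than in \<open>xval_NL\<close>, for the factors N and 3 N in
    \<open>x_small\<close>.\<close>
  let ?p = "3 + 2 * (4 * 2 ^ Suc r)"
  have "(\<lambda>n. 3 * c * real (NL n) ^ ?p / real n) \<longlonglongrightarrow> 0"
    using tendsto_poly_ln[OF NL_bigo] .
  then have "\<forall>\<^sub>F n in sequentially. 3 * c * real (NL n) ^ ?p / real n < 1"
    by (rule order_tendstoD(2)) simp
  moreover have "\<forall>\<^sub>F n in sequentially. a * real (d - 1) \<le> real n"
    using filterlim_real_sequentially unfolding filterlim_at_top by blast
  ultimately show ?thesis using eventually_ge_at_top[of d]
  proof eventually_elim
    case (elim n)
    then have n1: "n \<ge> 1" using d by linarith
    have "real (NL n) * (real (3 * NL n) * xval d a n (NL n) (4 * 2 ^ Suc r))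
      = 3 * c * real (NL n) ^ ?p / real n"
    proof -
      have "xval d a n (NL n) (4 * 2 ^ Suc r) = c * real (NL n) ^ (1 + 2 * (4 * 2 ^ Suc r)) / real n"
        using c(2)[OF n1] n1 by (simp add: field_simps)
      moreover have "real (NL n) ^ ?p = real (NL n) * real (NL n) * real (NL n) ^ (1 + 2 * (4 * 2 ^ Suc r))"
        by (simp add: power_add numeral_3_eq_3)
      ultimately show ?thesis by simp
    qed
    then show ?case
      using elim d ab \<alpha> \<epsilon> by unfold_locales (auto simp: NL_def)
  qed
qed

lemma tendsto_Delta:
  "(\<lambda>n. hprob n d a b (\<lambda>\<sigma> H. specnorm n (Delta n d a b (L n) \<sigma> H) \<le> real n powr \<epsilon> * \<alpha> powr (real (L n) / 2)))
    \<longlonglongrightarrow> 1"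
proof (rule tendsto_sandwich)
  let ?E = "\<lambda>n \<sigma> H. specnorm n (Delta n d a b (L n) \<sigma> H) \<le> real n powr \<epsilon> * \<alpha> powr (real (L n) / 2)"
  let ?g = "\<lambda>n. 1 - 3 ^ (2 * 2 ^ Suc r) * real (NL n) ^ (2 * 2 ^ Suc r) / real n"
  show "\<forall>\<^sub>F n in sequentially. ?g n \<le> hprob n d a b (?E n)"
    using eventually_bounds
  proof eventually_elim
    case (elim n)
    interpret bounds d a b \<alpha> \<epsilon> n "L n" r "NL n" by fact
    show ?case using hprob_compl[of "?E n"] hprob_Delta by (simp add: power_mult_distrib)
  qed
  show "\<forall>\<^sub>F n in sequentially. hprob n d a b (?E n) \<le> 1"
    using eventually_bounds
  proof eventually_elim
    case (elim n)
    interpret bounds d a b \<alpha> \<epsilon> n "L n" r "NL n" by fact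
    show ?case by (rule hprob_le_one)
  qed
  show "?g \<longlonglongrightarrow> 1"
    using tendsto_diff[OF tendsto_const tendsto_poly_ln[OF NL_bigo]] by simp
qed simp

lemma tendsto_Gamma:
  "(\<lambda>n. hprob n d a b (\<lambda>\<sigma> H. \<forall>m\<in>{1..L n}. specnorm n (Gamma_mat n d a b (L n) m \<sigma> H)
      \<le> real n powr (\<epsilon> - 1) * \<alpha> powr ((real (L n) + real m) / 2)))
    \<longlonglongrightarrow> 1"
proof -
  obtain c where c: "c \<ge> 0" "\<And>n. n \<ge> 1 \<Longrightarrow>
    real n * xval d a n (NL n) (4 * 2 ^ Suc r) = c * real (NL n) ^ (1 + 2 * (4 * 2 ^ Suc r))"
    using xval_NL by metis
  let ?q = "1 + 2 * (4 * 2 ^ Suc r)" and ?K = "2 * 2 ^ Suc r :: nat"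
  let ?E = "\<lambda>n m \<sigma> H. specnorm n (Gamma_mat n d a b (L n) m \<sigma> H)
      \<le> real n powr (\<epsilon> - 1) * \<alpha> powr ((real (L n) + real m) / 2)"
  \<comment> \<open>9 comes from the two factors 3 N in \<open>\<beta>\<close> below, and the next
    factor from 1 + \<kappa> N <= (1 + \<kappa>) N with \<kappa> = a (d - 1).\<close>
  define c' where "c' = 9 * (1 + a * real (d - 1)) * c"
  \<comment> \<open>Each factor n \<beta> is at most c' N^(3 + q); the additional power of N pays
    for the union bound over at most N values of m.\<close>
  let ?g = "\<lambda>n. 1 - c' ^ ?K * real (NL n) ^ (1 + (3 + ?q) * ?K) / real n"
  show ?thesis
  proof (rule tendsto_sandwich)
    show "\<forall>\<^sub>F n in sequentially. ?g n \<le> hprob n d a b (\<lambda>\<sigma> H. \<forall>m\<in>{1..L n}. ?E n m \<sigma> H)"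
      using eventually_bounds
    proof eventually_elim
      case (elim n)
      interpret bounds d a b \<alpha> \<epsilon> n "L n" r "NL n" by fact
      let ?N = "real (NL n)" and ?xv = "xval d a n (NL n) (4 * 2 ^ Suc r)"
      let ?\<kappa> = "a * real (d - 1)"
      define \<beta> where "\<beta> = real (3 * NL n) * (?xv * real (3 * NL n) + ?\<kappa> * (?N * (real (3 * NL n) * ?xv)))"
      have N1: "?N \<ge> 1" by (simp add: NL_def)
      have \<kappa>: "?\<kappa> \<ge> 0" using ab by simp
      have xn: "real n * ?xv = c * ?N ^ ?q" using c(2) n_pos by simp
      have "real n * \<beta> = 9 * ?N\<^sup>2 * (1 + ?\<kappa> * ?N) * (real n * ?xv)"
        unfolding \<beta>_def by (simp add: algebra_simps power2_eq_square)
      also have "\<dots> \<le> 9 * ?N\<^sup>2 * ((1 + ?\<kappa>) * ?N) * (c * ?N ^ ?q)"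
        unfolding xn using N1 c(1) \<kappa> by (intro mult_right_mono mult_left_mono) (auto simp: algebra_simps)
      also have "\<dots> = c' * ?N ^ (3 + ?q)"
        unfolding c'_def by (simp add: power_add power2_eq_square numeral_3_eq_3)
      finally have \<beta>le: "real n * \<beta> \<le> c' * ?N ^ (3 + ?q)" .
      have \<beta>0: "0 \<le> real n * \<beta>" unfolding \<beta>_def using nonneg(5) \<kappa> by simp
      have "hprob n d a b (\<lambda>\<sigma> H. \<exists>m\<in>{1..L n}. \<not> ?E n m \<sigma> H) \<le> (\<Sum>m\<in>{1..L n}. hprob n d a b (\<lambda>\<sigma> H. \<not> ?E n m \<sigma> H))"
        by (rule hprob_Ex_le) simp
      also have "\<dots> \<le> (\<Sum>m\<in>{1..L n}. (real n * \<beta>) ^ ?K / real n)"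
        unfolding \<beta>_def by (intro sum_mono hprob_Gamma)
      also have "\<dots> = real (L n) * ((real n * \<beta>) ^ ?K / real n)" by simp
      also have "\<dots> \<le> ?N * ((c' * ?N ^ (3 + ?q)) ^ ?K / real n)"
      proof (rule mult_mono)
        show "(real n * \<beta>) ^ ?K / real n \<le> (c' * ?N ^ (3 + ?q)) ^ ?K / real n"
          by (rule divide_right_mono[OF power_mono[OF \<beta>le \<beta>0]]) simp
        show "0 \<le> (real n * \<beta>) ^ ?K / real n" using zero_le_power[OF \<beta>0] by simp
      qed (use l_le_N in auto)
      also have "\<dots> = c' ^ ?K * ?N ^ (1 + (3 + ?q) * ?K) / real n"
        unfolding power_mult_distrib power_add[of ?N 1] power_mult by simp
      finally show ?case using hprob_compl[of "\<lambda>\<sigma> H. \<forall>m\<in>{1..L n}. ?E n m \<sigma> H"] by simp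
    qed
    show "\<forall>\<^sub>F n in sequentially. hprob n d a b (\<lambda>\<sigma> H. \<forall>m\<in>{1..L n}. ?E n m \<sigma> H) \<le> 1"
      using eventually_bounds
    proof eventually_elim
      case (elim n)
      interpret bounds d a b \<alpha> \<epsilon> n "L n" r "NL n" by fact
      show ?case by (rule hprob_le_one)
    qed
    show "?g \<longlonglongrightarrow> 1"
      using tendsto_diff[OF tendsto_const[of 1] tendsto_poly_ln[OF NL_bigo, of "c' ^ ?K" "1 + (3 + ?q) * ?K"]]
      by (simp only: diff_zero)
  qed simp
qed

end

theorem theorem3p1:
  fixes d :: nat and a b :: real
  defines "\<alpha> \<equiv> real (d - 1) * (a + (2 ^ (d - 1) - 1) * b) / 2 ^ (d - 1)"
      and "\<beta> \<equiv> real (d - 1) * (a - b) / 2 ^ (d - 1)"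
  assumes "d \<ge> 3" and "a \<ge> b" and "b > 0" and "\<alpha> > 1" and "\<beta> > 1"
  shows "\<exists>\<Gamma> :: nat \<Rightarrow> nat \<Rightarrow> nat \<Rightarrow> (nat \<Rightarrow> int) \<Rightarrow> nat set set \<Rightarrow> mat.
    (\<forall>n l \<sigma> H i j. l \<ge> 1 \<and> \<sigma> \<in> spins n \<and> H \<subseteq> dsets n d \<and> i < n \<and> j < n \<longrightarrow>
        Bmat n d l H i j =
          Delta n d a b l \<sigma> H i j
          + (\<Sum>m=1..l. mmul n (mmul n (Delta n d a b (l - m) \<sigma> H) (Abar n d a b \<sigma>)) (Bmat n d (m - 1) H) i j)
          - (\<Sum>m=1..l. \<Gamma> n l m \<sigma> H i j))
    \<and> (\<forall>(L :: nat \<Rightarrow> nat) (\<epsilon> :: real).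
         (\<lambda>n. real (L n)) \<in> O(\<lambda>n. ln (real n)) \<and> \<epsilon> > 0 \<longrightarrow>
         ((\<lambda>n. hprob n d a b (\<lambda>\<sigma> H.
              specnorm n (Delta n d a b (L n) \<sigma> H) \<le> real n powr \<epsilon> * \<alpha> powr (real (L n) / 2)))
            \<longlonglongrightarrow> 1)
         \<and> ((\<lambda>n. hprob n d a b (\<lambda>\<sigma> H.
              \<forall>m\<in>{1..L n}. specnorm n (\<Gamma> n (L n) m \<sigma> H)
                 \<le> real n powr (\<epsilon> - 1) * \<alpha> powr ((real (L n) + real m) / 2)))
            \<longlonglongrightarrow> 1))"
proof (rule exI[of _ "\<lambda>n l m \<sigma> H. Gamma_mat n d a b l m \<sigma> H"], intro conjI allI impI)
  fix n l i j :: nat and \<sigma> H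
  assume "l \<ge> 1 \<and> \<sigma> \<in> spins n \<and> H \<subseteq> dsets n d \<and> i < n \<and> j < n"
  then show "Bmat n d l H i j = Delta n d a b l \<sigma> H i j
      + (\<Sum>m=1..l. mmul n (mmul n (Delta n d a b (l - m) \<sigma> H) (Abar n d a b \<sigma>)) (Bmat n d (m - 1) H) i j)
      - (\<Sum>m=1..l. Gamma_mat n d a b l m \<sigma> H i j)"
    by (intro Bmat_expansion) auto
next
  fix L :: "nat \<Rightarrow> nat" and \<epsilon> :: real
  assume "(\<lambda>n. real (L n)) \<in> O(\<lambda>n. ln (real n)) \<and> \<epsilon> > 0"
  then have L: "(\<lambda>n. real (L n)) \<in> O(\<lambda>n. ln (real n))" and \<epsilon>: "\<epsilon> > 0" by auto
  \<comment> \<open>The order of the moment depends on \<epsilon> alone, so the number of blocks in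
    a chain stays fixed as n grows.\<close>
  obtain r where "1 / \<epsilon> < 2 ^ r" using real_arch_pow[of 2 "1 / \<epsilon>"] by auto
  then have "1 \<le> 2 ^ r * \<epsilon>" using \<epsilon> by (simp add: field_simps)
  also have "\<dots> \<le> real (2 ^ Suc r) * \<epsilon>" using \<epsilon> by simp
  finally have r: "1 \<le> real (2 ^ Suc r) * \<epsilon>" .
  have \<alpha>: "\<alpha> \<ge> 1" using assms by simp
  show "(\<lambda>n. hprob n d a b (\<lambda>\<sigma> H.
      specnorm n (Delta n d a b (L n) \<sigma> H) \<le> real n powr \<epsilon> * \<alpha> powr (real (L n) / 2))) \<longlonglongrightarrow> 1"
    by (rule tendsto_Delta[OF assms(3,5,4) \<alpha> _ L r]) (simp add: \<alpha>_def)
  show "(\<lambda>n. hprob n d a b (\<lambda>\<sigma> H. \<forall>m\<in>{1..L n}. specnorm n (Gamma_mat n d a b (L n) m \<sigma> H)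
      \<le> real n powr (\<epsilon> - 1) * \<alpha> powr ((real (L n) + real m) / 2))) \<longlonglongrightarrow> 1"
    by (rule tendsto_Gamma[OF assms(3,5,4) \<alpha> _ L r]) (simp add: \<alpha>_def)
qed

end
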